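(* For every $\varepsilon>0$, $$g(n,m) = \begin{cases} \Theta\left(\frac{m^2}{\log^2 m}\right) & \text{ if } m \leq n \log n, \\[4pt] \binom{n}{2}-\Theta\left(\frac{n^3 \log n}{m}\right) & \text{ if } n \log n < m < n^{3/2-\varepsilon}. \end{cases}$$
   Context: For a family $\mathcal{H}$ of graphs, a graph is $\mathcal{H}$-universal if it contains a copy (as a not necessarily induced subgraph) of every graph in $\mathcal{H}$. Let $\mathcal{H}(n,m)$ be the family of all graphs on $n$ vertices with $m$ edges, and call a graph $(n,m)$-universal if it is $\mathcal{H}(n,m)$-universal. $g(n,m)$ denotes the minimum number of edges of an $(n,m)$-universal graph on $n$ vertices. $\log$ denotes the natural logarithm. $\Theta$ is the usual asymptotic notation: $a=\Theta(b)$ means there are positive constants $c,C$ with $cb\le a\le Cb$ (the constants may depend on $\varepsilon$). Floors and ceilings are omitted where not essential.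
   Formalization: The second case is stated for all n at least some n_0 depending on ε (it fails for small n, e.g. n=4, m=6, where g equals the binomial coefficient), and the first case is stated for m ≥ 2, where m^2/log^2 m is defined. *)

theory Defs
  imports Complex_Main "HOL-Library.Ramsey"
begin

type_synonym 'a graph = "'a set \<times> 'a set set"

abbreviation verts :: "'a graph \<Rightarrow> 'a set" where "verts G \<equiv> fst G"
abbreviation edges :: "'a graph \<Rightarrow> 'a set set" where "edges G \<equiv> snd G"

definition simple_graph :: "'a graph \<Rightarrow> bool" where
  "simple_graph G \<longleftrightarrow> finite (verts G) \<and> edges G \<subseteq> nsets (verts G) 2"

(* Copies are subgraph copies that need not be induced: non-edges of H may be
   mapped to edges of G. *)
definition contains_copy :: "'a graph \<Rightarrow> 'b graph \<Rightarrow> bool" where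
  "contains_copy G H \<longleftrightarrow>
     (\<exists>f. inj_on f (verts H) \<and> f ` verts H \<subseteq> verts G \<and> (\<forall>e\<in>edges H. f ` e \<in> edges G))"

definition universal :: "'b graph set \<Rightarrow> 'a graph \<Rightarrow> bool" where
  "universal \<H> G \<longleftrightarrow> (\<forall>H\<in>\<H>. contains_copy G H)"

(* Vertices are labelled by natural numbers; this loses nothing, since every finite
   graph is isomorphic to such a graph. *)
definition graph_family :: "nat \<Rightarrow> nat \<Rightarrow> nat graph set" where
  "graph_family n m = {H. simple_graph H \<and> card (verts H) = n \<and> card (edges H) = m}"

definition nm_universal :: "nat \<Rightarrow> nat \<Rightarrow> nat graph \<Rightarrow> bool" where
  "nm_universal n m G \<longleftrightarrow> universal (graph_family n m) G"

(* The least number exists: the complete graph on n vertices is (n,m)-universal. *)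
definition min_universal_edges :: "nat \<Rightarrow> nat \<Rightarrow> nat" where
  "min_universal_edges n m =
     (LEAST k. \<exists>G. simple_graph G \<and> card (verts G) = n \<and> nm_universal n m G
                  \<and> card (edges G) = k)"

end

theory Submission
  imports Defs "HOL-Real_Asymp.Real_Asymp"
begin

text \<open>Lower bounds: a universal graph with \<open>e\<close> edges has at most \<open>(2e + 1)\<^sup>q (e choose m)\<close> labelled
  copies of graphs with \<open>m\<close> edges on \<open>q\<close> vertices, and all \<open>(q choose 2) choose m\<close> such graphs must
  occur; take \<open>q = n\<close> in the dense and \<open>q = m / (2 log m)\<close> in the sparse range.

  Upper bounds: rank the vertices of the given graph by degree and group the ranks into classes.
  Give all vertices independent random labels and let the type of a vertex be determined by its
  own label and the labels of its neighbours, padded by dummy labels up to a number depending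
  only on the class. The expected number of vertices of each type is then the same for all
  graphs, and by Chebyshev's inequality there is a labelling for which all these numbers are
  close to the expectation. The host graph has that many vertices of each type, minus
  the error term, two of them being adjacent if their types are compatible, and the
  few remaining vertices are adjacent to everything.\<close>

subsection \<open>Counting copies\<close>

text \<open>The host is fixed before the guest is known, so it can only use statistics shared by all
  guests: hence the padding of patterns to a length that depends on the class alone. Chebyshev's
  inequality works as long as few vertices read a common label, which fails for labels of vertices
  of huge degree; ranks below a threshold \<open>s\<close> are therefore never read and are placed
  on free hosts, as are the guests exceeding the host counts. In the dense range \<open>L\<close> of
  \<open>2D\<close> labels are tracked, with \<open>D\<close> about \<open>4m/n\<close>. The labels
  read by a vertex miss a given one with probability at least 1/2, so each tracked label yields
  about \<open>n/D * n\<close> missing edges. There are \<open>2^L\<close> possible sets, each with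
  an error of about \<open>D * sqrt (2^L * n)\<close>, and \<open>m < n^(3/2 - \<epsilon>)\<close>
  is what permits \<open>L\<close> of order \<open>log n\<close>. In the sparse range ranks come in
  dyadic blocks, with the degree bound halving from block to block. The number of patterns has to
  stay below a small power of \<open>m\<close>; this forces \<open>L\<close> of order
  \<open>log m\<close>, hence the block unit \<open>k = m / L\<close> and an edge count of order
  \<open>k^2\<close>.\<close>

lemma min_universal_edges_le:
  assumes "simple_graph G" "card (verts G) = n" "nm_universal n m G"
  shows "min_universal_edges n m \<le> card (edges G)"
  unfolding min_universal_edges_def by (rule Least_le) (use assms in blast)

lemma min_universal_edges_attained:
  obtains G :: "nat graph" where "simple_graph G" "card (verts G) = n" "nm_universal n m G"
    "card (edges G) = min_universal_edges n m"
proof -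
  let ?P = "\<lambda>k. \<exists>G :: nat graph. simple_graph G \<and> card (verts G) = n \<and> nm_universal n m G
                  \<and> card (edges G) = k"
  let ?K = "({..<n}, nsets {..<n} 2)"
  have "contains_copy ?K H" if "H \<in> graph_family n m" for H
  proof -
    from that have H: "finite (verts H)" "edges H \<subseteq> nsets (verts H) 2" "card (verts H) = n"
      by (auto simp: graph_family_def simple_graph_def)
    from H obtain f where f: "bij_betw f (verts H) {..<n}"
      using finite_same_card_bij[of "verts H" "{..<n}"] by auto
    have "f ` e \<in> nsets {..<n} 2" if "e \<in> edges H" for e
    proof -
      have "e \<subseteq> verts H" "card e = 2" "finite e"
        using that H(2) by (auto simp: nsets_def)
      moreover have "inj_on f e"
        using \<open>e \<subseteq> verts H\<close> f by (auto simp: bij_betw_def intro: inj_on_subset)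
      ultimately show ?thesis
        using f by (auto simp: nsets_def bij_betw_def card_image)
    qed
    then show ?thesis
      unfolding contains_copy_def using f by (auto simp: bij_betw_def)
  qed
  then have "?P (card (edges ?K))"
    by (intro exI[of _ ?K]) (auto simp: simple_graph_def nm_universal_def universal_def)
  then have "?P (LEAST k. ?P k)"
    by (rule LeastI)
  then show thesis
    using that unfolding min_universal_edges_def by blast
qed

lemma finite_edges: "simple_graph G \<Longrightarrow> finite (edges G)"
  unfolding simple_graph_def by (meson finite_imp_finite_nsets finite_subset)

text \<open>An edge set on \<open>{..<q}\<close>, padded by isolated vertices up to
  \<open>n\<close>, can be decoded from the image of its edges together with the embedding on its
  non-isolated vertices. Counting maps into the endpoints of edges of \<open>G\<close> plus one
  point, rather than into all \<open>n\<close> vertices, gives the factor \<open>(2e + 1)^q\<close>;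
  this matters in the sparse range, where \<open>n\<close> may far exceed \<open>m\<close>.\<close>

lemma universal_counting:
  fixes G :: "nat graph"
  assumes G: "simple_graph G" "card (verts G) = n" "nm_universal n m G" and "q \<le> n"
  shows "(q choose 2) choose m
      \<le> (2 * card (edges G) + 1) ^ q * (card (edges G) choose m)"
proof -
  define Y where "Y = \<Union> (edges G)"
  have fE: "finite (edges G)" using G(1) by (rule finite_edges)
  have e2: "card e = 2 \<and> finite e" if "e \<in> edges G" for e
    using G(1) that by (auto simp: simple_graph_def nsets_def)
  have fY: "finite Y" unfolding Y_def using fE e2 by auto
  have cY: "card Y \<le> 2 * card (edges G)"
  proof -
    have "card Y \<le> (\<Sum>e\<in>edges G. card e)"
      unfolding Y_def by (rule card_Union_le_sum_card)
    also have "\<dots> = 2 * card (edges G)" using e2 by simp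
    finally show ?thesis .
  qed
  \<comment> \<open>Isolated vertices are sent to a point \<open>z\<close> outside every edge, so
    that decoding creates no spurious edges.\<close>
  obtain z where z: "z \<notin> Y" using fY ex_new_if_finite infinite_UNIV_nat by blast
  define Hs where "Hs = {E. E \<subseteq> nsets {..<q} 2 \<and> card E = m}"
  define F where "F = ({..<q} \<rightarrow>\<^sub>E insert z Y)"
  define M where "M = {E. E \<subseteq> edges G \<and> card E = m}"
  define \<Psi> where "\<Psi> = (\<lambda>(f :: nat \<Rightarrow> nat, E). {p \<in> nsets {..<q} 2. f ` p \<in> E})"
  have fq: "finite (nsets {..<q} 2)" by (simp add: finite_imp_finite_nsets)
  have "Hs \<subseteq> \<Psi> ` (F \<times> M)"
  proof
    fix E assume "E \<in> Hs"
    then have E: "E \<subseteq> nsets {..<q} 2" "card E = m" by (auto simp: Hs_def)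
    have "E \<subseteq> nsets {..<n} 2" using E(1) \<open>q \<le> n\<close> by (force simp: nsets_def)
    then have "({..<n}, E) \<in> graph_family n m"
      using E by (auto simp: graph_family_def simple_graph_def)
    then have "contains_copy G ({..<n}, E)"
      using G(3) by (auto simp: nm_universal_def universal_def)
    then obtain f where f: "inj_on f {..<n}" "\<And>e. e \<in> E \<Longrightarrow> f ` e \<in> edges G"
      by (auto simp: contains_copy_def)
    define f' where "f' = restrict (\<lambda>v. if v \<in> \<Union>E then f v else z) {..<q}"
    have UE: "\<Union>E \<subseteq> {..<q}" using E(1) by (auto simp: nsets_def)
    have "f v \<in> Y" if "v \<in> \<Union>E" for v using that f(2) unfolding Y_def by blast
    then have 1: "f' \<in> F" unfolding F_def f'_def by auto
    have "inj_on ((`) f) E"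
    proof (rule inj_on_image)
      show "inj_on f (\<Union> E)"
        using f(1) UE \<open>q \<le> n\<close> by (meson inj_on_subset lessThan_subset_iff subset_trans)
    qed
    then have 2: "(`) f ` E \<in> M" using E f(2) by (auto simp: M_def card_image)
    have f'_eq: "f' ` p = f ` p" if "p \<subseteq> \<Union>E" for p
      using that UE by (intro image_cong) (auto simp: f'_def)
    have "E = \<Psi> (f', (`) f ` E)"
    proof (rule set_eqI, rule iffI)
      fix p assume p: "p \<in> E"
      then have "f' ` p = f ` p" using f'_eq by blast
      then show "p \<in> \<Psi> (f', (`) f ` E)" using p E(1) by (auto simp: \<Psi>_def)
    next
      fix p assume "p \<in> \<Psi> (f', (`) f ` E)"
      then have p: "p \<in> nsets {..<q} 2" "f' ` p \<in> (`) f ` E" by (auto simp: \<Psi>_def)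
      then obtain p2 where p2: "p2 \<in> E" "f' ` p = f ` p2" by auto
      have "z \<notin> f ` p2" using z f(2) p2(1) unfolding Y_def by blast
      have pU: "p \<subseteq> \<Union>E"
      proof
        fix v assume v: "v \<in> p"
        then have "f' v \<noteq> z" using p2(2) \<open>z \<notin> f ` p2\<close> by (metis imageI)
        moreover have "v < q" using v p(1) by (auto simp: nsets_def)
        ultimately show "v \<in> \<Union>E" by (auto simp: f'_def split: if_splits)
      qed
      then have "f ` p = f ` p2" using f'_eq p2(2) by simp
      moreover have "p \<subseteq> {..<n}" "p2 \<subseteq> {..<n}" using pU UE p2(1) \<open>q \<le> n\<close> by fastforce+
      ultimately have "p = p2" using f(1) by (simp add: inj_on_image_eq_iff)
      then show "p \<in> E" using p2 by simp
    qed
    then show "E \<in> \<Psi> ` (F \<times> M)" using 1 2 by blast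
  qed
  moreover have fin: "finite (F \<times> M)"
    unfolding F_def M_def using fY fE by (auto intro!: finite_PiE)
  ultimately have "card Hs \<le> card (F \<times> M)"
    by (meson card_image_le card_mono finite_imageI order_trans)
  also have "\<dots> = (card Y + 1) ^ q * (card (edges G) choose m)"
    unfolding F_def M_def using fY z fE
    by (simp add: card_cartesian_product card_PiE n_subsets)
  also have "\<dots> \<le> (2 * card (edges G) + 1) ^ q * (card (edges G) choose m)"
    using cY by (intro mult_right_mono power_mono) auto
  also have "card Hs = (q choose 2) choose m"
    unfolding Hs_def using fq by (simp add: n_subsets)
  finally show ?thesis .
qed

section \<open>Lower bounds from the counting inequality\<close>

text \<open>Factor by factor this is \<open>(e - i) / (N - i) \<le> e / N\<close>, cross-multiplied
  so as to stay in the naturals.\<close>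

lemma binomial_ratio_le:
  fixes e N m :: nat
  assumes "e \<le> N"
  shows "(e choose m) * N ^ m \<le> (N choose m) * e ^ m"
proof (induction m)
  case (Suc m)
  have absorb: "Suc m * (a choose Suc m) = (a - m) * (a choose m)" for a :: nat
    using binomial_absorb_comp[of a m] Suc_times_binomial_eq[of "a - 1" m]
    by (cases a) (simp_all del: binomial_Suc_Suc mult_Suc add: mult.commute)
  have le: "(e - m) * N \<le> (N - m) * e"
    using assms by (simp add: diff_mult_distrib diff_mult_distrib2 mult.commute diff_le_mono2)
  have "Suc m * ((e choose Suc m) * N ^ Suc m) = (Suc m * (e choose Suc m)) * (N * N ^ m)"
    by (simp only: power_Suc mult_ac)
  also have "\<dots> = ((e - m) * N) * ((e choose m) * N ^ m)"
    by (simp only: absorb mult_ac)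
  also have "\<dots> \<le> ((N - m) * e) * ((N choose m) * e ^ m)"
    using le Suc.IH by (rule mult_le_mono)
  also have "\<dots> = ((N - m) * (N choose m)) * (e * e ^ m)"
    by (simp only: mult_ac)
  also have "\<dots> = (Suc m * (N choose Suc m)) * (e * e ^ m)"
    by (simp only: absorb)
  also have "\<dots> = Suc m * ((N choose Suc m) * e ^ Suc m)"
    by (simp only: power_Suc mult_ac)
  finally show ?case by (simp del: mult_Suc)
qed auto

lemma universal_edges_power_bound:
  fixes G :: "nat graph"
  assumes G: "simple_graph G" "card (verts G) = n" "nm_universal n m G" and "q \<le> n"
    and "m \<le> q choose 2" "card (edges G) \<le> q choose 2"
  shows "(q choose 2) ^ m \<le> (2 * card (edges G) + 1) ^ q * card (edges G) ^ m"
proof -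
  let ?e = "card (edges G)" and ?N = "q choose 2"
  have "(?N choose m) * ?N ^ m \<le> ((2 * ?e + 1) ^ q * (?e choose m)) * ?N ^ m"
    using universal_counting[OF G \<open>q \<le> n\<close>] by (rule mult_le_mono1)
  also have "\<dots> \<le> (2 * ?e + 1) ^ q * ((?N choose m) * ?e ^ m)"
    using binomial_ratio_le[OF assms(6), of m] by (simp add: mult.assoc)
  also have "\<dots> = (?N choose m) * ((2 * ?e + 1) ^ q * ?e ^ m)"
    by (simp add: algebra_simps)
  finally show ?thesis using assms(5) by simp
qed

lemma universal_edges_ge:
  fixes G :: "nat graph"
  assumes "simple_graph G" "nm_universal n m G" "m \<le> n choose 2"
  shows "m \<le> card (edges G)"
proof -
  have "m \<le> card (nsets {..<n} 2)" using assms(3) by simp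
  then obtain E where E: "E \<subseteq> nsets {..<n} 2" "card E = m"
    by (meson obtain_subset_with_card_n)
  then have "contains_copy G ({..<n}, E)"
    using assms(2) by (auto simp: nm_universal_def universal_def graph_family_def simple_graph_def)
  then obtain f where f: "inj_on f {..<n}" "\<And>e. e \<in> E \<Longrightarrow> f ` e \<in> edges G"
    by (auto simp: contains_copy_def)
  have "inj_on ((`) f) E"
    by (rule inj_on_image) (use E(1) f(1) in \<open>auto simp: nsets_def intro: inj_on_subset\<close>)
  then have "card E \<le> card (edges G)"
    using finite_edges[OF assms(1)] f(2) by (intro card_inj_on_le[of "(`) f"]) auto
  then show ?thesis using E(2) by simp
qed

lemma two_times_choose_two: "2 * (n choose 2) = n * (n - 1)"
proof -
  have "even (n * (n - 1))" by (cases n) auto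
  then show ?thesis by (simp add: choose_two)
qed

text \<open>Take \<open>m\<close>-th roots in \<open>universal_edges_power_bound\<close>: for
  \<open>e \<le> N\<close> one has \<open>2e + 1 \<le> q^2\<close>, so the factor counting maps is
  at most \<open>exp (2 * q * ln q)\<close>. The parameter \<open>q\<close> trades the size of
  \<open>q choose 2\<close> against this factor.\<close>

lemma min_universal_edges_ge_exp:
  assumes "2 \<le> q" "q \<le> n" "1 \<le> m" "m \<le> q choose 2"
  shows "real (q choose 2) * exp (- (2 * q * ln q / m)) \<le> real (min_universal_edges n m)"
proof -
  obtain G :: "nat graph" where G: "simple_graph G" "card (verts G) = n" "nm_universal n m G"
    "card (edges G) = min_universal_edges n m"
    by (rule min_universal_edges_attained)
  define e where "e = min_universal_edges n m"
  define N where "N = q choose 2"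
  define t where "t = 2 * q * ln q / m"
  have t: "t \<ge> 0" using assms by (auto simp: t_def)
  show ?thesis
  proof (cases "e \<le> N")
    case False
    have "real N * exp (- t) \<le> real N * 1" using t by (intro mult_left_mono) auto
    also have "\<dots> \<le> e" using False by simp
    finally show ?thesis by (simp add: N_def e_def t_def)
  next
    case True
    have pw: "N ^ m \<le> (2 * e + 1) ^ q * e ^ m"
      using universal_edges_power_bound[OF G(1-3) assms(2,4)] True G(4) by (simp add: N_def e_def)
    have "2 * N = q * (q - 1)" unfolding N_def by (rule two_times_choose_two)
    then have "2 * N + 1 \<le> q * q"
      using assms(1) by (cases q) auto
    then have "(2 * e + 1) ^ q \<le> (q * q) ^ q" using True by (intro power_mono) auto
    then have "N ^ m \<le> (q * q) ^ q * e ^ m" using pw by (meson le_trans mult_le_mono1)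
    then have pw': "real N ^ m \<le> (real q * real q) ^ q * real e ^ m"
      by (metis of_nat_le_iff of_nat_mult of_nat_power)
    have "real q * real q = exp (2 * ln q)" using assms(1) by (simp add: exp_double power2_eq_square)
    then have "(real q * real q) ^ q = exp (t * m)"
      using assms(3) by (simp add: t_def mult_ac flip: exp_of_nat_mult)
    then have "real N ^ m * exp (- (t * m)) \<le> real e ^ m"
      using pw' by (simp add: exp_minus field_simps)
    moreover have "(real N * exp (- t)) ^ m = real N ^ m * exp (- (t * m))"
      by (simp add: power_mult_distrib mult.commute flip: exp_of_nat_mult)
    ultimately have "(real N * exp (- t)) ^ m \<le> real e ^ m" by simp
    then have "real N * exp (- t) \<le> real e"
      using assms(3) by (subst (asm) power_mono_iff) auto
    then show ?thesis by (simp add: N_def e_def t_def)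
  qed
qed

text \<open>The case \<open>q = n\<close> with \<open>exp (- t) \<ge> 1 - t\<close>: the deficit is
  at most \<open>N * t\<close>, where \<open>N\<close> is at most \<open>n^2 / 2\<close>.\<close>

lemma dense_lower:
  assumes "2 \<le> n" "1 \<le> m" "m \<le> n choose 2"
  shows "real (n choose 2) - real (min_universal_edges n m) \<le> real n ^ 3 * ln n / m"
proof -
  define N where "N = real (n choose 2)"
  define t where "t = 2 * n * ln n / m"
  have N: "0 \<le> N" "2 * N \<le> real n * real n"
  proof -
    have "2 * (n choose 2) = n * (n - 1)" by (rule two_times_choose_two)
    then have "2 * (n choose 2) \<le> n * n" by simp
    then have "real (2 * (n choose 2)) \<le> real (n * n)" by (simp only: of_nat_le_iff)
    then show "2 * N \<le> real n * real n" by (simp add: N_def)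
  qed (simp add: N_def)
  have t: "t \<ge> 0" using assms by (auto simp: t_def)
  have "N * (1 - t) \<le> N * exp (- t)"
    using exp_ge_add_one_self[of "- t"] N by (intro mult_left_mono) auto
  also have "\<dots> \<le> min_universal_edges n m"
    using min_universal_edges_ge_exp[OF assms(1) _ assms(2,3)] by (simp add: N_def t_def)
  finally have "N - min_universal_edges n m \<le> N * t" by (simp add: algebra_simps)
  also have "\<dots> = (2 * N) * (n * ln n / m)" by (simp add: t_def)
  also have "\<dots> \<le> (real n * real n) * (n * ln n / m)"
    using N assms by (intro mult_right_mono) auto
  finally show ?thesis by (simp add: N_def power3_eq_cube)
qed

text \<open>Ensures that \<open>graph_family n m\<close> is nonempty; were it empty, every graph
  would be universal and the minimum 0, against the lower bound for small \<open>m\<close>.\<close>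

lemma le_choose_two_if_le_n_ln_n:
  assumes "2 \<le> m" "real m \<le> real n * ln n"
  shows "m \<le> n choose 2"
proof -
  have "(2 :: real) \<le> exp (3 / 4)"
    using exp_lower_Taylor_quadratic[of "3 / 4"] by (simp add: power2_eq_square)
  then have ln2: "ln (2 :: real) \<le> 3 / 4" by (metis exp_gt_zero ln_exp ln_le_cancel_iff zero_less_numeral)
  have ln4: "ln (4::real) = 2 * ln 2" using ln_realpow[of 2 2] by simp
  \<comment> \<open>The tangent of \<open>ln\<close> at 4, with \<open>ln 4 \<le> 3 / 2\<close>;
    this line is at most \<open>(n - 1) / 2\<close> from \<open>n = 4\<close> on, and the smaller
    \<open>n\<close> are checked one by one.\<close>
  have ln_le: "ln (real n) \<le> 3 / 2 + (real n / 4 - 1)" if "n > 0"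
  proof -
    have "ln (real n) = ln 4 + ln (real n / 4)" using that by (simp add: ln_div)
    also have "ln (real n / 4) \<le> real n / 4 - 1" using that by (intro ln_le_minus_one) auto
    finally show ?thesis using ln4 ln2 by linarith
  qed
  consider "n = 0" | "n = 1" | "n = 2" | "n = 3" | "n \<ge> 4" by linarith
  then show ?thesis
  proof cases
    case 4
    then have "real m < 4" using assms(2) ln_le by simp
    then show ?thesis using 4 by (simp add: choose_two)
  next
    case 5
    then have "ln (real n) \<le> (real n - 1) / 2" using ln_le by simp
    then have "real n * ln n \<le> real n * ((real n - 1) / 2)" by (intro mult_left_mono) auto
    then have "2 * real m \<le> real n * (real n - 1)" using assms(2) by simp
    also have "\<dots> = real (n * (n - 1))" using 5 by (simp add: of_nat_diff)
    also have "n * (n - 1) = 2 * (n choose 2)" by (rule two_times_choose_two[symmetric])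
    finally show ?thesis by simp
  next
    case 3
    then have "real m < 2" using assms(2) ln2 by simp
    then show ?thesis using assms(1) by simp
  qed (use assms in auto)
qed

text \<open>With \<open>q\<close> about \<open>m / (2 * ln m)\<close> the exponent
  \<open>2 * q * ln q / m\<close> is at most 1, so a constant fraction of \<open>q choose 2\<close>
  survives in \<open>min_universal_edges_ge_exp\<close>.\<close>

lemma sparse_lower_large:
  "\<exists>m0. \<forall>m n. m0 \<le> m \<and> real m \<le> real n * ln n \<longrightarrow>
     (1 / 200) * (real m ^ 2 / ln m ^ 2) \<le> min_universal_edges n m"
proof -
  have "eventually (\<lambda>m :: nat. real m / (2 * ln m) - 1 \<ge> real m / (4 * ln m)) at_top"
    by real_asymp
  moreover have "eventually (\<lambda>m :: nat. real m / (4 * ln m) \<ge> 2) at_top"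
    by real_asymp
  moreover have "eventually (\<lambda>m :: nat. (real m / (4 * ln m)) ^ 2 / 4 \<ge> real m) at_top"
    by real_asymp
  moreover have "eventually (\<lambda>m :: nat. m \<ge> 3) at_top" by (rule eventually_ge_at_top)
  ultimately have "eventually (\<lambda>m :: nat. real m / (2 * ln m) - 1 \<ge> real m / (4 * ln m) \<and>
      real m / (4 * ln m) \<ge> 2 \<and> (real m / (4 * ln m)) ^ 2 / 4 \<ge> real m \<and> m \<ge> 3) at_top"
    by eventually_elim simp
  then obtain m0 where m0: "\<And>m. m \<ge> m0 \<Longrightarrow> real m / (2 * ln m) - 1 \<ge> real m / (4 * ln m) \<and>
      real m / (4 * ln m) \<ge> 2 \<and> (real m / (4 * ln m)) ^ 2 / 4 \<ge> real m \<and> m \<ge> 3"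
    by (auto simp: eventually_at_top_linorder)
  show ?thesis
  proof (intro exI[of _ m0] allI impI)
    fix m n :: nat assume "m0 \<le> m \<and> real m \<le> real n * ln n"
    then have m: "real m \<le> real n * ln n" "m \<ge> 3" and
      a: "real m / (2 * ln m) - 1 \<ge> real m / (4 * ln m)" "real m / (4 * ln m) \<ge> 2"
        "(real m / (4 * ln m)) ^ 2 / 4 \<ge> real m"
      using m0[of m] by auto
    \<comment> \<open>Half of \<open>m / (2 * ln m)\<close>, a lower bound for \<open>q\<close> that
      absorbs the rounding.\<close>
    define y where "y = real m / (4 * ln m)"
    define q where "q = nat \<lfloor>real m / (2 * ln m)\<rfloor>"
    have lnm: "1 \<le> ln (real m)"
      using m(2) exp_le by (subst ln_ge_iff) auto
    have "real m / (2 * ln m) \<ge> 0" using lnm by simp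
    then have q: "real q \<le> real m / (2 * ln m)" "y \<le> real q"
      using a(1) unfolding q_def y_def by (simp_all add: of_nat_nat, linarith)
    have y2: "2 \<le> y" using a(2) by (simp add: y_def)
    have q2: "2 \<le> q" using q(2) y2 by linarith
    have qm: "real q \<le> real m"
    proof -
      have "real m / (2 * ln m) \<le> real m / 1" using lnm by (intro divide_left_mono) auto
      then show ?thesis using q(1) by simp
    qed
    have n0: "n > 0" using m by (cases n) auto
    \<comment> \<open>Here \<open>m \<le> n * ln n\<close> enters: if \<open>m > n\<close>, it gives
      \<open>m \<le> n * ln m\<close>.\<close>
    have qn: "q \<le> n"
    proof (cases "m \<le> n")
      case True
      then show ?thesis using qm by linarith
    next
      case False
      then have "ln (real n) \<le> ln (real m)" using n0 by simp
      then have "real n * ln n \<le> real n * ln m" by (intro mult_left_mono) auto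
      then have "real m \<le> real n * ln m" using m(1) by simp
      then have "real m / (2 * ln m) \<le> real n * ln m / (2 * ln m)"
        using lnm by (intro divide_right_mono) auto
      also have "\<dots> \<le> real n" using lnm by simp
      finally show ?thesis using q(1) by linarith
    qed
    have Nq: "y\<^sup>2 / 4 \<le> real (q choose 2)"
    proof -
      have "2 * (q choose 2) = q * (q - 1)" by (rule two_times_choose_two)
      then have "real (2 * (q choose 2)) = real (q * (q - 1))" by (simp only:)
      then have "2 * real (q choose 2) = real q * (real q - 1)" using q2 by (simp add: of_nat_diff)
      moreover have "real q * (real q - 1) \<ge> y * (y / 2)"
        using q(2) y2 by (intro mult_mono) auto
      ultimately show ?thesis by (simp add: power2_eq_square)
    qed
    have mN: "m \<le> q choose 2" using Nq a(3) by (simp add: y_def)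
    have "2 * q * ln q / m \<le> 1"
    proof -
      have "ln (real q) \<le> ln (real m)" using qm q2 by simp
      then have "real q * ln q \<le> (real m / (2 * ln m)) * ln m"
        using q(1) q2 lnm by (intro mult_mono) auto
      also have "\<dots> = real m / 2" using lnm by simp
      finally show ?thesis using m(2) by simp
    qed
    then have "exp (- 1) \<le> exp (- (2 * q * ln q / m))" by simp
    moreover have "1 / 3 \<le> exp (- 1 :: real)"
      using exp_le by (simp add: exp_minus field_simps)
    ultimately have ex: "1 / 3 \<le> exp (- (2 * q * ln q / m))" by linarith
    \<comment> \<open>The factors are \<open>1/16\<close> from \<open>y^2\<close>,
      \<open>1/4\<close> from \<open>Nq\<close> and \<open>1/3\<close> from
      \<open>exp (- 1)\<close>; their product is 1/192.\<close>
    have "(1 / 200) * (real m ^ 2 / ln m ^ 2) \<le> (y\<^sup>2 / 4) * (1 / 3)"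
      by (simp add: y_def power_divide power_mult_distrib divide_simps)
    also have "\<dots> \<le> real (q choose 2) * exp (- (2 * q * ln q / m))"
      using Nq ex by (intro mult_mono) auto
    also have "\<dots> \<le> min_universal_edges n m"
      using min_universal_edges_ge_exp[OF q2 qn _ mN] m(2) by simp
    finally show "(1 / 200) * (real m ^ 2 / ln m ^ 2) \<le> min_universal_edges n m" .
  qed
qed

lemma sparse_lower:
  "\<exists>c>0. \<forall>n m :: nat. 2 \<le> m \<and> real m \<le> real n * ln n \<longrightarrow>
     c * (real m ^ 2 / ln m ^ 2) \<le> min_universal_edges n m"
proof -
  obtain m0 where m0: "\<And>m n. m0 \<le> m \<Longrightarrow> real m \<le> real n * ln n \<Longrightarrow>
     (1 / 200) * (real m ^ 2 / ln m ^ 2) \<le> min_universal_edges n m"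
    using sparse_lower_large by blast
  \<comment> \<open>For \<open>m < m0\<close> the trivial lower bound \<open>m\<close> on the number
    of edges suffices: the second term makes \<open>c * m^2 / (ln m)^2 \<le> m\<close>
    there.\<close>
  define c where "c = min (1 / 200) ((ln 2)\<^sup>2 / (real m0 + 1))"
  have "c > 0" by (simp add: c_def)
  moreover have "c * (real m ^ 2 / ln m ^ 2) \<le> min_universal_edges n m"
    if m: "2 \<le> m" "real m \<le> real n * ln n" for m n :: nat
  proof (cases "m0 \<le> m")
    case True
    have "c * (real m ^ 2 / ln m ^ 2) \<le> (1 / 200) * (real m ^ 2 / ln m ^ 2)"
      by (rule mult_right_mono) (auto simp only: c_def min.cobounded1 intro!: divide_nonneg_nonneg zero_le_power2)
    then show ?thesis using m0[OF True m(2)] by linarith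
  next
    case False
    obtain G :: "nat graph" where G: "simple_graph G" "card (verts G) = n" "nm_universal n m G"
      "card (edges G) = min_universal_edges n m"
      by (rule min_universal_edges_attained)
    have "m \<le> min_universal_edges n m"
      using universal_edges_ge[OF G(1,3) le_choose_two_if_le_n_ln_n[OF m]] G(4) by simp
    have ln: "0 < ln (2 :: real)" "ln 2 \<le> ln (real m)" using m by auto
    have "c * (real m ^ 2 / ln m ^ 2) \<le> ((ln 2)\<^sup>2 / real m) * (real m ^ 2 / (ln 2)\<^sup>2)"
    proof (rule mult_mono)
      have "c \<le> (ln 2)\<^sup>2 / (real m0 + 1)" by (simp add: c_def)
      also have "\<dots> \<le> (ln 2)\<^sup>2 / real m"
        using False m by (intro divide_left_mono) auto
      finally show "c \<le> (ln 2)\<^sup>2 / real m" .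
      show "real m ^ 2 / ln m ^ 2 \<le> real m ^ 2 / (ln 2)\<^sup>2"
        using ln by (intro divide_left_mono power_mono mult_pos_pos) auto
    qed auto
    also have "\<dots> = real m" using m by (simp add: power2_eq_square)
    finally show ?thesis using \<open>m \<le> min_universal_edges n m\<close> by linarith
  qed
  ultimately show ?thesis by blast
qed

subsection \<open>Degree rankings and graphs of compatible types\<close>

lemma sum_degrees_le:
  assumes "simple_graph H"
  shows "(\<Sum>v\<in>verts H. card {w \<in> verts H. {v, w} \<in> edges H}) \<le> 2 * card (edges H)"
proof -
  let ?V = "verts H" and ?E = "edges H"
  have V: "finite ?V" and E: "?E \<subseteq> nsets ?V 2" and fE: "finite ?E"
    using assms finite_edges[OF assms] by (auto simp: simple_graph_def)
  have "(\<Sum>v\<in>?V. card {w \<in> ?V. {v, w} \<in> ?E}) \<le> (\<Sum>v\<in>?V. card {e \<in> ?E. v \<in> e})"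
  proof (rule sum_mono)
    fix v assume "v \<in> ?V"
    have "w \<noteq> v" if "{v, w} \<in> ?E" for w
      using that E by (auto simp: nsets_def)
    then have "inj_on (\<lambda>w. {v, w}) {w \<in> ?V. {v, w} \<in> ?E}"
      by (auto simp: inj_on_def doubleton_eq_iff)
    then show "card {w \<in> ?V. {v, w} \<in> ?E} \<le> card {e \<in> ?E. v \<in> e}"
      using fE by (intro card_inj_on_le[where f = "\<lambda>w. {v, w}"]) auto
  qed
  also have "\<dots> = 2 * card ?E"
  proof (rule sum_multicount[OF V fE], intro ballI)
    fix e assume "e \<in> ?E"
    then have "{i \<in> ?V. i \<in> e} = e" "card e = 2" using E by (auto simp: nsets_def)
    then show "card {i \<in> ?V. i \<in> e} = 2" by simp
  qed
  finally show ?thesis .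
qed

text \<open>Sort by decreasing degree: the \<open>Suc i\<close> vertices of rank at most
  \<open>i\<close> all have at least the degree of the one of rank \<open>i\<close>, and all degrees
  sum to at most \<open>2 * m\<close>.\<close>

lemma degree_ranking:
  assumes "simple_graph H" "card (verts H) = n" "card (edges H) = m"
  obtains g where "bij_betw g {..<n} (verts H)"
    "\<And>i. i < n \<Longrightarrow> Suc i * card {j. j < n \<and> {g i, g j} \<in> edges H} \<le> 2 * m"
proof -
  let ?V = "verts H" and ?E = "edges H"
  define d where "d = (\<lambda>v. card {w \<in> ?V. {v, w} \<in> ?E})"
  have V: "finite ?V" using assms by (auto simp: simple_graph_def)
  then obtain ys where ys: "set ys = ?V" "distinct ys" by (meson finite_distinct_list)
  define xs where "xs = sort_key (\<lambda>v. - int (d v)) ys"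
  have xs: "set xs = ?V" "distinct xs" using ys by (auto simp: xs_def)
  then have len: "length xs = n" using assms(2) distinct_card by fastforce
  have sorted: "sorted (map (\<lambda>v. - int (d v)) xs)" by (simp add: xs_def)
  have mono: "d (xs ! i) \<le> d (xs ! j)" if "j \<le> i" "i < n" for i j
    using sorted_nth_mono[OF sorted, of j i] that len by simp
  have bij: "bij_betw ((!) xs) {..<n} ?V"
    using bij_betw_nth[OF xs(2), of "{..<n}" ?V] xs len by simp
  have d_eq: "d (xs ! i) = card {j. j < n \<and> {xs ! i, xs ! j} \<in> ?E}" for i
  proof -
    have "{w \<in> ?V. {xs ! i, w} \<in> ?E} = (!) xs ` {j. j < n \<and> {xs ! i, xs ! j} \<in> ?E}"
      using bij by (auto simp: bij_betw_def)
    moreover have "inj_on ((!) xs) {j. j < n \<and> {xs ! i, xs ! j} \<in> ?E}"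
      using bij by (auto simp: bij_betw_def intro: inj_on_subset)
    ultimately show ?thesis unfolding d_def by (simp add: card_image)
  qed
  have "Suc i * d (xs ! i) \<le> 2 * m" if "i < n" for i
  proof -
    have "Suc i * d (xs ! i) = (\<Sum>j\<le>i. d (xs ! i))" by simp
    also have "\<dots> \<le> (\<Sum>j\<le>i. d (xs ! j))" by (rule sum_mono) (use mono that in auto)
    also have "\<dots> \<le> (\<Sum>j<n. d (xs ! j))" by (rule sum_mono2) (use that in auto)
    also have "\<dots> = (\<Sum>v\<in>?V. d v)" using bij by (rule sum.reindex_bij_betw)
    also have "\<dots> \<le> 2 * m" using sum_degrees_le[OF assms(1)] assms(3) by (simp add: d_def)
    finally show ?thesis .
  qed
  then show thesis using that[of "(!) xs"] bij d_eq by simp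
qed

text \<open>Ordering the vertices by decreasing degree makes the vertex of rank \<open>i\<close> have degree
  at most \<open>2m / (i + 1)\<close>; \<open>N i\<close> is the neighbourhood of that vertex.\<close>

definition ranked_nbhd :: "nat \<Rightarrow> nat \<Rightarrow> (nat \<Rightarrow> nat set) \<Rightarrow> bool" where
  "ranked_nbhd n m N \<longleftrightarrow> (\<forall>i<n. N i \<subseteq> {..<n} \<and> i \<notin> N i \<and> Suc i * card (N i) \<le> 2 * m
     \<and> (\<forall>j\<in>N i. i \<in> N j))"

definition typed_graph :: "nat \<Rightarrow> ('t \<Rightarrow> 't \<Rightarrow> bool) \<Rightarrow> (nat \<Rightarrow> 't) \<Rightarrow> nat graph" where
  "typed_graph n R \<theta> =
     ({..<n}, {{i, j} |i j. i < n \<and> j < n \<and> i \<noteq> j \<and> R (\<theta> i) (\<theta> j)})"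

lemma simple_typed_graph: "simple_graph (typed_graph n R \<theta>)"
  by (auto simp: simple_graph_def typed_graph_def nsets_def)

lemma extend_inj_to_bij:
  assumes "finite A" "finite B" "card A = card B" "inj_on h C" "C \<subseteq> A" "h ` C \<subseteq> B"
  obtains k where "bij_betw k A B" "\<And>x. x \<in> C \<Longrightarrow> k x = h x"
proof -
  have "card (A - C) = card (B - h ` C)"
    using assms by (simp add: card_Diff_subset card_image finite_subset)
  then obtain l where l: "bij_betw l (A - C) (B - h ` C)"
    using assms finite_same_card_bij by blast
  define k where "k = (\<lambda>x. if x \<in> C then h x else l x)"
  have "bij_betw k C (h ` C)"
    using assms(4) by (auto simp: bij_betw_def k_def inj_on_def)
  moreover have "bij_betw k (A - C) (B - h ` C)"
    using l by (subst bij_betw_cong[of _ k l]) (auto simp: k_def)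
  ultimately have "bij_betw k (C \<union> (A - C)) (h ` C \<union> (B - h ` C))"
    by (rule bij_betw_combine) auto
  then show thesis using that[of k] assms by (simp add: Un_absorb1 k_def)
qed

text \<open>\<open>\<theta>\<close> types the hosts once and for all, \<open>\<tau>\<close> the
  guests of one particular graph. A nonfree type has at most as many hosts as guests, so all its
  hosts can be filled by guests of the same type; the surplus guests go to \<open>free\<close>
  hosts. Compatibility with \<open>free\<close> is asked only of guests with a neighbour, so that
  isolated guests may have a type that is joined to nothing.\<close>

lemma min_universal_edges_le_typed:
  fixes R :: "'t \<Rightarrow> 't \<Rightarrow> bool"
  assumes sym: "\<And>a b. R a b \<Longrightarrow> R b a"
    and types: "\<And>N. ranked_nbhd n m N \<Longrightarrow> \<exists>\<tau>.
        (\<forall>\<pi>. \<pi> \<noteq> free \<longrightarrow> card {i. i < n \<and> \<theta> i = \<pi>} \<le> card {i. i < n \<and> \<tau> i = \<pi>}) \<and>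
        (\<forall>i<n. \<forall>j\<in>N i. R (\<tau> i) (\<tau> j) \<and> R free (\<tau> i) \<and> R free free)"
  shows "min_universal_edges n m \<le> card (edges (typed_graph n R \<theta>))"
proof (rule min_universal_edges_le)
  show "simple_graph (typed_graph n R \<theta>)" by (rule simple_typed_graph)
  show "card (verts (typed_graph n R \<theta>)) = n" by (simp add: typed_graph_def)
  show "nm_universal n m (typed_graph n R \<theta>)"
    unfolding nm_universal_def universal_def
  proof
    fix H assume "H \<in> graph_family n m"
    then have H: "simple_graph H" "card (verts H) = n" "card (edges H) = m"
      by (auto simp: graph_family_def)
    obtain g where g: "bij_betw g {..<n} (verts H)"
      "\<And>i. i < n \<Longrightarrow> Suc i * card {j. j < n \<and> {g i, g j} \<in> edges H} \<le> 2 * m"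
      using degree_ranking[OF H] by blast
    have E2: "edges H \<subseteq> nsets (verts H) 2" using H by (auto simp: simple_graph_def)
    define N where "N = (\<lambda>i. {j. j < n \<and> {g i, g j} \<in> edges H})"
    have "i \<notin> N i" for i using E2 by (auto simp: N_def nsets_def)
    moreover have N_sym: "i \<in> N j" if "j \<in> N i" "i < n" for i j
      using that unfolding N_def mem_Collect_eq by (subst insert_commute) auto
    ultimately have "ranked_nbhd n m N"
      unfolding ranked_nbhd_def using g(2) by (auto simp: N_def)
    from types[OF this] obtain \<tau> where
      count: "\<forall>\<pi>. \<pi> \<noteq> free \<longrightarrow> card {i. i < n \<and> \<theta> i = \<pi>} \<le> card {i. i < n \<and> \<tau> i = \<pi>}"
      and comp: "\<forall>i<n. \<forall>j\<in>N i. R (\<tau> i) (\<tau> j) \<and> R free (\<tau> i) \<and> R free free"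
      by (elim exE conjE)
    have "\<forall>\<pi>. \<exists>\<alpha>. \<pi> \<noteq> free \<longrightarrow> \<alpha> ` {i. i < n \<and> \<theta> i = \<pi>} \<subseteq> {i. i < n \<and> \<tau> i = \<pi>}
        \<and> inj_on \<alpha> {i. i < n \<and> \<theta> i = \<pi>}"
      using card_le_inj[OF _ _ count[rule_format]] by simp
    from choice[OF this] obtain \<alpha> where
      \<alpha>: "\<forall>\<pi>. \<pi> \<noteq> free \<longrightarrow> \<alpha> \<pi> ` {i. i < n \<and> \<theta> i = \<pi>} \<subseteq> {i. i < n \<and> \<tau> i = \<pi>}
        \<and> inj_on (\<alpha> \<pi>) {i. i < n \<and> \<theta> i = \<pi>}"
      by (elim exE)
    define C where "C = {i. i < n \<and> \<theta> i \<noteq> free}"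
    define h where "h = (\<lambda>i. \<alpha> (\<theta> i) i)"
    have h: "h i < n \<and> \<tau> (h i) = \<theta> i" if "i \<in> C" for i
      using \<alpha>[rule_format, of "\<theta> i"] that by (auto simp: C_def h_def)
    have "inj_on h C"
    proof (rule inj_onI)
      fix x y assume xy: "x \<in> C" "y \<in> C" "h x = h y"
      then have "\<theta> x = \<theta> y" using h by metis
      then show "x = y"
        using xy \<alpha>[rule_format, of "\<theta> x"] by (auto simp: C_def h_def inj_on_def)
    qed
    then obtain k where k: "bij_betw k {..<n} {..<n}" "\<And>x. x \<in> C \<Longrightarrow> k x = h x"
      using extend_inj_to_bij[of "{..<n}" "{..<n}" h C] h by (auto simp: C_def)
    have k_type: "\<theta> x = free \<or> \<tau> (k x) = \<theta> x" if "x < n" for x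
      using that k(2)[of x] h[of x] by (cases "\<theta> x = free") (auto simp: C_def)
    define b where "b = g \<circ> k"
    have b: "bij_betw b {..<n} (verts H)" unfolding b_def using k(1) g(1) by (rule bij_betw_trans)
    \<comment> \<open>\<open>b\<close> runs from hosts to guests, since it is the hosts that get
      filled; the embedding of the graph is its inverse.\<close>
    define f where "f = inv_into {..<n} b"
    have f: "bij_betw f (verts H) {..<n}" unfolding f_def using b by (rule bij_betw_inv_into)
    have "f ` e \<in> edges (typed_graph n R \<theta>)" if e: "e \<in> edges H" for e
    proof -
      obtain u v where uv: "e = {u, v}" "u \<noteq> v" "u \<in> verts H" "v \<in> verts H"
        using e E2 by (auto simp: nsets_def card_2_iff)
      define i j where "i = f u" and "j = f v"
      have ij: "i < n" "j < n" "i \<noteq> j" "b i = u" "b j = v"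
        using f uv b
        by (auto simp: i_def j_def bij_betw_def inj_on_def f_def bij_betw_inv_into_right[OF b])
      have kk: "k i < n" "k j < n" using k(1) ij by (auto simp: bij_betw_def)
      have "k j \<in> N (k i)" using ij uv e kk by (auto simp: N_def b_def)
      moreover from this have "k i \<in> N (k j)" using N_sym kk by blast
      ultimately have "R (\<tau> (k i)) (\<tau> (k j))" "R free (\<tau> (k i))" "R free (\<tau> (k j))" "R free free"
        using comp kk by blast+
      then have "R (\<theta> i) (\<theta> j)"
        using k_type[OF ij(1)] k_type[OF ij(2)] sym by metis
      then show ?thesis using ij uv(1) by (auto simp: typed_graph_def i_def j_def)
    qed
    then show "contains_copy (typed_graph n R \<theta>) H"
      unfolding contains_copy_def using f
      by (intro exI[of _ f]) (auto simp: bij_betw_def typed_graph_def)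
  qed
qed

text \<open>\<open>u\<close> and \<open>w\<close> will be \<open>Free\<close> and
  \<open>Isolated\<close>: \<open>n0\<close> counts the hosts that may have neighbours, and those
  among them that no type in \<open>P\<close> claims become free.\<close>

lemma host_typing:
  fixes P :: "'t set" and b :: "'t \<Rightarrow> nat"
  assumes "finite P" "(\<Sum>\<pi>\<in>P. b \<pi>) \<le> n0" "n0 \<le> n" "u \<notin> P" "w \<notin> P" "u \<noteq> w"
  obtains \<theta> where "\<And>\<pi>. \<pi> \<in> P \<Longrightarrow> card {i. i < n \<and> \<theta> i = \<pi>} = b \<pi>"
    "card {i. i < n \<and> \<theta> i = u} = n0 - (\<Sum>\<pi>\<in>P. b \<pi>)"
    "card {i. i < n \<and> \<theta> i = w} = n - n0"
    "\<And>i. \<theta> i \<in> insert u (insert w P)"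
proof -
  define S where "S = (SIGMA \<pi>:P. {..<b \<pi>})"
  have fS: "finite S" using assms(1) by (auto simp: S_def)
  have cS: "card S = (\<Sum>\<pi>\<in>P. b \<pi>)" using assms(1) by (simp add: S_def)
  obtain h where h: "inj_on h S" "h ` S \<subseteq> {..<n0}"
    using card_le_inj[of S "{..<n0}"] fS cS assms(2) by auto
  define \<theta> where "\<theta> = (\<lambda>i. if i \<in> h ` S then fst (inv_into S h i)
    else if i < n0 then u else w)"
  have \<theta>h: "\<theta> (h s) = fst s" if "s \<in> S" for s
    using that h(1) by (simp add: \<theta>_def)
  have fstS: "fst s \<in> P" if "s \<in> S" for s using that by (auto simp: S_def)
  have in_hS: "\<theta> i \<in> P \<longleftrightarrow> i \<in> h ` S" for i
    using assms(4,5) \<theta>h fstS by (auto simp: \<theta>_def)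
  have 1: "card {i. i < n \<and> \<theta> i = \<pi>} = b \<pi>" if "\<pi> \<in> P" for \<pi>
  proof -
    have "{i. i < n \<and> \<theta> i = \<pi>} = h ` {s \<in> S. fst s = \<pi>}"
    proof -
      have "i \<in> h ` {s \<in> S. fst s = \<pi>}" if "\<theta> i = \<pi>" for i
        using that in_hS[of i] \<open>\<pi> \<in> P\<close> \<theta>h by auto
      moreover have "h s < n" if "s \<in> S" for s using that h(2) assms(3) by fastforce
      ultimately show ?thesis using \<theta>h by auto
    qed
    moreover have "{s \<in> S. fst s = \<pi>} = Pair \<pi> ` {..<b \<pi>}" using that by (auto simp: S_def)
    moreover have "inj_on h {s \<in> S. fst s = \<pi>}" using h(1) by (rule inj_on_subset) auto
    ultimately show ?thesis by (simp add: card_image inj_on_def)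
  qed
  have out: "\<theta> i = (if i < n0 then u else w)" if "i \<notin> h ` S" for i
    using that by (simp add: \<theta>_def)
  have "\<theta> i = u \<longleftrightarrow> i < n0 \<and> i \<notin> h ` S" for i
    using in_hS[of i] out[of i] assms(4-6) by (cases "i \<in> h ` S") (simp_all, metis)
  then have "{i. i < n \<and> \<theta> i = u} = {..<n0} - h ` S"
    using assms(3) by auto
  then have 2: "card {i. i < n \<and> \<theta> i = u} = n0 - (\<Sum>\<pi>\<in>P. b \<pi>)"
    using h fS cS by (simp add: card_Diff_subset card_image)
  have lt: "i < n0" if "i \<in> h ` S" for i using that h(2) by auto
  have "\<theta> i = w \<longleftrightarrow> \<not> i < n0" for i
  proof (cases "i \<in> h ` S")
    case True
    then have "\<theta> i \<in> P" "i < n0" using in_hS[of i] lt[of i] by simp_all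
    then show ?thesis using assms(5) by auto
  next
    case False
    then show ?thesis using out[of i] assms(6) by simp
  qed
  then have "{i. i < n \<and> \<theta> i = w} = {n0..<n}"
    by (intro set_eqI) (simp add: not_less conj_commute)
  then have 3: "card {i. i < n \<and> \<theta> i = w} = n - n0" by simp
  have 4: "\<theta> i \<in> insert u (insert w P)" for i
    using in_hS[of i] out[of i] by (cases "i \<in> h ` S") simp_all
  show thesis by (rule that[OF 1 2 3 4])
qed

subsection \<open>Random labels\<close>

text \<open>Multiplicativity of expectation for independent functions under the uniform distribution
  on \<open>\<Omega>\<close>, with denominators cleared, so that counting replaces a probability
  space.\<close>

lemma sum_mult_independent:
  fixes f g :: "('u \<Rightarrow> 'l) \<Rightarrow> real" and U \<Lambda>
  defines "\<Omega> \<equiv> (U \<rightarrow>\<^sub>E \<Lambda>)"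
  assumes "S \<inter> S' = {}"
    and f: "\<And>c c'. (\<And>u. u \<in> S \<Longrightarrow> c u = c' u) \<Longrightarrow> f c = f c'"
    and g: "\<And>c c'. (\<And>u. u \<in> S' \<Longrightarrow> c u = c' u) \<Longrightarrow> g c = g c'"
  shows "(\<Sum>c\<in>\<Omega>. f c) * (\<Sum>c\<in>\<Omega>. g c) = real (card \<Omega>) * (\<Sum>c\<in>\<Omega>. f c * g c)"
proof -
  \<comment> \<open>Exchanging the coordinates in \<open>S'\<close> between two independent copies turns the product of
    the means into the mean of the product.\<close>
  define \<phi> where "\<phi> = (\<lambda>(c :: 'u \<Rightarrow> 'l, c' :: 'u \<Rightarrow> 'l).
    (\<lambda>u. if u \<in> S' then c' u else c u, \<lambda>u. if u \<in> S' then c u else c' u))"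
  have \<phi>\<phi>: "\<phi> (\<phi> p) = p" for p by (auto simp: \<phi>_def fun_eq_iff split: prod.split)
  have \<phi>\<Omega>: "\<phi> p \<in> \<Omega> \<times> \<Omega>" if "p \<in> \<Omega> \<times> \<Omega>" for p
    using that by (auto simp: \<phi>_def \<Omega>_def PiE_iff extensional_def)
  have "(\<Sum>c\<in>\<Omega>. f c) * (\<Sum>c\<in>\<Omega>. g c) = (\<Sum>p\<in>\<Omega> \<times> \<Omega>. f (fst p) * g (snd p))"
    by (simp add: sum_product sum.cartesian_product split_beta)
  also have "\<dots> = (\<Sum>p\<in>\<Omega> \<times> \<Omega>. f (fst p) * g (fst p))"
  proof (rule sum.reindex_bij_witness[where i = \<phi> and j = \<phi>])
    fix p assume "p \<in> \<Omega> \<times> \<Omega>"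
    show "f (fst (\<phi> p)) * g (fst (\<phi> p)) = f (fst p) * g (snd p)"
    proof (rule arg_cong2[where f = "(*)"])
      show "f (fst (\<phi> p)) = f (fst p)"
        by (rule f) (use \<open>S \<inter> S' = {}\<close> in \<open>auto simp: \<phi>_def split: prod.split\<close>)
      show "g (fst (\<phi> p)) = g (snd p)"
        by (rule g) (auto simp: \<phi>_def split: prod.split)
    qed
  qed (use \<phi>\<phi> \<phi>\<Omega> in auto)
  also have "\<dots> = (\<Sum>c\<in>\<Omega>. \<Sum>c'\<in>\<Omega>. f c * g c)"
    by (subst sum.cartesian_product) (simp add: split_beta)
  also have "\<dots> = real (card \<Omega>) * (\<Sum>c\<in>\<Omega>. f c * g c)"
    by (simp add: sum_distrib_left)
  finally show ?thesis .
qed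

text \<open>Chebyshev's inequality with local dependence: the terms for \<open>v\<close> and
  \<open>w\<close> are uncorrelated unless \<open>S v\<close> meets \<open>S w\<close>, and
  otherwise their covariance is at most 1, so the variance is at most
  \<open>card V * B\<close>.\<close>

lemma lower_deviation_count:
  fixes f :: "'v \<Rightarrow> ('u \<Rightarrow> 'l) \<Rightarrow> real" and U \<Lambda> and p E :: real
  defines "\<Omega> \<equiv> (U \<rightarrow>\<^sub>E \<Lambda>)"
  assumes fin: "finite U" "finite \<Lambda>" "\<Lambda> \<noteq> {}" "finite V"
    and f01: "\<And>v c. 0 \<le> f v c \<and> f v c \<le> 1"
    and dep: "\<And>v c c'. v \<in> V \<Longrightarrow> (\<And>u. u \<in> S v \<Longrightarrow> c u = c' u) \<Longrightarrow> f v c = f v c'"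
    and mean: "\<And>v. v \<in> V \<Longrightarrow> (\<Sum>c\<in>\<Omega>. f v c) = p * card \<Omega>"
    and B: "\<And>v. v \<in> V \<Longrightarrow> card {w \<in> V. S v \<inter> S w \<noteq> {}} \<le> B"
    and "E > 0"
  shows "real (card {c \<in> \<Omega>. (\<Sum>v\<in>V. f v c) < card V * p - E}) * E\<^sup>2 \<le> card V * B * card \<Omega>"
proof (cases "V = {}")
  case True
  then show ?thesis using \<open>E > 0\<close> by simp
next
  case False
  have f\<Omega>: "finite \<Omega>" and "\<Omega> \<noteq> {}"
    using fin by (auto simp: \<Omega>_def PiE_eq_empty_iff intro!: finite_PiE)
  then have c\<Omega>: "real (card \<Omega>) > 0" by (simp add: card_gt_0_iff)
  obtain v0 where "v0 \<in> V" using False by blast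
  have "0 \<le> (\<Sum>c\<in>\<Omega>. f v0 c)" "(\<Sum>c\<in>\<Omega>. f v0 c) \<le> 1 * real (card \<Omega>)"
    using f01 sum_bounded_above[of \<Omega> "f v0" 1] by (auto intro!: sum_nonneg)
  then have p01: "0 \<le> p" "p \<le> 1"
    using mean[OF \<open>v0 \<in> V\<close>] c\<Omega> by (auto simp: zero_le_mult_iff)
  define X where "X = (\<lambda>c. \<Sum>v\<in>V. f v c - p)"
  have X: "X c = (\<Sum>v\<in>V. f v c) - card V * p" for c
    by (simp add: X_def sum_subtractf)
  have cov: "(\<Sum>c\<in>\<Omega>. (f v c - p) * (f w c - p)) \<le> (if S v \<inter> S w \<noteq> {} then real (card \<Omega>) else 0)"
    if "v \<in> V" "w \<in> V" for v w
  proof (cases "S v \<inter> S w = {}")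
    case True
    have "(\<Sum>c\<in>\<Omega>. f v c - p) * (\<Sum>c\<in>\<Omega>. f w c - p)
        = card \<Omega> * (\<Sum>c\<in>\<Omega>. (f v c - p) * (f w c - p))"
      unfolding \<Omega>_def
    proof (rule sum_mult_independent[OF True])
      show "f v c - p = f v c' - p" if "\<And>u. u \<in> S v \<Longrightarrow> c u = c' u" for c c'
        using dep[OF \<open>v \<in> V\<close> that] by simp
      show "f w c - p = f w c' - p" if "\<And>u. u \<in> S w \<Longrightarrow> c u = c' u" for c c'
        using dep[OF \<open>w \<in> V\<close> that] by simp
    qed
    moreover have "(\<Sum>c\<in>\<Omega>. f v c - p) = 0"
      using mean[OF that(1)] by (simp add: sum_subtractf)
    ultimately show ?thesis using True c\<Omega> by simp
  next
    case False
    have "(f v c - p) * (f w c - p) \<le> 1" for c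
    proof -
      have "\<bar>f v c - p\<bar> \<le> 1" "\<bar>f w c - p\<bar> \<le> 1"
        using f01[of v c] f01[of w c] p01 by (auto simp: abs_le_iff)
      then have "\<bar>f v c - p\<bar> * \<bar>f w c - p\<bar> \<le> 1 * 1" by (intro mult_mono) auto
      then show ?thesis by (simp add: abs_mult[symmetric])
    qed
    then have "(\<Sum>c\<in>\<Omega>. (f v c - p) * (f w c - p)) \<le> real (card \<Omega>) * 1"
      by (intro sum_bounded_above) auto
    then show ?thesis using False by simp
  qed
  have "(\<Sum>c\<in>\<Omega>. (X c)\<^sup>2) = (\<Sum>v\<in>V. \<Sum>w\<in>V. \<Sum>c\<in>\<Omega>. (f v c - p) * (f w c - p))"
  proof -
    have "(\<Sum>c\<in>\<Omega>. (X c)\<^sup>2) = (\<Sum>c\<in>\<Omega>. \<Sum>v\<in>V. \<Sum>w\<in>V. (f v c - p) * (f w c - p))"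
      by (simp add: X_def power2_eq_square sum_product)
    also have "\<dots> = (\<Sum>v\<in>V. \<Sum>c\<in>\<Omega>. \<Sum>w\<in>V. (f v c - p) * (f w c - p))"
      by (rule sum.swap)
    also have "\<dots> = (\<Sum>v\<in>V. \<Sum>w\<in>V. \<Sum>c\<in>\<Omega>. (f v c - p) * (f w c - p))"
      by (rule sum.cong[OF refl], rule sum.swap)
    finally show ?thesis .
  qed
  also have "\<dots> \<le> (\<Sum>v\<in>V. \<Sum>w\<in>V. if S v \<inter> S w \<noteq> {} then real (card \<Omega>) else 0)"
    by (rule sum_mono, rule sum_mono, rule cov)
  also have "\<dots> = (\<Sum>v\<in>V. real (card \<Omega>) * card {w \<in> V. S v \<inter> S w \<noteq> {}})"
    using fin(4) by (simp add: sum.If_cases Int_def mult.commute)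
  also have "\<dots> \<le> (\<Sum>v\<in>V. real (card \<Omega>) * B)"
    by (intro sum_mono mult_left_mono) (use B in auto)
  finally have X2: "(\<Sum>c\<in>\<Omega>. (X c)\<^sup>2) \<le> card V * B * card \<Omega>" by (simp add: mult_ac)
  define bad where "bad = {c \<in> \<Omega>. (\<Sum>v\<in>V. f v c) < card V * p - E}"
  have "real (card bad) * E\<^sup>2 = (\<Sum>c\<in>bad. E\<^sup>2)" by simp
  also have "\<dots> \<le> (\<Sum>c\<in>bad. (X c)\<^sup>2)"
  proof (rule sum_mono)
    fix c assume "c \<in> bad"
    then have "E \<le> - X c" by (simp add: X bad_def)
    then have "E\<^sup>2 \<le> (- X c)\<^sup>2" using \<open>E > 0\<close> by (intro power_mono) auto
    then show "E\<^sup>2 \<le> (X c)\<^sup>2" by simp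
  qed
  also have "\<dots> \<le> (\<Sum>c\<in>\<Omega>. (X c)\<^sup>2)"
    using f\<Omega> by (intro sum_mono2) (auto simp: bad_def)
  finally show ?thesis using X2 by (simp add: bad_def)
qed

text \<open>Reading a uniform labelling along an injective sequence of coordinates gives a uniform
  pattern, because every pattern extends in the same number of ways. This makes the law of the
  patterns independent of the guest.\<close>

lemma card_marginal:
  fixes s :: "nat \<Rightarrow> 'u" and U :: "'u set" and \<Lambda> :: "'l set"
  assumes fin: "finite U" and s: "inj_on s {..<r}" "s ` {..<r} \<subseteq> U"
  shows "card {c \<in> U \<rightarrow>\<^sub>E \<Lambda>. Q (restrict (c \<circ> s) {..<r})}
    = card {g \<in> {..<r} \<rightarrow>\<^sub>E \<Lambda>. Q g} * card \<Lambda> ^ (card U - r)"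
proof -
  let ?W = "U - s ` {..<r}"
  define F where "F = (\<lambda>c :: 'u \<Rightarrow> 'l. (restrict (c \<circ> s) {..<r}, restrict c ?W))"
  define G where "G = (\<lambda>(g :: nat \<Rightarrow> 'l, h) u. if u \<in> s ` {..<r} then g (inv_into {..<r} s u) else h u)"
  have "bij_betw F {c \<in> U \<rightarrow>\<^sub>E \<Lambda>. Q (restrict (c \<circ> s) {..<r})}
      ({g \<in> {..<r} \<rightarrow>\<^sub>E \<Lambda>. Q g} \<times> (?W \<rightarrow>\<^sub>E \<Lambda>))"
  proof (rule bij_betw_byWitness[where f' = G])
    show "\<forall>c\<in>{c \<in> U \<rightarrow>\<^sub>E \<Lambda>. Q (restrict (c \<circ> s) {..<r})}. G (F c) = c"
    proof (intro ballI ext)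
      fix c u assume "c \<in> {c \<in> U \<rightarrow>\<^sub>E \<Lambda>. Q (restrict (c \<circ> s) {..<r})}"
      then have c: "c \<in> U \<rightarrow>\<^sub>E \<Lambda>" by simp
      show "G (F c) u = c u"
      proof (cases "u \<in> s ` {..<r}")
        case True
        then have "inv_into {..<r} s u \<in> {..<r}" "s (inv_into {..<r} s u) = u"
          by (rule inv_into_into, rule f_inv_into_f)
        then show ?thesis using True by (simp add: G_def F_def)
      next
        case False
        then show ?thesis using PiE_arb[OF c, of u] by (cases "u \<in> U") (simp_all add: G_def F_def)
      qed
    qed
    have GF: "restrict (G (g, h) \<circ> s) {..<r} = g" "restrict (G (g, h)) ?W = h" "G (g, h) \<in> U \<rightarrow>\<^sub>E \<Lambda>"
      if "g \<in> {..<r} \<rightarrow>\<^sub>E \<Lambda>" "h \<in> ?W \<rightarrow>\<^sub>E \<Lambda>" for g h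
    proof -
      show "restrict (G (g, h) \<circ> s) {..<r} = g"
      proof
        fix k
        show "restrict (G (g, h) \<circ> s) {..<r} k = g k"
          using PiE_arb[OF that(1), of k] s(1) by (cases "k < r") (simp_all add: G_def)
      qed
      show "restrict (G (g, h)) ?W = h"
      proof
        fix u
        show "restrict (G (g, h)) ?W u = h u"
          using PiE_arb[OF that(2), of u] by (cases "u \<in> ?W") (simp_all add: G_def)
      qed
      show "G (g, h) \<in> U \<rightarrow>\<^sub>E \<Lambda>"
      proof (rule PiE_I)
        fix u assume "u \<in> U"
        show "G (g, h) u \<in> \<Lambda>"
        proof (cases "u \<in> s ` {..<r}")
          case True
          then show ?thesis
            using PiE_mem[OF that(1) inv_into_into[OF True]] by (simp add: G_def)
        next
          case False
          then show ?thesis using PiE_mem[OF that(2), of u] \<open>u \<in> U\<close> by (simp add: G_def)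
        qed
      next
        fix u assume "u \<notin> U"
        then show "G (g, h) u = undefined"
          using PiE_arb[OF that(2), of u] s(2) by (auto simp: G_def)
      qed
    qed
    then show "\<forall>p\<in>{g \<in> {..<r} \<rightarrow>\<^sub>E \<Lambda>. Q g} \<times> (?W \<rightarrow>\<^sub>E \<Lambda>). F (G p) = p"
      by (auto simp: F_def)
    show "G ` ({g \<in> {..<r} \<rightarrow>\<^sub>E \<Lambda>. Q g} \<times> (?W \<rightarrow>\<^sub>E \<Lambda>))
        \<subseteq> {c \<in> U \<rightarrow>\<^sub>E \<Lambda>. Q (restrict (c \<circ> s) {..<r})}"
    proof (rule image_subsetI)
      fix p assume "p \<in> {g \<in> {..<r} \<rightarrow>\<^sub>E \<Lambda>. Q g} \<times> (?W \<rightarrow>\<^sub>E \<Lambda>)"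
      then obtain g h where gh: "p = (g, h)" "g \<in> {..<r} \<rightarrow>\<^sub>E \<Lambda>" "Q g" "h \<in> ?W \<rightarrow>\<^sub>E \<Lambda>"
        by blast
      show "G p \<in> {c \<in> U \<rightarrow>\<^sub>E \<Lambda>. Q (restrict (c \<circ> s) {..<r})}"
        using GF[OF gh(2,4)] gh(1,3) by simp
    qed
    show "F ` {c \<in> U \<rightarrow>\<^sub>E \<Lambda>. Q (restrict (c \<circ> s) {..<r})}
        \<subseteq> {g \<in> {..<r} \<rightarrow>\<^sub>E \<Lambda>. Q g} \<times> (?W \<rightarrow>\<^sub>E \<Lambda>)"
    proof (rule image_subsetI)
      fix c assume "c \<in> {c \<in> U \<rightarrow>\<^sub>E \<Lambda>. Q (restrict (c \<circ> s) {..<r})}"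
      then have c: "c \<in> U \<rightarrow>\<^sub>E \<Lambda>" "Q (restrict (c \<circ> s) {..<r})" by simp_all
      have "restrict (c \<circ> s) {..<r} \<in> {..<r} \<rightarrow>\<^sub>E \<Lambda>"
        unfolding restrict_PiE_iff using PiE_mem[OF c(1)] s(2) by auto
      moreover have "restrict c ?W \<in> ?W \<rightarrow>\<^sub>E \<Lambda>"
        unfolding restrict_PiE_iff using PiE_mem[OF c(1)] by auto
      ultimately show "F c \<in> {g \<in> {..<r} \<rightarrow>\<^sub>E \<Lambda>. Q g} \<times> (?W \<rightarrow>\<^sub>E \<Lambda>)"
        using c(2) by (simp add: F_def)
    qed
  qed
  then have "card {c \<in> U \<rightarrow>\<^sub>E \<Lambda>. Q (restrict (c \<circ> s) {..<r})}
      = card {g \<in> {..<r} \<rightarrow>\<^sub>E \<Lambda>. Q g} * card (?W \<rightarrow>\<^sub>E \<Lambda>)"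
    by (simp add: bij_betw_same_card card_cartesian_product)
  also have "card (?W \<rightarrow>\<^sub>E \<Lambda>) = card \<Lambda> ^ (card U - r)"
    using fin s by (simp add: card_PiE card_Diff_subset card_image)
  finally show ?thesis .
qed

definition type_prob :: "nat \<Rightarrow> 'l set \<Rightarrow> ((nat \<Rightarrow> 'l) \<Rightarrow> 't) \<Rightarrow> 't \<Rightarrow> real" where
  "type_prob r \<Lambda> \<phi> \<pi> = card {g \<in> {..<r} \<rightarrow>\<^sub>E \<Lambda>. \<phi> g = \<pi>} / real (card \<Lambda>) ^ r"

lemma type_prob_nonneg: "type_prob r \<Lambda> \<phi> \<pi> \<ge> 0"
  by (simp add: type_prob_def)

lemma sum_type_prob:
  assumes "finite P" "finite \<Lambda>"
  shows "(\<Sum>\<pi>\<in>P. type_prob r \<Lambda> \<phi> \<pi>)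
    = card {g \<in> {..<r} \<rightarrow>\<^sub>E \<Lambda>. \<phi> g \<in> P} / real (card \<Lambda>) ^ r"
proof -
  have "{g \<in> {..<r} \<rightarrow>\<^sub>E \<Lambda>. \<phi> g \<in> P} = (\<Union>\<pi>\<in>P. {g \<in> {..<r} \<rightarrow>\<^sub>E \<Lambda>. \<phi> g = \<pi>})" by auto
  moreover have "finite ({..<r} \<rightarrow>\<^sub>E \<Lambda>)" using assms(2) by (simp add: finite_PiE)
  ultimately have "card {g \<in> {..<r} \<rightarrow>\<^sub>E \<Lambda>. \<phi> g \<in> P}
      = (\<Sum>\<pi>\<in>P. card {g \<in> {..<r} \<rightarrow>\<^sub>E \<Lambda>. \<phi> g = \<pi>})"
    using assms(1) by (simp add: card_UN_disjoint disjoint_iff)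
  then show ?thesis by (simp add: type_prob_def sum_divide_distrib)
qed

text \<open>A union bound over the events, one for each class \<open>x\<close> and each type in
  \<open>P x\<close>, that the type is too rare; \<open>small\<close> says that their Chebyshev
  bounds sum to less than 1. Two vertices of a class are dependent only if they read a common label,
  which the degree bound \<open>D\<close> makes rare.\<close>

lemma exists_labelling:
  fixes V :: "'x \<Rightarrow> nat set" and \<phi> :: "'x \<Rightarrow> (nat \<Rightarrow> 'l) \<Rightarrow> 't" and E :: "'x \<Rightarrow> real"
  assumes N: "ranked_nbhd n m N" and deg: "\<And>i. s \<le> i \<Longrightarrow> i < n \<Longrightarrow> card (N i) \<le> D"
    and X: "finite X" and V: "\<And>x. x \<in> X \<Longrightarrow> V x \<subseteq> {s..<n}"
    and r: "\<And>x. x \<in> X \<Longrightarrow> r x \<ge> 1"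
    and \<Lambda>: "finite \<Lambda>" "\<Lambda> \<noteq> {}"
    and P: "\<And>x. x \<in> X \<Longrightarrow> finite (P x)" and E: "\<And>x. x \<in> X \<Longrightarrow> E x > 0"
    and small: "(\<Sum>x\<in>X. real (card (P x)) * real (card (V x))
      * real (if r x = 1 then 1 else r x * (D + 1)) / (E x)\<^sup>2) < 1"
  obtains lab pat where
    "\<And>i. i < n \<Longrightarrow> lab i \<in> \<Lambda>"
    "\<And>x i. x \<in> X \<Longrightarrow> i \<in> V x \<Longrightarrow> pat x i \<in> {..<r x} \<rightarrow>\<^sub>E \<Lambda> \<and> pat x i 0 = lab i"
    "\<And>x i j. x \<in> X \<Longrightarrow> i \<in> V x \<Longrightarrow> card (N i) < r x \<Longrightarrow> j \<in> N i \<Longrightarrow> s \<le> j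
        \<Longrightarrow> lab j \<in> pat x i ` {1..<r x}"
    "\<And>x \<pi>. x \<in> X \<Longrightarrow> \<pi> \<in> P x \<Longrightarrow>
        real (card (V x)) * type_prob (r x) \<Lambda> (\<phi> x) \<pi> - E x
          \<le> real (card {i \<in> V x. \<phi> x (pat x i) = \<pi>})"
proof -
  have N1: "N i \<subseteq> {..<n}" "i \<notin> N i" if "i < n" for i
    using N that by (auto simp: ranked_nbhd_def)
  have N2: "i \<in> N j" if "i < n" "j \<in> N i" for i j
    using N that by (auto simp: ranked_nbhd_def)
  \<comment> \<open>Neighbours of rank below \<open>s\<close> are ignored: their degrees need not be
    bounded by \<open>D\<close>, and a label read by very many vertices would spoil the variance
    bound.\<close>
  define N' where "N' = (\<lambda>i. N i \<inter> {s..<n})"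
  have fN: "finite (N i)" if "i < n" for i using N1(1)[OF that] finite_subset by blast
  have "\<exists>e. bij_betw e {..<card (N' i)} (N' i)" for i
    by (rule finite_same_card_bij) (auto simp: N'_def)
  then obtain e where e: "\<And>i. bij_betw (e i) {..<card (N' i)} (N' i)" by metis
  \<comment> \<open>Slot 0 reads the label of \<open>i\<close> itself, the next slots those of its neighbours, and the
    remaining ones private dummy labels \<open>(i, k)\<close> with \<open>k > 0\<close>. So all vertices of a class read the
    same number of independent labels, and the law of the pattern does not depend on the graph.\<close>
  define sl where "sl = (\<lambda>i k. if k = 0 then (i, 0 :: nat)
      else if k \<le> card (N' i) then (e i (k - 1), 0) else (i, k))"
  define R where "R = Max (r ` X)"
  have R: "r x \<le> R" if "x \<in> X" for x using that X by (simp add: R_def)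
  define U where "U = {..<n} \<times> {..R}"
  define \<Omega> where "\<Omega> = (U \<rightarrow>\<^sub>E \<Lambda>)"
  have fU: "finite U" by (simp add: U_def)
  have f\<Omega>: "finite \<Omega>" and "\<Omega> \<noteq> {}"
    using fU \<Lambda> by (auto simp: \<Omega>_def PiE_eq_empty_iff intro!: finite_PiE)
  then have c\<Omega>: "real (card \<Omega>) > 0" by (simp add: card_gt_0_iff)
  have e_in: "e i (k - 1) \<in> N' i" if "k \<noteq> 0" "k \<le> card (N' i)" for i k
    using e[of i] that by (auto simp: bij_betw_def)
  have sl_inj: "inj_on (sl i) {..<q}" if "i < n" for i q
  proof (rule inj_onI)
    fix k l assume "sl i k = sl i l"
    moreover have "k = l"
      if "e i (k - 1) = e i (l - 1)" "k \<noteq> 0" "l \<noteq> 0" "k \<le> card (N' i)" "l \<le> card (N' i)"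
    proof -
      have "k - 1 = l - 1"
        using bij_betw_imp_inj_on[OF e[of i]] that(1) by (rule inj_onD) (use that in auto)
      then show ?thesis using that by simp
    qed
    moreover have "e i (k - 1) \<noteq> i \<and> i \<noteq> e i (k - 1)" if "k \<noteq> 0" "k \<le> card (N' i)" for k
      using e_in[OF that] N1(2)[OF \<open>i < n\<close>] by (auto simp: N'_def)
    ultimately show "k = l" by (auto simp: sl_def split: if_splits)
  qed
  have sl_U: "sl i ` {..<r x} \<subseteq> U" if "i < n" "x \<in> X" for i x
    using R[OF that(2)] that(1) e_in by (auto simp: sl_def U_def N'_def)
  define S where "S = (\<lambda>x i. sl i ` {..<r x})"
  define f where "f = (\<lambda>x \<pi> i c. if \<phi> x (restrict (c \<circ> sl i) {..<r x}) = \<pi> then 1 else 0 :: real)"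
  have sumf: "(\<Sum>i\<in>V x. f x \<pi> i c) = card {i \<in> V x. \<phi> x (restrict (c \<circ> sl i) {..<r x}) = \<pi>}"
    if "x \<in> X" for x \<pi> c
    using V[OF that] finite_subset[of "V x"]
    by (auto simp: f_def sum.If_cases Int_def)
  have mean: "(\<Sum>c\<in>\<Omega>. f x \<pi> i c) = type_prob (r x) \<Lambda> (\<phi> x) \<pi> * card \<Omega>"
    if "x \<in> X" "i \<in> V x" for x \<pi> i
  proof -
    have "i < n" using that V by fastforce
    have le: "r x \<le> card U"
      using card_inj_on_le[OF sl_inj[OF \<open>i < n\<close>] sl_U[OF \<open>i < n\<close> \<open>x \<in> X\<close>] fU] by simp
    have "(\<Sum>c\<in>\<Omega>. f x \<pi> i c) = card {c \<in> \<Omega>. \<phi> x (restrict (c \<circ> sl i) {..<r x}) = \<pi>}"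
      using f\<Omega> by (simp add: f_def sum.If_cases Int_def)
    also have "\<dots> = real (card {g \<in> {..<r x} \<rightarrow>\<^sub>E \<Lambda>. \<phi> x g = \<pi>} * card \<Lambda> ^ (card U - r x))"
      unfolding \<Omega>_def
      using card_marginal[OF fU sl_inj[OF \<open>i < n\<close>] sl_U[OF \<open>i < n\<close> \<open>x \<in> X\<close>],
          where Q = "\<lambda>g. \<phi> x g = \<pi>"] by simp
    also have "\<dots> = type_prob (r x) \<Lambda> (\<phi> x) \<pi> * card \<Omega>"
    proof -
      have "card \<Omega> = card \<Lambda> ^ r x * card \<Lambda> ^ (card U - r x)"
        using le fU by (simp add: \<Omega>_def card_PiE flip: power_add)
      moreover have "card \<Lambda> > 0" using \<Lambda> by (simp add: card_gt_0_iff)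
      ultimately show ?thesis by (simp add: type_prob_def)
    qed
    finally show ?thesis .
  qed
  have overlap: "card {w \<in> V x. S x i \<inter> S x w \<noteq> {}} \<le> (if r x = 1 then 1 else r x * (D + 1))"
    if "x \<in> X" "i \<in> V x" for x i
  proof (cases "r x = 1")
    case True
    then have "{w \<in> V x. S x i \<inter> S x w \<noteq> {}} \<subseteq> {i}" by (auto simp: S_def sl_def)
    then have "card {w \<in> V x. S x i \<inter> S x w \<noteq> {}} \<le> card {i}" by (intro card_mono) auto
    then show ?thesis using True by simp
  next
    case False
    have fst_sl: "fst (sl w k) = w \<or> fst (sl w k) \<in> N' w" for w k
      using e_in by (auto simp: sl_def)
    have i: "s \<le> i" "i < n" using that V by fastforce+
    define T where "T = fst ` S x i"
    have "s \<le> fst (sl i k) \<and> fst (sl i k) < n" for k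
      using fst_sl[of i k] i by (auto simp: N'_def)
    then have T: "T \<subseteq> {s..<n}"
      unfolding T_def S_def image_image by (simp add: image_subset_iff)
    have cT: "card T \<le> r x"
      unfolding T_def S_def using card_image_le[of "{..<r x}" "\<lambda>k. fst (sl i k)"]
      by (simp add: image_image)
    \<comment> \<open>If \<open>w\<close> shares a slot with \<open>i\<close>, then \<open>w\<close>
      is one of the at most \<open>r x\<close> vertices at which \<open>i\<close> reads, or a
      neighbour of one of them; these vertices have rank at least \<open>s\<close>, hence at most
      \<open>D\<close> neighbours each.\<close>
    have "{w \<in> V x. S x i \<inter> S x w \<noteq> {}} \<subseteq> (\<Union>u\<in>T. insert u (N u))"
    proof
      fix w assume w: "w \<in> {w \<in> V x. S x i \<inter> S x w \<noteq> {}}"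
      then have "w < n" using V[OF \<open>x \<in> X\<close>] by auto
      from w obtain a where a1: "a \<in> S x i" "a \<in> S x w" by blast
      then obtain k where a: "a \<in> S x i" "a = sl w k" unfolding S_def by blast
      then have "fst a \<in> T" by (auto simp: T_def)
      moreover have "w = fst a \<or> w \<in> N (fst a)"
        using fst_sl[of w k] a(2) N2[OF \<open>w < n\<close>] by (auto simp: N'_def)
      ultimately show "w \<in> (\<Union>u\<in>T. insert u (N u))" by blast
    qed
    moreover have "finite (\<Union>u\<in>T. insert u (N u))"
      using T fN finite_subset[of T] by auto
    ultimately have "card {w \<in> V x. S x i \<inter> S x w \<noteq> {}} \<le> card (\<Union>u\<in>T. insert u (N u))"
      by (rule card_mono[rotated])
    also have "\<dots> \<le> (\<Sum>u\<in>T. card (insert u (N u)))"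
      by (rule card_UN_le) (use T finite_subset in blast)
    also have "\<dots> \<le> (\<Sum>u\<in>T. D + 1)"
    proof (rule sum_mono)
      fix u assume "u \<in> T"
      then have "card (N u) \<le> D" "finite (N u)" using T deg fN by auto
      then show "card (insert u (N u)) \<le> D + 1" by (simp add: card_insert_if)
    qed
    also have "\<dots> \<le> r x * (D + 1)" using cT by (simp del: mult_Suc_right add_Suc_right)
    finally show ?thesis using False by simp
  qed
  define bad where "bad = (\<lambda>x \<pi>. {c \<in> \<Omega>. (\<Sum>i\<in>V x. f x \<pi> i c)
      < card (V x) * type_prob (r x) \<Lambda> (\<phi> x) \<pi> - E x})"
  define \<beta> where "\<beta> = (\<lambda>x. real (card (V x)) * real (if r x = 1 then 1 else r x * (D + 1)) / (E x)\<^sup>2)"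
  have badc: "real (card (bad x \<pi>)) \<le> \<beta> x * card \<Omega>" if "x \<in> X" for x \<pi>
  proof -
    have "real (card (bad x \<pi>)) * (E x)\<^sup>2
        \<le> card (V x) * (if r x = 1 then 1 else r x * (D + 1)) * card \<Omega>"
      unfolding bad_def \<Omega>_def
    proof (rule lower_deviation_count[where S = "S x"])
      show "finite (V x)" using V[OF that] finite_subset by blast
      show "f x \<pi> v c = f x \<pi> v c'" if "\<And>u. u \<in> S x v \<Longrightarrow> c u = c' u" for v c c'
      proof -
        have "restrict (c \<circ> sl v) {..<r x} = restrict (c' \<circ> sl v) {..<r x}"
          using that by (intro restrict_ext) (auto simp: S_def)
        then show ?thesis by (simp add: f_def)
      qed
    qed (use fU \<Lambda> that mean overlap E in \<open>auto simp: f_def \<Omega>_def simp del: mult_Suc_right\<close>)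
    then show ?thesis using E[OF that] by (simp add: \<beta>_def field_simps)
  qed
  have "real (card (\<Union>x\<in>X. \<Union>\<pi>\<in>P x. bad x \<pi>)) \<le> (\<Sum>x\<in>X. real (card (\<Union>\<pi>\<in>P x. bad x \<pi>)))"
    using card_UN_le[OF X, of "\<lambda>x. \<Union>\<pi>\<in>P x. bad x \<pi>"] by (simp flip: of_nat_sum)
  also have "\<dots> \<le> (\<Sum>x\<in>X. \<Sum>\<pi>\<in>P x. real (card (bad x \<pi>)))"
    using card_UN_le[OF P, of _ "bad _"] by (intro sum_mono) (simp flip: of_nat_sum)
  also have "\<dots> \<le> (\<Sum>x\<in>X. \<Sum>\<pi>\<in>P x. \<beta> x * card \<Omega>)"
    by (intro sum_mono badc)
  also have "\<dots> = (\<Sum>x\<in>X. card (P x) * \<beta> x) * card \<Omega>"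
    by (simp add: sum_distrib_right mult.assoc)
  also have "\<dots> < 1 * real (card \<Omega>)"
    using small c\<Omega> by (intro mult_strict_right_mono) (simp_all add: \<beta>_def mult.assoc)
  finally have "card (\<Union>x\<in>X. \<Union>\<pi>\<in>P x. bad x \<pi>) < card \<Omega>" by simp
  moreover have "finite (\<Union>x\<in>X. \<Union>\<pi>\<in>P x. bad x \<pi>)"
    using X P f\<Omega> by (auto simp: bad_def)
  ultimately have "\<not> \<Omega> \<subseteq> (\<Union>x\<in>X. \<Union>\<pi>\<in>P x. bad x \<pi>)"
    by (meson card_mono not_le)
  then obtain c where c: "c \<in> \<Omega>" "\<And>x \<pi>. x \<in> X \<Longrightarrow> \<pi> \<in> P x \<Longrightarrow> c \<notin> bad x \<pi>" by blast
  show thesis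
  proof (rule that[of "\<lambda>i. c (i, 0)" "\<lambda>x i. restrict (c \<circ> sl i) {..<r x}"])
    fix i assume "i < n"
    then show "c (i, 0) \<in> \<Lambda>" using c(1) by (auto simp: \<Omega>_def U_def)
  next
    fix x i assume xi: "x \<in> X" "i \<in> V x"
    then have "i < n" using V[of x] by auto
    have "restrict (c \<circ> sl i) {..<r x} \<in> {..<r x} \<rightarrow>\<^sub>E \<Lambda>"
      unfolding restrict_PiE_iff
    proof
      fix k assume "k \<in> {..<r x}"
      then have "sl i k \<in> U" using sl_U[OF \<open>i < n\<close> xi(1)] by blast
      then show "(c \<circ> sl i) k \<in> \<Lambda>" using PiE_mem[OF c(1)[unfolded \<Omega>_def]] by simp
    qed
    moreover have "restrict (c \<circ> sl i) {..<r x} 0 = c (i, 0)"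
      using r[OF xi(1)] by (simp add: sl_def)
    ultimately show "restrict (c \<circ> sl i) {..<r x} \<in> {..<r x} \<rightarrow>\<^sub>E \<Lambda>
        \<and> restrict (c \<circ> sl i) {..<r x} 0 = c (i, 0)" ..
  next
    fix x i j assume xi: "x \<in> X" "i \<in> V x" "card (N i) < r x" "j \<in> N i" "s \<le> j"
    then have "i < n" using V[of x] by auto
    then have "j \<in> N' i" using xi N1 by (auto simp: N'_def)
    then obtain k where k: "k < card (N' i)" "e i k = j"
      using e[of i] by (force simp: bij_betw_def)
    have "card (N' i) \<le> card (N i)"
      using fN[OF \<open>i < n\<close>] by (auto simp: N'_def intro: card_mono)
    then have "Suc k \<in> {1..<r x}" "restrict (c \<circ> sl i) {..<r x} (Suc k) = c (j, 0)"
      using k xi(3) by (auto simp: sl_def)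
    then show "c (j, 0) \<in> restrict (c \<circ> sl i) {..<r x} ` {1..<r x}" by (metis imageI)
  next
    fix x \<pi> assume xp: "x \<in> X" "\<pi> \<in> P x"
    show "real (card (V x)) * type_prob (r x) \<Lambda> (\<phi> x) \<pi> - E x
        \<le> real (card {i \<in> V x. \<phi> x (restrict (c \<circ> sl i) {..<r x}) = \<pi>})"
      using c(2)[OF xp] c(1) sumf[OF xp(1)] by (auto simp: bad_def not_less)
  qed
qed

section \<open>Turning expected type counts into a host graph\<close>

text \<open>The host receives of each type the expected number minus the admissible deviation
  \<open>E\<close>, rounded down, which every guest attains. Truncation by \<open>nat\<close>
  respects the upper bound since probabilities are nonnegative; each type loses at most
  \<open>E + 1\<close>, the 1 being for rounding.\<close>

lemma floor_counts:
  fixes \<phi> :: "(nat \<Rightarrow> 'l) \<Rightarrow> 't" and E :: real and v r :: nat and \<Lambda> :: "'l set"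
  defines "b \<equiv> \<lambda>p. nat \<lfloor>real v * type_prob r \<Lambda> \<phi> p - E\<rfloor>"
  assumes "finite Q" "finite \<Lambda>" "E \<ge> 0"
  shows "real (\<Sum>p\<in>Q. b p)
      \<le> v * (card {g \<in> {..<r} \<rightarrow>\<^sub>E \<Lambda>. \<phi> g \<in> Q} / real (card \<Lambda>) ^ r)" (is ?upper)
    and "v * (card {g \<in> {..<r} \<rightarrow>\<^sub>E \<Lambda>. \<phi> g \<in> Q} / real (card \<Lambda>) ^ r) - card Q * (E + 1)
      \<le> real (\<Sum>p\<in>Q. b p)" (is ?lower)
proof -
  have eq: "v * (card {g \<in> {..<r} \<rightarrow>\<^sub>E \<Lambda>. \<phi> g \<in> Q} / real (card \<Lambda>) ^ r)
      = (\<Sum>p\<in>Q. v * type_prob r \<Lambda> \<phi> p)"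
    using sum_type_prob[OF assms(2,3), of r \<phi>] by (simp flip: sum_distrib_left)
  show ?upper unfolding eq of_nat_sum
  proof (rule sum_mono)
    fix p
    show "real (b p) \<le> v * type_prob r \<Lambda> \<phi> p"
    proof -
      define y where "y = v * type_prob r \<Lambda> \<phi> p - E"
      have "real (nat \<lfloor>y\<rfloor>) \<le> max 0 y" by (cases "y \<ge> 0") (simp_all add: of_nat_nat)
      also have "\<dots> \<le> v * type_prob r \<Lambda> \<phi> p"
        using type_prob_nonneg[of r \<Lambda> \<phi> p] \<open>E \<ge> 0\<close> by (simp add: y_def)
      finally show ?thesis by (simp add: b_def y_def)
    qed
  qed
  have "(\<Sum>p\<in>Q. v * type_prob r \<Lambda> \<phi> p - (E + 1)) \<le> (\<Sum>p\<in>Q. real (b p))"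
    by (rule sum_mono) (simp add: b_def, linarith)
  then show ?lower unfolding eq by (simp add: sum_subtractf)
qed

lemma floor_counts_le:
  fixes \<phi> :: "(nat \<Rightarrow> 'l) \<Rightarrow> 't" and E :: real and v :: nat
  assumes "finite Q" "finite \<Lambda>" "\<Lambda> \<noteq> {}" "E \<ge> 0"
  shows "(\<Sum>p\<in>Q. nat \<lfloor>real v * type_prob r \<Lambda> \<phi> p - E\<rfloor>) \<le> v"
proof -
  have fin: "finite ({..<r} \<rightarrow>\<^sub>E \<Lambda>)" using assms(2) by (simp add: finite_PiE)
  have "card {g \<in> {..<r} \<rightarrow>\<^sub>E \<Lambda>. \<phi> g \<in> Q} \<le> card ({..<r} \<rightarrow>\<^sub>E \<Lambda>)"
    by (rule card_mono[OF fin]) auto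
  also have "\<dots> = card \<Lambda> ^ r" by (simp add: card_PiE)
  finally have "real (card {g \<in> {..<r} \<rightarrow>\<^sub>E \<Lambda>. \<phi> g \<in> Q}) \<le> real (card \<Lambda>) ^ r"
    by (simp flip: of_nat_power)
  moreover have "real (card \<Lambda>) ^ r > 0" using assms(2,3) by (simp add: card_gt_0_iff)
  ultimately have "card {g \<in> {..<r} \<rightarrow>\<^sub>E \<Lambda>. \<phi> g \<in> Q} / real (card \<Lambda>) ^ r \<le> 1" by simp
  then have "v * (card {g \<in> {..<r} \<rightarrow>\<^sub>E \<Lambda>. \<phi> g \<in> Q} / real (card \<Lambda>) ^ r) \<le> real v * 1"
    by (rule mult_left_mono) simp
  then show ?thesis
    using floor_counts(1)[OF assms(1,2,4), of v r \<phi>] by linarith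
qed

text \<open>\<open>Free\<close> hosts are joined to all hosts that are not \<open>Isolated\<close>; they take up the vertices of
  smallest rank and those left over by the random typing.\<close>

datatype ('x, 't) slot = Free | Isolated | Typed 'x 't

fun compat :: "('x \<Rightarrow> 't \<Rightarrow> 'x \<Rightarrow> 't \<Rightarrow> bool) \<Rightarrow> ('x, 't) slot \<Rightarrow> ('x, 't) slot \<Rightarrow> bool" where
  "compat R Isolated _ = False"
| "compat R _ Isolated = False"
| "compat R Free _ = True"
| "compat R _ Free = True"
| "compat R (Typed x a) (Typed y b) = R x a y b"

text \<open>\<open>F x\<close> says that \<open>r x\<close> exceeds all degrees in the class \<open>V x\<close>, so that the patterns of this
  class show the labels of all neighbours of rank at least \<open>s\<close>.\<close>

lemma random_host:
  fixes V :: "'x \<Rightarrow> nat set" and \<phi> :: "'x \<Rightarrow> (nat \<Rightarrow> 'l) \<Rightarrow> 't" and E :: "'x \<Rightarrow> real"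
    and R :: "'x \<Rightarrow> 't \<Rightarrow> 'x \<Rightarrow> 't \<Rightarrow> bool" and r :: "'x \<Rightarrow> nat" and \<Lambda> :: "'l set"
  defines "b \<equiv> \<lambda>x p. nat \<lfloor>real (card (V x)) * type_prob (r x) \<Lambda> (\<phi> x) p - E x\<rfloor>"
  assumes n0: "n0 \<le> n" "n0 = n \<or> 2 * m \<le> n0" and sD: "2 * m < Suc s * Suc D"
    and X: "finite X" and V: "\<And>x. x \<in> X \<Longrightarrow> V x \<subseteq> {s..<n0}"
    and disj: "\<And>x y. x \<in> X \<Longrightarrow> y \<in> X \<Longrightarrow> x \<noteq> y \<Longrightarrow> V x \<inter> V y = {}"
    and r: "\<And>x. x \<in> X \<Longrightarrow> r x \<ge> 1"
    and \<Lambda>: "finite \<Lambda>" "\<Lambda> \<noteq> {}"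
    and P: "\<And>x. x \<in> X \<Longrightarrow> finite (P x)" and E: "\<And>x. x \<in> X \<Longrightarrow> E x > 0"
    and small: "(\<Sum>x\<in>X. real (card (P x)) * real (card (V x))
      * real (if r x = 1 then 1 else r x * (D + 1)) / (E x)\<^sup>2) < 1"
    and full: "\<And>x i. x \<in> X \<Longrightarrow> F x \<Longrightarrow> i \<in> V x \<Longrightarrow> 2 * m < Suc i * r x"
    and Rsym: "\<And>x a y b. R x a y b \<Longrightarrow> R y b x a"
    and Rok: "\<And>x y g h. \<lbrakk>x \<in> X; y \<in> X; g \<in> {..<r x} \<rightarrow>\<^sub>E \<Lambda>; h \<in> {..<r y} \<rightarrow>\<^sub>E \<Lambda>;
        F x \<Longrightarrow> h 0 \<in> g ` {1..<r x}; F y \<Longrightarrow> g 0 \<in> h ` {1..<r y}\<rbrakk>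
      \<Longrightarrow> R x (\<phi> x g) y (\<phi> y h)"
  obtains \<theta> where
    "\<And>x Q. x \<in> X \<Longrightarrow> Q \<subseteq> P x \<Longrightarrow> card {i. i < n \<and> \<theta> i \<in> Typed x ` Q} = (\<Sum>p\<in>Q. b x p)"
    "card {i. i < n \<and> \<theta> i = Free} = n0 - (\<Sum>x\<in>X. \<Sum>p\<in>P x. b x p)"
    "card {i. i < n \<and> \<theta> i = Isolated} = n - n0"
    "\<And>i. \<theta> i = Free \<or> \<theta> i = Isolated \<or> (\<exists>x\<in>X. \<exists>p\<in>P x. \<theta> i = Typed x p)"
    "min_universal_edges n m \<le> card (edges (typed_graph n (compat R) \<theta>))"
proof -
  define PP where "PP = (\<lambda>(x, p). Typed x p) ` Sigma X P"
  define b' where "b' = (\<lambda>\<pi>. case \<pi> of Typed x p \<Rightarrow> b x p | _ \<Rightarrow> 0)"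
  have fPP: "finite PP" unfolding PP_def using X P by auto
  have inj: "inj_on (\<lambda>(x, p). Typed x p) (Sigma X P)" by (auto simp: inj_on_def)
  have fV: "finite (V x)" if "x \<in> X" for x using V[OF that] finite_subset by blast
  have sumPP: "(\<Sum>\<pi>\<in>PP. b' \<pi>) = (\<Sum>x\<in>X. \<Sum>p\<in>P x. b x p)"
    unfolding PP_def using X P
    by (subst sum.reindex[OF inj]) (simp add: b'_def split_beta sum.Sigma)
  also have "\<dots> \<le> (\<Sum>x\<in>X. card (V x))"
    unfolding b_def
    by (rule sum_mono, rule floor_counts_le) (use P \<Lambda> E in \<open>auto intro: less_imp_le\<close>)
  also have "\<dots> = card (\<Union>x\<in>X. V x)"
    using X fV disj by (subst card_UN_disjoint) auto
  also have "\<dots> \<le> card {..<n0}"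
    by (rule card_mono) (use V in fastforce)+
  finally have sumPP_le: "(\<Sum>\<pi>\<in>PP. b' \<pi>) \<le> n0" by simp
  have notin: "Free \<notin> PP" "Isolated \<notin> PP" "Free \<noteq> Isolated" by (auto simp: PP_def)
  obtain \<theta> where \<theta>:
    "\<And>\<pi>. \<pi> \<in> PP \<Longrightarrow> card {i. i < n \<and> \<theta> i = \<pi>} = b' \<pi>"
    "card {i. i < n \<and> \<theta> i = Free} = n0 - (\<Sum>\<pi>\<in>PP. b' \<pi>)"
    "card {i. i < n \<and> \<theta> i = Isolated} = n - n0"
    "\<And>i. \<theta> i \<in> insert Free (insert Isolated PP)"
    by (rule host_typing[OF fPP sumPP_le n0(1) notin], rule that) (assumption | blast)+
  have range: "\<theta> i = Free \<or> \<theta> i = Isolated \<or> (\<exists>x\<in>X. \<exists>p\<in>P x. \<theta> i = Typed x p)" for i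
    using \<theta>(4)[of i] by (auto simp: PP_def)
  have count: "card {i. i < n \<and> \<theta> i = Typed x p} = b x p" if "x \<in> X" "p \<in> P x" for x p
    using \<theta>(1)[of "Typed x p"] that by (force simp: PP_def b'_def)
  have 1: "card {i. i < n \<and> \<theta> i \<in> Typed x ` Q} = (\<Sum>p\<in>Q. b x p)"
    if "x \<in> X" "Q \<subseteq> P x" for x Q
  proof -
    have "{i. i < n \<and> \<theta> i \<in> Typed x ` Q} = (\<Union>p\<in>Q. {i. i < n \<and> \<theta> i = Typed x p})" by auto
    also have "card \<dots> = (\<Sum>p\<in>Q. card {i. i < n \<and> \<theta> i = Typed x p})"
      using P[OF that(1)] that(2) finite_subset by (subst card_UN_disjoint) auto
    also have "\<dots> = (\<Sum>p\<in>Q. b x p)" using count that by (intro sum.cong) auto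
    finally show ?thesis .
  qed
  have 5: "min_universal_edges n m \<le> card (edges (typed_graph n (compat R) \<theta>))"
  proof (rule min_universal_edges_le_typed[where free = Free])
    fix \<pi> \<rho> assume "compat R \<pi> \<rho>"
    then show "compat R \<rho> \<pi>" using Rsym by (cases \<pi>; cases \<rho>) auto
  next
    fix N assume N: "ranked_nbhd n m N"
    have degN: "Suc i * card (N i) \<le> 2 * m" if "i < n" for i
      using N that by (auto simp: ranked_nbhd_def)
    have sub: "N i \<subseteq> {..<n}" if "i < n" for i using N that by (auto simp: ranked_nbhd_def)
    have symN: "i \<in> N j" if "i < n" "j \<in> N i" for i j
      using N that by (auto simp: ranked_nbhd_def)
    have deg: "card (N i) \<le> D" if "s \<le> i" "i < n" for i
    proof (rule ccontr)
      assume "\<not> card (N i) \<le> D"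
      then have "Suc s * Suc D \<le> Suc i * card (N i)"
        using that by (intro mult_le_mono) auto
      then show False using degN[OF \<open>i < n\<close>] sD by linarith
    qed
    \<comment> \<open>A vertex of rank at least \<open>2 * m\<close> has degree 0; in the other
      case, \<open>n0 = n\<close>, there is no such \<open>i\<close>.\<close>
    have iso: "N i = {}" if "n0 \<le> i" "i < n" for i
    proof (rule ccontr)
      assume "N i \<noteq> {}"
      then have "card (N i) \<ge> 1"
        using sub[OF \<open>i < n\<close>] by (metis card_gt_0_iff finite_lessThan finite_subset less_eq_Suc_le One_nat_def)
      then have "Suc i * 1 \<le> Suc i * card (N i)" by (rule mult_le_mono2)
      then have "Suc i * 1 \<le> 2 * m" using degN[OF \<open>i < n\<close>] by (rule order_trans)
      then show False using n0 that by auto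
    qed
    have Vn: "V x \<subseteq> {s..<n}" if "x \<in> X" for x using V[OF that] n0(1) by fastforce
    obtain lab pat where
      lab: "\<And>i. i < n \<Longrightarrow> lab i \<in> \<Lambda>"
      and pat: "\<And>x i. x \<in> X \<Longrightarrow> i \<in> V x \<Longrightarrow> pat x i \<in> {..<r x} \<rightarrow>\<^sub>E \<Lambda> \<and> pat x i 0 = lab i"
      and seen: "\<And>x i j. x \<in> X \<Longrightarrow> i \<in> V x \<Longrightarrow> card (N i) < r x \<Longrightarrow> j \<in> N i \<Longrightarrow> s \<le> j
        \<Longrightarrow> lab j \<in> pat x i ` {1..<r x}"
      and cnt: "\<And>x \<pi>. x \<in> X \<Longrightarrow> \<pi> \<in> P x \<Longrightarrow>
        real (card (V x)) * type_prob (r x) \<Lambda> (\<phi> x) \<pi> - E x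
          \<le> real (card {i \<in> V x. \<phi> x (pat x i) = \<pi>})"
      by (rule exists_labelling[where \<phi> = \<phi>, OF N deg X Vn r \<Lambda> P E small], assumption+,
          rule that) (assumption | blast)+
    define cl where "cl = (\<lambda>i. THE x. x \<in> X \<and> i \<in> V x)"
    have cl: "cl i = x" if "x \<in> X" "i \<in> V x" for i x
      unfolding cl_def using that disj by (intro the_equality) auto
    \<comment> \<open>\<open>Free\<close> is exempt from the count condition, so it can absorb all
      guests of rank below \<open>n0\<close> outside the classes, in particular the high degrees at
      ranks below \<open>s\<close>.\<close>
    define \<tau> where "\<tau> = (\<lambda>i. if \<exists>x\<in>X. i \<in> V x then Typed (cl i) (\<phi> (cl i) (pat (cl i) i))
      else if i < n0 then Free else Isolated)"
    have \<tau>: "\<tau> i = Typed x (\<phi> x (pat x i))" if "x \<in> X" "i \<in> V x" for i x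
      using cl[OF that] that by (auto simp: \<tau>_def)
    have \<tau>_cases: "\<tau> i = Free \<and> i < n0 \<or> \<tau> i = Isolated \<and> n0 \<le> i \<or> (\<exists>x\<in>X. i \<in> V x \<and> i < n0)" for i
    proof (cases "\<exists>x\<in>X. i \<in> V x")
      case True
      then obtain x where "x \<in> X" "i \<in> V x" by blast
      then show ?thesis using V[of x] by auto
    next
      case False
      then show ?thesis by (simp only: \<tau>_def if_False) (simp add: not_less)
    qed
    have "card {i. i < n \<and> \<theta> i = \<pi>} \<le> card {i. i < n \<and> \<tau> i = \<pi>}" if "\<pi> \<noteq> Free" for \<pi>
    proof (cases \<pi>)
      case (Typed x p)
      show ?thesis
      proof (cases "x \<in> X \<and> p \<in> P x")
        case True
        have "card {i. i < n \<and> \<theta> i = \<pi>} = b x p" using count True Typed by simp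
        also have "\<dots> \<le> card {i \<in> V x. \<phi> x (pat x i) = p}"
          using cnt[of x p] True unfolding b_def by linarith
        also have "\<dots> \<le> card {i. i < n \<and> \<tau> i = \<pi>}"
        proof (rule card_mono)
          show "{i \<in> V x. \<phi> x (pat x i) = p} \<subseteq> {i. i < n \<and> \<tau> i = \<pi>}"
            using \<tau>[of x] True Typed Vn[of x] by auto
        qed simp
        finally show ?thesis .
      next
        case False
        then have "\<theta> i \<noteq> \<pi>" for i using range[of i] Typed by auto
        then show ?thesis by simp
      qed
    next
      case Isolated
      have "{n0..<n} \<subseteq> {i. i < n \<and> \<tau> i = Isolated}" 
      proof
        fix i assume i: "i \<in> {n0..<n}"
        then have "\<not> i < n0" by simp
        then show "i \<in> {i. i < n \<and> \<tau> i = Isolated}" using \<tau>_cases[of i] i by auto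
      qed
      then have "card {n0..<n} \<le> card {i. i < n \<and> \<tau> i = Isolated}" by (intro card_mono) auto
      then show ?thesis using Isolated \<theta>(3) by simp
    qed (use that in auto)
    moreover have "compat R (\<tau> i) (\<tau> j) \<and> compat R Free (\<tau> i) \<and> compat R Free Free"
      if ij: "i < n" "j \<in> N i" for i j
    proof -
      have jn: "j < n" using sub ij by auto
      have "i \<in> N j" using symN ij by auto
      then have "i < n0" "j < n0" using iso[OF _ \<open>i < n\<close>] iso[OF _ jn] ij(2) by (metis empty_iff not_le)+
      then have ci: "\<tau> i = Free \<or> (\<exists>x\<in>X. i \<in> V x)" and cj: "\<tau> j = Free \<or> (\<exists>x\<in>X. j \<in> V x)"
        using \<tau>_cases[of i] \<tau>_cases[of j] by auto
      have nI: "\<tau> i \<noteq> Isolated" "\<tau> j \<noteq> Isolated" using ci cj \<tau> by auto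
      have less_r: "card (N i) < r x" if "i < n" "x \<in> X" "i \<in> V x" "F x" for i x
      proof -
        have "Suc i * card (N i) < Suc i * r x"
          using degN[OF that(1)] full[OF that(2,4,3)] by linarith
        then show ?thesis by (simp only: nat_mult_less_cancel1)
      qed
      have "compat R (\<tau> i) (\<tau> j)"
      proof (cases "(\<exists>x\<in>X. i \<in> V x) \<and> (\<exists>x\<in>X. j \<in> V x)")
        case True
        then obtain x y where xy: "x \<in> X" "i \<in> V x" "y \<in> X" "j \<in> V y" by blast
        have s: "s \<le> i" "s \<le> j" using Vn[OF xy(1)] Vn[OF xy(3)] xy by auto
        have "R x (\<phi> x (pat x i)) y (\<phi> y (pat y j))"
        proof (rule Rok[OF xy(1,3)])
          show "pat x i \<in> {..<r x} \<rightarrow>\<^sub>E \<Lambda>" "pat y j \<in> {..<r y} \<rightarrow>\<^sub>E \<Lambda>" using pat xy by auto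
          show "pat y j 0 \<in> pat x i ` {1..<r x}" if "F x"
            using seen[OF xy(1,2) less_r[OF ij(1) xy(1,2) that] ij(2) s(2)] pat xy by metis
          show "pat x i 0 \<in> pat y j ` {1..<r y}" if "F y"
            using seen[OF xy(3,4) less_r[OF jn xy(3,4) that] \<open>i \<in> N j\<close> s(1)] pat xy by metis
        qed
        then show ?thesis using \<tau> xy by simp
      next
        case False
        then have "\<tau> i = Free \<or> \<tau> j = Free" using ci cj by blast
        then show ?thesis using nI by (cases "\<tau> i"; cases "\<tau> j") auto
      qed
      then show ?thesis using nI by (cases "\<tau> i") auto
    qed
    ultimately show "\<exists>\<tau>. (\<forall>\<pi>. \<pi> \<noteq> Free \<longrightarrow> card {i. i < n \<and> \<theta> i = \<pi>} \<le> card {i. i < n \<and> \<tau> i = \<pi>}) \<and>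
        (\<forall>i<n. \<forall>j\<in>N i. compat R (\<tau> i) (\<tau> j) \<and> compat R Free (\<tau> i) \<and> compat R Free Free)"
      by (intro exI[of _ \<tau>]) blast
  qed
  show thesis by (rule that[OF 1 \<theta>(2)[unfolded sumPP] \<theta>(3) range 5])
qed

subsection \<open>The dense range\<close>

text \<open>Slot 0 holds the own label and is unrestricted, hence the factor \<open>Q\<close>; each
  of the \<open>D\<close> other slots loses one value.\<close>

lemma card_avoiding:
  assumes "t < (Q :: nat)"
  shows "card {g \<in> {..<Suc D} \<rightarrow>\<^sub>E {..<Q}. t \<notin> g ` {1..<Suc D}} = Q * (Q - 1) ^ D"
proof -
  have "{g \<in> {..<Suc D} \<rightarrow>\<^sub>E {..<Q}. t \<notin> g ` {1..<Suc D}}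
      = (\<Pi>\<^sub>E k\<in>{..<Suc D}. if k = 0 then {..<Q} else {..<Q} - {t})" (is "?A = ?B")
  proof (rule set_eqI, rule iffI)
    fix g assume g: "g \<in> ?A"
    show "g \<in> ?B"
    proof (rule PiE_I)
      fix k assume "k \<in> {..<Suc D}"
      then show "g k \<in> (if k = 0 then {..<Q} else {..<Q} - {t})"
        using g PiE_mem[of g "{..<Suc D}" "\<lambda>_. {..<Q}" k] by (auto simp: image_iff)
    qed (use g PiE_arb in fastforce)
  next
    fix g assume g: "g \<in> ?B"
    have mem: "g k \<in> (if k = 0 then {..<Q} else {..<Q} - {t})" if "k < Suc D" for k
      using PiE_mem[OF g, of k] that by simp
    have "g \<in> {..<Suc D} \<rightarrow>\<^sub>E {..<Q}"
    proof (rule PiE_I)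
      fix k assume "k \<in> {..<Suc D}"
      then show "g k \<in> {..<Q}" using mem[of k] by (auto split: if_splits)
    qed (use g PiE_arb in fastforce)
    moreover have "t \<notin> g ` {1..<Suc D}"
    proof
      assume "t \<in> g ` {1..<Suc D}"
      then obtain k where "1 \<le> k" "k < Suc D" "g k = t" by auto
      then show False using mem[of k] by simp
    qed
    ultimately show "g \<in> ?A" by simp
  qed
  also have "card \<dots> = (\<Prod>k<Suc D. card (if k = 0 then {..<Q} else {..<Q} - {t}))"
    by (simp add: card_PiE)
  also have "\<dots> = Q * (Q - 1) ^ D"
    using assms by (subst prod.lessThan_Suc_shift) simp
  finally show ?thesis .
qed

text \<open>The rectangles \<open>A t \<times> B t\<close> consist of nonedges. They are disjoint
  because their first sides are, and no vertex lies on both a first and a second side, so no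
  unordered pair is counted twice.\<close>

lemma card_typed_edges_add_nonedges_le:
  fixes n :: nat
  assumes fin: "finite T" and AB: "\<And>t. t \<in> T \<Longrightarrow> A t \<subseteq> {..<n} \<and> B t \<subseteq> {..<n}"
    and disj: "\<And>t u. t \<in> T \<Longrightarrow> u \<in> T \<Longrightarrow> t \<noteq> u \<Longrightarrow> A t \<inter> A u = {}"
    and AB_disj: "\<And>t u. t \<in> T \<Longrightarrow> u \<in> T \<Longrightarrow> A t \<inter> B u = {}"
    and non: "\<And>t i j. t \<in> T \<Longrightarrow> i \<in> A t \<Longrightarrow> j \<in> B t \<Longrightarrow> \<not> R (\<theta> i) (\<theta> j) \<and> \<not> R (\<theta> j) (\<theta> i)"
  shows "card (edges (typed_graph n R \<theta>)) + (\<Sum>t\<in>T. card (A t) * card (B t)) \<le> n choose 2"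
proof -
  define Z where "Z = (\<Union>t\<in>T. A t \<times> B t)"
  have fAB: "finite (A t)" "finite (B t)" if "t \<in> T" for t
    using AB[OF that] finite_subset by blast+
  have "card Z = (\<Sum>t\<in>T. card (A t \<times> B t))"
    unfolding Z_def using fin fAB disj by (subst card_UN_disjoint) fastforce+
  then have cZ: "card Z = (\<Sum>t\<in>T. card (A t) * card (B t))" by (simp add: card_cartesian_product)
  define \<psi> where "\<psi> = (\<lambda>(i :: nat, j). {i, j})"
  have cross: "i \<noteq> j'" if "(i, j) \<in> Z" "(i', j') \<in> Z" for i j i' j'
    using that AB_disj unfolding Z_def by blast
  have "inj_on \<psi> Z"
  proof (rule inj_onI)
    fix p p' assume p: "p \<in> Z" "p' \<in> Z" "\<psi> p = \<psi> p'"
    obtain i j i' j' where eq: "p = (i, j)" "p' = (i', j')" by (metis surj_pair)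
    have "i \<noteq> j'" using cross p(1,2) eq by blast
    moreover have "{i, j} = {i', j'}" using p(3) eq by (simp add: \<psi>_def)
    ultimately show "p = p'" using eq by (auto simp: doubleton_eq_iff)
  qed
  moreover have sub: "\<psi> ` Z \<subseteq> nsets {..<n} 2"
  proof (rule image_subsetI)
    fix p assume p: "p \<in> Z"
    obtain i j where ij: "p = (i, j)" by (metis surj_pair)
    then obtain t where "t \<in> T" "i \<in> A t" "j \<in> B t" using p by (auto simp: Z_def)
    then have "i < n" "j < n" using AB[of t] by auto
    moreover have "i \<noteq> j" using cross p ij by blast
    ultimately show "\<psi> p \<in> nsets {..<n} 2" using ij by (simp add: \<psi>_def nsets_def)
  qed
  moreover have "edges (typed_graph n R \<theta>) \<inter> \<psi> ` Z = {}"
  proof (rule ccontr)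
    assume "edges (typed_graph n R \<theta>) \<inter> \<psi> ` Z \<noteq> {}"
    then obtain e p where e: "e \<in> edges (typed_graph n R \<theta>)" "e = \<psi> p" "p \<in> Z" by blast
    obtain a b where "e = {a, b}" "R (\<theta> a) (\<theta> b)" using e(1) by (auto simp: typed_graph_def)
    moreover obtain t i j where "p = (i, j)" and t: "t \<in> T" "i \<in> A t" "j \<in> B t"
      using e(3) unfolding Z_def by blast
    ultimately have ab: "R (\<theta> a) (\<theta> b)" "{a, b} = {i, j}" using e(2) by (simp_all add: \<psi>_def)
    then show False using non[OF t] by (auto simp: doubleton_eq_iff)
  qed
  ultimately have "card (edges (typed_graph n R \<theta>)) + card Z = card (edges (typed_graph n R \<theta>) \<union> \<psi> ` Z)"
    using finite_edges[OF simple_typed_graph] finite_subset[OF sub] finite_imp_finite_nsets[of "{..<n}"]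
    by (subst card_Un_disjoint) (auto simp: card_image)
  also have "\<dots> \<le> card (nsets {..<n} 2)"
  proof (rule card_mono)
    show "edges (typed_graph n R \<theta>) \<union> \<psi> ` Z \<subseteq> nsets {..<n} 2"
      using sub simple_typed_graph[of n R \<theta>] by (auto simp: simple_graph_def typed_graph_def)
  qed (simp add: finite_imp_finite_nsets)
  finally show ?thesis using cZ by simp
qed

text \<open>Class 0 shows its own label, class 1 the set of labels below \<open>L\<close> occurring among its
  neighbours; the only missing edges of the host join a label \<open>t < L\<close> to a set without \<open>t\<close>.\<close>

lemma dense_host:
  fixes n m D q L :: nat and E0 E1 :: real
  assumes D: "D = 4 * m div n" "1 \<le> D" and q: "q = n div 4" "1 \<le> q" and L: "L \<le> 2 * D"
    and E: "E0 > 0" "E1 > 0"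
    and small: "real L * q / E0\<^sup>2 + 2 ^ L * real q * (real (D + 1) * (D + 1)) / E1\<^sup>2 < 1"
    and pos: "0 \<le> q / (2 * real D) - (E0 + 1)" "0 \<le> q / 2 - 2 ^ L * (E1 + 1)"
  shows "real (min_universal_edges n m)
      + L * ((q / (2 * real D) - (E0 + 1)) * (q / 2 - 2 ^ L * (E1 + 1))) \<le> real (n choose 2)"
proof -
  \<comment> \<open>With \<open>2 * D\<close> labels, the \<open>D\<close> random labels read by
    class 1 miss a fixed one with probability at least \<open>1 / 2\<close>, by Bernoulli's
    inequality.\<close>
  define \<Lambda> where "\<Lambda> = {..<2 * D}"
  \<comment> \<open>The last two blocks of \<open>q\<close> ranks: from rank
    \<open>n - 2 * q \<ge> n / 2\<close> on, degrees are at most \<open>4 * m / n\<close>, hence at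
    most \<open>D\<close>.\<close>
  define V where "V = (\<lambda>x :: nat. if x = 0 then {n - 2 * q..<n - q} else {n - q..<n})"
  define r where "r = (\<lambda>x :: nat. if x = 0 then 1 else D + 1)"
  define \<phi> :: "nat \<Rightarrow> (nat \<Rightarrow> nat) \<Rightarrow> nat \<times> nat set"
    where "\<phi> = (\<lambda>x g. if x = 0 then (g 0, {}) else (0, {..<L} \<inter> g ` {1..<D + 1}))"
  define P :: "nat \<Rightarrow> (nat \<times> nat set) set" where
    "P = (\<lambda>x. if x = 0 then (\<lambda>t. (t, {})) ` {..<L} else Pair 0 ` Pow {..<L})"
  define Er where "Er = (\<lambda>x :: nat. if x = 0 then E0 else E1)"
  define bad :: "nat \<Rightarrow> nat \<times> nat set \<Rightarrow> nat \<Rightarrow> nat \<times> nat set \<Rightarrow> bool"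
    where "bad = (\<lambda>x a y b. x = 0 \<and> y = 1 \<and> fst a < L \<and> fst a \<notin> snd b)"
  define R where "R = (\<lambda>x a y b. \<not> bad x a y b \<and> \<not> bad y b x a)"
  have q4: "4 * q \<le> n" using q by simp
  have cV: "card (V x) = q" for x using q4 by (auto simp: V_def)
  have finP: "finite (P x)" for x by (simp add: P_def)
  have cP: "card (P 0) = L" "card (P (Suc 0)) = 2 ^ L"
    by (simp_all add: P_def card_image inj_on_def card_Pow)
  have c\<Lambda>: "card \<Lambda> = 2 * D" "finite \<Lambda>" "\<Lambda> \<noteq> {}" using D(2) by (simp_all add: \<Lambda>_def lessThan_empty_iff)
  have n: "n > 0" using q by (cases n) auto
  have sD: "2 * m < Suc (n - 2 * q) * Suc D"
  proof -
    have "4 * m < n * Suc D"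
      unfolding D(1) using n by (metis dividend_less_times_div mult_Suc_right add.commute)
    also have "\<dots> \<le> (2 * Suc (n - 2 * q)) * Suc D"
      using q4 by (intro mult_le_mono1) arith
    finally show ?thesis by simp
  qed
  obtain \<theta> where \<theta>: "\<And>x Q. x \<in> {0, 1} \<Longrightarrow> Q \<subseteq> P x \<Longrightarrow>
      card {i. i < n \<and> \<theta> i \<in> Typed x ` Q}
        = (\<Sum>p\<in>Q. nat \<lfloor>real (card (V x)) * type_prob (r x) \<Lambda> (\<phi> x) p - Er x\<rfloor>)"
    and g: "min_universal_edges n m \<le> card (edges (typed_graph n (compat R) \<theta>))"
  proof (rule random_host[of n n m "n - 2 * q" D "{0, 1}" V r \<Lambda> P Er "\<lambda>x. x = 1" R \<phi>])
    show "(\<Sum>x\<in>{0, 1}. real (card (P x)) * real (card (V x)) *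
        real (if r x = 1 then 1 else r x * (D + 1)) / (Er x)\<^sup>2) < 1"
      using small D(2) by (simp add: cP cV r_def Er_def algebra_simps add_divide_distrib)
    show "2 * m < Suc i * r x" if "x \<in> {0, 1}" "x = 1" "i \<in> V x" for x i
    proof -
      have "Suc (n - 2 * q) * Suc D \<le> Suc i * Suc D"
        using that by (intro mult_le_mono1) (auto simp: V_def)
      then show ?thesis using sD that by (simp add: r_def)
    qed
    show "R x (\<phi> x g) y (\<phi> y h)"
      if "x \<in> {0, 1}" "y \<in> {0, 1}" "x = 1 \<Longrightarrow> h 0 \<in> g ` {1..<r x}" "y = 1 \<Longrightarrow> g 0 \<in> h ` {1..<r y}"
      for x y g h
      using that by (auto simp: R_def bad_def \<phi>_def r_def)
  qed (use sD q4 D E finP c\<Lambda> in \<open>auto simp: V_def r_def Er_def R_def\<close>)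
  define A where "A = (\<lambda>t. {i. i < n \<and> \<theta> i \<in> Typed 0 ` {(t, {})}})"
  define Q where "Q = (\<lambda>t :: nat. Pair (0 :: nat) ` {\<sigma> \<in> Pow {..<L}. t \<notin> \<sigma>})"
  define B where "B = (\<lambda>t. {i. i < n \<and> \<theta> i \<in> Typed 1 ` Q t})"
  have edge: "card (edges (typed_graph n (compat R) \<theta>)) + (\<Sum>t<L. card (A t) * card (B t)) \<le> n choose 2"
    by (rule card_typed_edges_add_nonedges_le) (auto simp: A_def B_def Q_def R_def bad_def)
  have cA: "real (card (A t)) \<ge> q / (2 * real D) - (E0 + 1)" if "t < L" for t
  proof -
    have "card (A t) = (\<Sum>p\<in>{(t, {})}. nat \<lfloor>real q * type_prob 1 \<Lambda> (\<phi> 0) p - E0\<rfloor>)"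
      unfolding A_def using \<theta>[of 0 "{(t, {})}"] that cV by (simp add: P_def r_def Er_def)
    moreover have "{g \<in> {..<1} \<rightarrow>\<^sub>E \<Lambda>. \<phi> 0 g \<in> {(t, {})}} = {restrict (\<lambda>_. t) {..<1}}"
    proof -
      have "g = restrict (\<lambda>_. t) {..<1}" if g: "g \<in> {..<1 :: nat} \<rightarrow>\<^sub>E \<Lambda>" "g 0 = t" for g
        using PiE_arb[OF g(1)] g(2) by (auto simp: fun_eq_iff)
      moreover have "restrict (\<lambda>_. t) {..<1 :: nat} \<in> {..<1} \<rightarrow>\<^sub>E \<Lambda>"
        unfolding restrict_PiE_iff using that L by (simp add: \<Lambda>_def)
      moreover have "restrict (\<lambda>_. t) {..<1 :: nat} 0 = t" by simp
      ultimately show ?thesis unfolding \<phi>_def if_P[OF refl] by blast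
    qed
    ultimately show ?thesis
      using floor_counts(2)[of "{(t, {})}" \<Lambda> E0 q 1 "\<phi> 0"] c\<Lambda> E by simp
  qed
  have cB: "real (card (B t)) \<ge> q / 2 - 2 ^ L * (E1 + 1)" if "t < L" for t
  proof -
    have fQ: "finite (Q t)" "card (Q t) \<le> 2 ^ L"
    proof -
      show "finite (Q t)" by (simp add: Q_def)
      have "card (Q t) \<le> card (P 1)" by (rule card_mono) (auto simp: finP Q_def P_def)
      then show "card (Q t) \<le> 2 ^ L" using cP by simp
    qed
    have "card (B t) = (\<Sum>p\<in>Q t. nat \<lfloor>real q * type_prob (D + 1) \<Lambda> (\<phi> 1) p - E1\<rfloor>)"
      unfolding B_def using \<theta>[of 1 "Q t"] cV by (auto simp: Q_def P_def r_def Er_def)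
    then have *: "q * (card {g \<in> {..<D + 1} \<rightarrow>\<^sub>E \<Lambda>. \<phi> 1 g \<in> Q t} / real (card \<Lambda>) ^ (D + 1))
        - card (Q t) * (E1 + 1) \<le> card (B t)"
      using floor_counts(2)[of "Q t" \<Lambda> E1 q "D + 1" "\<phi> 1"] c\<Lambda> E fQ by simp
    have "{g \<in> {..<D + 1} \<rightarrow>\<^sub>E \<Lambda>. \<phi> 1 g \<in> Q t}
        = {g \<in> {..<Suc D} \<rightarrow>\<^sub>E {..<2 * D}. t \<notin> g ` {1..<Suc D}}"
      using that by (auto simp: \<phi>_def Q_def \<Lambda>_def)
    then have "card {g \<in> {..<D + 1} \<rightarrow>\<^sub>E \<Lambda>. \<phi> 1 g \<in> Q t} = 2 * D * (2 * D - 1) ^ D"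
      using card_avoiding[of t "2 * D" D] that L by simp
    then have "card {g \<in> {..<D + 1} \<rightarrow>\<^sub>E \<Lambda>. \<phi> 1 g \<in> Q t} / real (card \<Lambda>) ^ (D + 1)
        = (real (2 * D - 1) / real (2 * D)) ^ D"
      using D(2) c\<Lambda>(1) by (simp add: power_divide)
    also have "real (2 * D - 1) / real (2 * D) = 1 + (- 1 / (2 * D))"
      using D(2) by (simp add: field_simps of_nat_diff)
    also have "(1 + (- 1 / (2 * D))) ^ D \<ge> 1 + real D * (- 1 / (2 * D))"
      using D(2) by (intro Bernoulli_inequality) (simp add: field_simps)
    finally have "1 / 2 \<le> card {g \<in> {..<D + 1} \<rightarrow>\<^sub>E \<Lambda>. \<phi> 1 g \<in> Q t} / real (card \<Lambda>) ^ (D + 1)"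
      using D(2) by (simp add: field_simps)
    then have "q * (1 / 2) \<le> q * (card {g \<in> {..<D + 1} \<rightarrow>\<^sub>E \<Lambda>. \<phi> 1 g \<in> Q t} / real (card \<Lambda>) ^ (D + 1))"
      by (rule mult_left_mono) simp
    moreover have "real (card (Q t)) * (E1 + 1) \<le> 2 ^ L * (E1 + 1)"
      using fQ(2) E by (intro mult_right_mono) (auto simp flip: of_nat_le_iff)
    ultimately show ?thesis using * by linarith
  qed
  have "real L * ((q / (2 * real D) - (E0 + 1)) * (q / 2 - 2 ^ L * (E1 + 1)))
      = (\<Sum>t<L. (q / (2 * real D) - (E0 + 1)) * (q / 2 - 2 ^ L * (E1 + 1)))" by simp
  also have "\<dots> \<le> (\<Sum>t<L. real (card (A t)) * real (card (B t)))"
    by (intro sum_mono mult_mono cA cB pos) auto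
  also have "\<dots> = real (\<Sum>t<L. card (A t) * card (B t))" by simp
  finally show ?thesis using edge g by linarith
qed

text \<open>\<open>dense_host\<close> omits about \<open>L * (q / D) * q\<close> edges, which has
  order \<open>n^3 * ln n / m\<close> once \<open>L\<close> has order \<open>ln n\<close>. The
  obstacle is the loss \<open>2^L * (E1 + 1)\<close> in class 1: it is of order at most
  \<open>n^(\<delta>/3) * n^(\<delta>/6) * n^(1/2) * D\<close> with
  \<open>D \<le> 4 * n^(1/2 - \<delta>)\<close>, thus at most of order
  \<open>n^(1 - \<delta>/2)\<close> and finally below \<open>q / 4\<close>.\<close>

lemma dense_upper:
  fixes \<epsilon> :: real
  assumes "\<epsilon> > 0"
  shows "\<exists>c>0. \<exists>n0. \<forall>n m :: nat. n0 \<le> n \<and> real n * ln n < real m \<and> real m < real n powr (3 / 2 - \<epsilon>) \<longrightarrow>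
    c * (real n ^ 3 * ln n / m) \<le> real (n choose 2) - real (min_universal_edges n m)"
proof -
  \<comment> \<open>A smaller exponent only enlarges the range of \<open>m\<close>; the cap keeps
    \<open>1/2 - \<delta>\<close> positive.\<close>
  define \<delta> where "\<delta> = min \<epsilon> (1 / 4)"
  have \<delta>: "0 < \<delta>" "\<delta> \<le> 1 / 4" "\<delta> \<le> \<epsilon>" using assms by (auto simp: \<delta>_def)
  have "eventually (\<lambda>n :: nat. n powr (\<delta> / 3) * (2 * (n powr (\<delta> / 6) * n powr (1 / 2))
      * (4 * n powr (1 / 2 - \<delta>) + 1) + 1) \<le> real n / 20) at_top"
    using \<delta> by real_asymp
  moreover have "eventually (\<lambda>n :: nat. 2 * sqrt (n * ln n) + 1 \<le> n powr (1 / 2 + \<delta>) / 80) at_top"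
    using \<delta> by real_asymp
  moreover have "eventually (\<lambda>n :: nat. \<delta> / 3 * ln n - 1 \<ge> \<delta> / 6 * ln n) at_top"
    using \<delta> by real_asymp
  moreover have "eventually (\<lambda>n :: nat. \<delta> / 6 * ln n > 0) at_top"
    using \<delta> by real_asymp
  moreover have "eventually (\<lambda>n :: nat. ln n \<ge> 1) at_top"
    by real_asymp
  moreover have "eventually (\<lambda>n :: nat. n \<ge> 16) at_top" by (rule eventually_ge_at_top)
  ultimately have "eventually (\<lambda>n :: nat.
      n powr (\<delta> / 3) * (2 * (n powr (\<delta> / 6) * n powr (1 / 2)) * (4 * n powr (1 / 2 - \<delta>) + 1) + 1) \<le> real n / 20 \<and>
      2 * sqrt (n * ln n) + 1 \<le> n powr (1 / 2 + \<delta>) / 80 \<and>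
      \<delta> / 3 * ln n - 1 \<ge> \<delta> / 6 * ln n \<and> \<delta> / 6 * ln n > 0 \<and> ln n \<ge> 1 \<and> n \<ge> 16) at_top"
    by eventually_elim simp
  then obtain n0 where n0: "\<And>n :: nat. n \<ge> n0 \<Longrightarrow>
      n powr (\<delta> / 3) * (2 * (n powr (\<delta> / 6) * n powr (1 / 2)) * (4 * n powr (1 / 2 - \<delta>) + 1) + 1) \<le> real n / 20 \<and>
      2 * sqrt (n * ln n) + 1 \<le> n powr (1 / 2 + \<delta>) / 80 \<and>
      \<delta> / 3 * ln n - 1 \<ge> \<delta> / 6 * ln n \<and> \<delta> / 6 * ln n > 0 \<and> ln n \<ge> 1 \<and> n \<ge> 16"
    by (auto simp: eventually_at_top_linorder)
  show ?thesis
  proof (intro exI[of _ "\<delta> / 9600"] exI[of _ n0] conjI allI impI)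
    show "\<delta> / 9600 > 0" using \<delta> by simp
    fix n m :: nat
    assume "n0 \<le> n \<and> real n * ln n < real m \<and> real m < real n powr (3 / 2 - \<epsilon>)"
    then have m: "real n * ln n < real m" "real m < real n powr (3 / 2 - \<epsilon>)" and "n0 \<le> n" by auto
    note asym = n0[OF \<open>n0 \<le> n\<close>]
    have n16: "n \<ge> 16" and ln1: "ln (real n) \<ge> 1" using asym by auto
    define q where "q = n div 4"
    define D where "D = 4 * m div n"
    define L where "L = nat \<lfloor>\<delta> / 3 * ln n\<rfloor>"
    define x where "x = real n powr (1 / 2 - \<delta>)"
    \<comment> \<open>\<open>E0\<close> and \<open>E1\<close> are chosen so that each of the two
      terms in \<open>small\<close> equals \<open>q / (4 * n)\<close>.\<close>
    define E0 where "E0 = 2 * sqrt (L * n)"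
    define E1 where "E1 = 2 * sqrt (2 ^ L * n) * (D + 1)"
    have q: "1 \<le> q" "real n / 5 \<le> q" "q \<le> real n / 4"
      using n16 by (auto simp: q_def)
    have Dle: "real D \<le> 4 * real m / n"
      using of_nat_div_le_of_nat[of "4 * m" n, where ?'a = real] by (simp add: D_def)
    have Dge: "4 * real m / n - 1 \<le> real D"
    proof -
      have "4 * m < n + n * D"
        unfolding D_def using n16 by (intro dividend_less_times_div) auto
      then have "real (4 * m) < real (n + n * D)" by (simp only: of_nat_less_iff)
      then show ?thesis using n16 by (simp add: field_simps)
    qed
    have "ln n \<le> real m / n" using m(1) n16 by (simp add: field_simps)
    then have D4: "4 * ln n - 1 \<le> D" using Dge by simp
    then have D1: "1 \<le> D" using ln1 by linarith
    have "n powr (3 / 2 - \<epsilon>) \<le> n powr (3 / 2 - \<delta>)"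
      using \<delta>(3) n16 by (intro powr_mono) auto
    then have "real m \<le> n powr (3 / 2 - \<delta>)" using m(2) by linarith
    also have "\<dots> = x * n"
      using n16 powr_mult_base[of "real n" "1 / 2 - \<delta>"] by (simp add: x_def mult.commute)
    finally have "real m / n \<le> x" using n16 by (simp add: field_simps)
    then have Dx: "D \<le> 4 * x" using Dle by simp
    have Lfl: "\<delta> / 3 * ln n \<ge> 0" using \<delta> ln1 by simp
    have Lle: "real L \<le> \<delta> / 3 * ln n" 
    proof -
      have "real L = of_int \<lfloor>\<delta> / 3 * ln n\<rfloor>"
        unfolding L_def using Lfl by (intro of_nat_nat) (simp only: zero_le_floor)
      then show ?thesis by linarith
    qed
    have Lge: "\<delta> / 6 * ln n \<le> L" using asym Lfl unfolding L_def by linarith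
    then have L1: "1 \<le> L" using asym by (cases L) auto
    have "\<delta> / 3 * ln n \<le> 1 * ln n" using \<delta> ln1 by (intro mult_right_mono) auto
    then have Lln: "real L \<le> ln n" using Lle by simp
    then have LD: "L \<le> 2 * D" using D4 ln1 by linarith
    have pow2L: "2 ^ L \<le> n powr (\<delta> / 3)"
    proof -
      have "(2 :: real) ^ L \<le> exp 1 ^ L"
        using exp_ge_add_one_self[of 1] by (intro power_mono) auto
      also have "\<dots> = exp (real L)" by (simp flip: exp_of_nat_mult)
      also have "\<dots> \<le> exp (\<delta> / 3 * ln n)" using Lle by simp
      also have "\<dots> = n powr (\<delta> / 3)" using n16 by (simp add: powr_def)
      finally show ?thesis .
    qed
    have E0pos: "E0 > 0" using L1 n16 by (simp add: E0_def)
    have E1pos: "E1 > 0" using n16 by (simp add: E1_def)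
    have small: "real L * q / E0\<^sup>2 + 2 ^ L * real q * (real (D + 1) * (D + 1)) / E1\<^sup>2 < 1"
    proof -
      have "E0\<^sup>2 = 4 * (L * n)" by (simp add: E0_def power_mult_distrib)
      then have "real L * q / E0\<^sup>2 = q / (4 * n)" using L1 by simp
      moreover have "E1\<^sup>2 = 4 * n * (2 ^ L * (real (D + 1) * (D + 1)))"
        by (simp add: E1_def power_mult_distrib power2_eq_square)
      then have "2 ^ L * real q * (real (D + 1) * (D + 1)) / E1\<^sup>2 = q / (4 * n)"
        by (simp add: divide_simps del: of_nat_add)
      moreover have "q / (4 * real n) \<le> 1 / 16" using q n16 by (simp add: field_simps)
      ultimately show ?thesis by linarith
    qed
    have x0: "x > 0" using n16 by (simp add: x_def)
    have "E0 + 1 \<le> q / (4 * real D)"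
    proof -
      have "E0 \<le> 2 * sqrt (n * ln n)"
        unfolding E0_def mult.commute[of "real n"] of_nat_mult using Lln
        by (intro mult_left_mono real_sqrt_le_mono mult_right_mono) auto
      then have "E0 + 1 \<le> n powr (1 / 2 + \<delta>) / 80" using asym by linarith
      also have "n powr (1 / 2 + \<delta>) = n / x"
        using n16 powr_diff[of "real n" 1 "1 / 2 - \<delta>"] by (simp add: x_def)
      also have "n / x / 80 = (n / 5) / (4 * (4 * x))" by simp
      also have "\<dots> \<le> q / (4 * real D)"
        using q Dx D1 x0 by (intro frac_le) auto
      finally show ?thesis .
    qed
    then have A: "q / (4 * real D) \<le> q / (2 * real D) - (E0 + 1)"
      using D1 by (simp add: field_simps)
    have "2 ^ L * (E1 + 1) \<le> q / 4"
    proof -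
      have "sqrt (2 ^ L * n) \<le> sqrt (n powr (\<delta> / 3) * n)"
        using pow2L by (intro real_sqrt_le_mono) (simp add: mult_right_mono)
      also have "\<dots> = n powr (\<delta> / 6) * n powr (1 / 2)"
        using n16 by (simp add: real_sqrt_mult powr_half_sqrt[symmetric] powr_powr)
      finally have "E1 \<le> 2 * (n powr (\<delta> / 6) * n powr (1 / 2)) * (4 * x + 1)"
        unfolding E1_def using Dx by (intro mult_mono) auto
      then have "2 ^ L * (E1 + 1) \<le> n powr (\<delta> / 3) * (2 * (n powr (\<delta> / 6) * n powr (1 / 2)) * (4 * x + 1) + 1)"
        using pow2L E1pos by (intro mult_mono) auto
      also have "\<dots> \<le> n / 20" using asym by (simp add: x_def)
      also have "\<dots> \<le> q / 4" using q by simp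
      finally show ?thesis .
    qed
    then have B: "q / 4 \<le> q / 2 - 2 ^ L * (E1 + 1)" by simp
    have pos: "0 \<le> q / (2 * real D) - (E0 + 1)" "0 \<le> q / 2 - 2 ^ L * (E1 + 1)"
      by (rule order_trans[OF _ A], simp, rule order_trans[OF _ B], simp)
    have m0: "real m > 0" using m(1) ln1 n16 by (smt (verit) mult_nonneg_nonneg of_nat_0_le_iff)
    \<comment> \<open>9600 is \<open>6 * 80 * 20\<close>: the 6 comes from the lower bound on
      \<open>L\<close>, each of the other factors has a 5 from \<open>q \<ge> n / 5\<close>, and the
      remaining 16 and 4 are those of \<open>4 * D\<close> and \<open>q / 4\<close>.\<close>
    have "\<delta> / 9600 * (real n ^ 3 * ln n / m)
        = (\<delta> / 6 * ln n) * ((n / 5 / (4 * (4 * real m / n))) * (n / 5 / 4))"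
      using m0 n16 by (simp add: field_simps power3_eq_cube)
    also have "\<dots> \<le> real L * ((q / (2 * real D) - (E0 + 1)) * (q / 2 - 2 ^ L * (E1 + 1)))"
    proof (intro mult_mono Lge)
      have "n / 5 / (4 * (4 * real m / n)) \<le> q / (4 * real D)"
        using q Dle D1 by (intro frac_le) auto
      then show "n / 5 / (4 * (4 * real m / n)) \<le> q / (2 * real D) - (E0 + 1)" using A by linarith
      show "n / 5 / 4 \<le> q / 2 - 2 ^ L * (E1 + 1)" using B q by linarith
    qed (use pos in auto)
    also have "\<dots> \<le> real (n choose 2) - real (min_universal_edges n m)"
      using dense_host[OF D_def D1 q_def q(1) LD E0pos E1pos small pos] by linarith
    finally show "\<delta> / 9600 * (real n ^ 3 * ln n / m)
      \<le> real (n choose 2) - real (min_universal_edges n m)" .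
  qed
qed

subsection \<open>The sparse range\<close>

lemma card_typed_edges_le_pairs:
  assumes "finite Z" and Z: "\<And>i j. i < n \<Longrightarrow> j < n \<Longrightarrow> R (\<theta> i) (\<theta> j) \<Longrightarrow> (i, j) \<in> Z \<or> (j, i) \<in> Z"
  shows "card (edges (typed_graph n R \<theta>)) \<le> card Z"
proof -
  have "edges (typed_graph n R \<theta>) \<subseteq> (\<lambda>(i, j). {i, j}) ` Z"
  proof
    fix e assume "e \<in> edges (typed_graph n R \<theta>)"
    then obtain i j where ij: "e = {i, j}" "i < n" "j < n" "R (\<theta> i) (\<theta> j)"
      by (auto simp: typed_graph_def)
    have "e = (\<lambda>(i, j). {i, j}) (i, j)" "e = (\<lambda>(i, j). {i, j}) (j, i)" using ij(1) by auto
    then show "e \<in> (\<lambda>(i, j). {i, j}) ` Z" using Z[OF ij(2-4)] by blast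
  qed
  then show ?thesis using assms(1) by (meson card_image_le card_mono finite_imageI order_trans)
qed

section \<open>Counting label patterns for the sparse range\<close>

text \<open>A binomial tail bound by exponential weights: each counted \<open>\<sigma>\<close> has
  \<open>z ^ card \<sigma> \<ge> z ^ d\<close>, and the weights of all subsets sum to
  \<open>(1 + z) ^ T\<close>.\<close>

lemma card_small_subsets_le:
  fixes T d :: nat and z :: real
  assumes "0 < z" "z \<le> 1"
  shows "real (card {\<sigma>. \<sigma> \<subseteq> {..<T} \<and> card \<sigma> \<le> d}) * z ^ d \<le> (1 + z) ^ T"
proof -
  let ?S = "{\<sigma>. \<sigma> \<subseteq> {..<T} \<and> card \<sigma> \<le> d}"
  have "real (card ?S) * z ^ d = (\<Sum>\<sigma>\<in>?S. z ^ d)" by simp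
  also have "\<dots> \<le> (\<Sum>\<sigma>\<in>?S. z ^ card \<sigma>)"
    using assms by (intro sum_mono power_decreasing) auto
  also have "\<dots> \<le> (\<Sum>\<sigma>\<in>Pow {..<T}. z ^ card \<sigma>)"
    using assms by (intro sum_mono2) auto
  also have "\<dots> = (\<Sum>\<sigma>\<in>Pow {..<T}. \<Prod>k\<in>\<sigma>. z)" by simp
  also have "\<dots> = (\<Prod>k<T. z + 1)"
    using prod_add[of "{..<T}" "\<lambda>_. z" "\<lambda>_. 1"] by simp
  also have "\<dots> = (1 + z) ^ T" by (simp add: add.commute)
  finally show ?thesis .
qed

lemma card_residue_le: "card {c \<in> {..<T * a}. c mod T = s} \<le> (a :: nat)"
proof -
  have "inj_on (\<lambda>c. c div T) {c \<in> {..<T * a}. c mod T = s}"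
    by (rule inj_onI) (metis (mono_tags, lifting) div_mult_mod_eq mem_Collect_eq)
  moreover have "(\<lambda>c. c div T) ` {c \<in> {..<T * a}. c mod T = s} \<subseteq> {..<a}"
    by (auto simp: less_mult_imp_div_less mult.commute)
  ultimately have "card {c \<in> {..<T * a}. c mod T = s} \<le> card {..<a}"
    by (rule card_inj_on_le) simp
  then show ?thesis by simp
qed

lemma card_own_label_le:
  assumes "1 \<le> r" "finite \<Lambda>"
  shows "card {g \<in> {..<r} \<rightarrow>\<^sub>E \<Lambda>. g 0 \<in> \<Lambda>'} \<le> card (\<Lambda> \<inter> \<Lambda>') * card \<Lambda> ^ (r - 1)"
proof -
  have "{g \<in> {..<r} \<rightarrow>\<^sub>E \<Lambda>. g 0 \<in> \<Lambda>'} \<subseteq> (\<Pi>\<^sub>E k\<in>{..<r}. if k = 0 then \<Lambda> \<inter> \<Lambda>' else \<Lambda>)"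
  proof
    fix g assume g: "g \<in> {g \<in> {..<r} \<rightarrow>\<^sub>E \<Lambda>. g 0 \<in> \<Lambda>'}"
    show "g \<in> (\<Pi>\<^sub>E k\<in>{..<r}. if k = 0 then \<Lambda> \<inter> \<Lambda>' else \<Lambda>)"
    proof (rule PiE_I)
      fix k assume "k \<in> {..<r}"
      then show "g k \<in> (if k = 0 then \<Lambda> \<inter> \<Lambda>' else \<Lambda>)"
        using g PiE_mem[of g "{..<r}" "\<lambda>_. \<Lambda>" k] by auto
    qed (use g PiE_arb in fastforce)
  qed
  moreover have "finite (\<Pi>\<^sub>E k\<in>{..<r}. if k = 0 then \<Lambda> \<inter> \<Lambda>' else \<Lambda>)"
    using assms by (intro finite_PiE) auto
  ultimately have "card {g \<in> {..<r} \<rightarrow>\<^sub>E \<Lambda>. g 0 \<in> \<Lambda>'}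
      \<le> card (\<Pi>\<^sub>E k\<in>{..<r}. if k = 0 then \<Lambda> \<inter> \<Lambda>' else \<Lambda>)"
    by (rule card_mono[rotated])
  also have "\<dots> = (\<Prod>k<r. card (if k = 0 then \<Lambda> \<inter> \<Lambda>' else \<Lambda>))"
    by (simp add: card_PiE)
  also have "\<dots> = (\<Prod>k<Suc (r - 1). card (if k = 0 then \<Lambda> \<inter> \<Lambda>' else \<Lambda>))"
    using assms(1) by simp
  also have "\<dots> = card (\<Lambda> \<inter> \<Lambda>') * card \<Lambda> ^ (r - 1)"
    by (subst prod.lessThan_Suc_shift) simp
  finally show ?thesis .
qed

text \<open>At most \<open>2 * m\<close> ranks are non-isolated, so a clique on
  \<open>min n (2 * m)\<close> hosts suffices. This covers bounded \<open>m\<close> in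
  \<open>sparse_upper\<close>.\<close>

lemma min_universal_edges_le_4_m2: "min_universal_edges n m \<le> 4 * m\<^sup>2"
proof -
  define n0 where "n0 = min n (2 * m)"
  obtain \<theta> :: "nat \<Rightarrow> (unit, unit) slot" where
    \<theta>: "card {i. i < n \<and> \<theta> i = Free} = n0"
      "\<And>i. \<theta> i = Free \<or> \<theta> i = Isolated"
    and g: "min_universal_edges n m \<le> card (edges (typed_graph n (compat (\<lambda>_ _ _ _. True)) \<theta>))"
  \<comment> \<open>There are no classes, and \<open>s = 2 * m\<close> with \<open>D = 0\<close>
    meets the rank condition \<open>2 * m < Suc s * Suc D\<close>.\<close>
  proof (rule random_host[of n0 n m "2 * m" 0 "{} :: unit set" "\<lambda>_. {}" "\<lambda>_. 1" "{0 :: nat}" "\<lambda>_. {}"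
        "\<lambda>_. 1" "\<lambda>_. False" "\<lambda>_ _ _ _. True" "\<lambda>_ _. ()"])
  qed (auto simp: n0_def)
  let ?A = "{i. i < n \<and> \<theta> i = Free}"
  have "card (edges (typed_graph n (compat (\<lambda>_ _ _ _. True)) \<theta>)) \<le> card (?A \<times> ?A)"
  proof (rule card_typed_edges_le_pairs)
    fix i j assume "i < n" "j < n" "compat (\<lambda>_ _ _ _. True) (\<theta> i) (\<theta> j)"
    then show "(i, j) \<in> ?A \<times> ?A \<or> (j, i) \<in> ?A \<times> ?A"
      using \<theta>(2)[of i] \<theta>(2)[of j] by auto
  qed simp
  also have "\<dots> = n0 * n0" using \<theta>(1) by (simp add: card_cartesian_product)
  also have "\<dots> \<le> (2 * m) * (2 * m)" unfolding n0_def by (rule mult_le_mono) auto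
  finally show ?thesis using g by (simp add: power2_eq_square)
qed

text \<open>10 is the first \<open>x\<close> with \<open>16 * (4 * x + 2) \<le> 2 ^ x\<close>; this
  explains why class 9 collects the hubs and shows no neighbours.\<close>

lemma pattern_exponent_le:
  assumes "10 \<le> x" "x \<le> e + 1"
  shows "(4 * x + 2) * 2 ^ (e + 1 - x) \<le> (2 :: nat) ^ (e - 3)"
proof -
  have "(4 * x + 2) * 16 \<le> (2 :: nat) ^ x"
    using assms(1) by (induction x rule: dec_induct) auto
  then have "((4 * x + 2) * 16) * 2 ^ (e + 1 - x) \<le> (2 :: nat) ^ x * 2 ^ (e + 1 - x)"
    by (rule mult_le_mono1)
  also have "\<dots> = 2 ^ (e + 1)" using assms(2) by (simp flip: power_add)
  also have "\<dots> = 2 ^ ((e - 3) + 4)" using assms by (intro arg_cong[where f = "(^) 2"]) simp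
  also have "\<dots> = 16 * 2 ^ (e - 3)" by (simp only: power_add) simp
  finally have "16 * ((4 * x + 2) * 2 ^ (e + 1 - x)) \<le> 16 * (2 :: nat) ^ (e - 3)"
    by (simp only: mult_ac)
  then show ?thesis by (simp only: nat_mult_le_cancel_disj)
qed

text \<open>With \<open>z = 1 / 16^x\<close> one has \<open>T * z = d\<close>, so the number is at
  most \<open>exp d * 16^(x * d)\<close>, hence at most \<open>2^((4 * x + 2) * d)\<close>. For
  \<open>L = 2^e\<close> the final bound is \<open>2^(L / 8)\<close>, which is at most
  \<open>m^(1/8)\<close> once \<open>2^L \<le> m\<close>.\<close>

lemma card_patterns_le:
  assumes "10 \<le> x" "x \<le> e + 1"
  shows "real (card {\<sigma>. \<sigma> \<subseteq> {..<2 ^ (e + 1 + 3 * x) :: nat} \<and> card \<sigma> \<le> 2 ^ (e + 1 - x)}) \<le> 2 ^ (2 ^ (e - 3))"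
proof -
  define d :: nat where "d = 2 ^ (e + 1 - x)"
  define T :: nat where "T = 2 ^ (e + 1 + 3 * x)"
  define z :: real where "z = (1 / 16) ^ x"
  let ?c = "real (card {\<sigma>. \<sigma> \<subseteq> {..<T} \<and> card \<sigma> \<le> d})"
  have z: "0 < z" "z \<le> 1" by (auto simp: z_def power_le_one)
  have "(16 :: nat) ^ x * d = T"
  proof -
    have "(16 :: nat) ^ x = 2 ^ (4 * x)" by (simp add: power_mult)
    then show ?thesis using assms by (simp add: d_def T_def flip: power_add)
  qed
  then have "real T = 16 ^ x * real d" by (metis of_nat_mult of_nat_numeral of_nat_power)
  then have Tz: "real T * z = d" by (simp add: z_def power_divide)
  have "?c * z ^ d \<le> (1 + z) ^ T" by (rule card_small_subsets_le[OF z])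
  also have "\<dots> \<le> exp z ^ T"
    using z exp_ge_add_one_self[of z] by (intro power_mono) auto
  also have "\<dots> = exp (real d)" using Tz by (simp flip: exp_of_nat_mult)
  also have "\<dots> = exp 1 ^ d" by (simp flip: exp_of_nat_mult)
  also have "\<dots> \<le> 4 ^ d" using exp_le by (intro power_mono) auto
  finally have "?c * z ^ d \<le> 4 ^ d" .
  then have "?c \<le> 4 ^ d * (16 ^ x) ^ d"
    by (simp add: z_def power_divide field_simps)
  also have "\<dots> = 2 ^ ((4 * x + 2) * d)"
  proof -
    have "(4 :: real) ^ d = 2 ^ (2 * d)" "((16 :: real) ^ x) ^ d = 2 ^ (4 * x * d)"
      by (simp_all add: power_mult)
    then show ?thesis by (simp add: algebra_simps flip: power_add)
  qed
  also have "\<dots> \<le> 2 ^ (2 ^ (e - 3))"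
    using pattern_exponent_le[OF assms] by (intro power_increasing) (auto simp: d_def)
  finally show ?thesis by (simp add: T_def d_def)
qed

text \<open>The classes are consecutive intervals starting at \<open>s\<close> and cut off at
  \<open>n0\<close>, so their sizes telescope.\<close>

lemma sum_class_sizes:
  fixes s k n0 :: nat
  assumes "s \<le> k" "9 \<le> j"
  shows "(\<Sum>x = 9..j. card {if x = 9 then s else k * 2 ^ x..<min n0 (k * 2 ^ (x + 1))})
    = min n0 (k * 2 ^ (j + 1)) - s"
  using assms(2)
proof (induction j rule: dec_induct)
  case (step j)
  have "k * 1 \<le> k * 2 ^ (j + 1)" by (intro mult_le_mono2) simp
  then have "s \<le> k * 2 ^ (j + 1)" using assms(1) by linarith
  then show ?case using step by (auto simp: min_def)
qed simp

text \<open>With \<open>L\<close> of order \<open>log m\<close> and \<open>k\<close> of order \<open>m / L\<close>, class \<open>x > 9\<close> consists of the ranks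
  between \<open>k 2\<^sup>x\<close> and \<open>k 2\<^sup>x\<^sup>+\<^sup>1\<close>, whose degrees are at most \<open>d x = 2L / 2\<^sup>x\<close>, and class 9 of the hubs.
  Two hosts are joined if the one in the higher class sees the label of the other one modulo
  \<open>T x\<close>. As \<open>d x / T x = 16\<^sup>-\<^sup>x\<close>, the numbers of edges at the classes sum to \<open>O(k\<^sup>2)\<close>, whereas
  there are only \<open>m\<^bsup>1/8+o(1)\<^esup>\<close> patterns, so that few vertices are left over.\<close>

lemma sparse_host:
  fixes e m n :: nat and E W :: real
  defines "L \<equiv> 2 ^ e"
  defines "k \<equiv> m div L + 1"
  assumes e: "9 \<le> e" and m: "L \<le> m" and E: "0 < E" "768 * real L ^ 7 * W * m < E\<^sup>2"
    and W: "2 ^ (2 ^ (e - 3)) \<le> W"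
  shows "real (min_universal_edges n m)
    \<le> (real k / L + 1 + e * (16 * real L ^ 4 * W * (E + 1))) * (8 * m) + 2 ^ 21 * real k ^ 2"
proof -
  \<comment> \<open>Small enough that \<open>s\<close> free hosts, each joined to at most
    \<open>8 * m\<close> others, cost only order \<open>k^2\<close> apart from rounding, since
    \<open>m < k * L\<close>; large enough that \<open>s * D\<close> exceeds
    \<open>2 * m\<close>.\<close>
  define s where "s = k div L + 1"
  define D where "D = 2 * (L * L)"
  \<comment> \<open>\<open>k * 2 ^ (e + 2)\<close> is \<open>4 * k * L\<close>, more than
    \<open>2 * m\<close>, so that ranks from \<open>n0\<close> on are isolated; it is also the right
    end of the last class \<open>e + 1\<close>.\<close>
  define n0 where "n0 = min n (k * 2 ^ (e + 2))"
  define X where "X = {9..e + 1}"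
  define V where "V = (\<lambda>x. {if x = 9 then s else k * 2 ^ x..<min n0 (k * 2 ^ (x + 1))})"
  define d where "d = (\<lambda>x. 2 ^ (e + 1 - x) :: nat)"
  \<comment> \<open>This is \<open>16 ^ x * d x\<close>: the sparsity \<open>1 / 16 ^ x\<close> of
    the shown residues has to beat the growth \<open>4 ^ x\<close> of the squared class
    sizes.\<close>
  define T where "T = (\<lambda>x. 2 ^ (e + 1 + 3 * x) :: nat)"
  define r where "r = (\<lambda>x :: nat. if x = 9 then 1 else d x + 1)"
  \<comment> \<open>The number of labels is \<open>T (e + 1)\<close>, the largest modulus; every
    \<open>T x\<close> of a class divides it, so residues of random labels are uniform.\<close>
  define \<Lambda> where "\<Lambda> = {..<(2 :: nat) ^ (4 * e + 4)}"
  define \<phi> :: "nat \<Rightarrow> (nat \<Rightarrow> nat) \<Rightarrow> nat \<times> nat set"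
    where "\<phi> = (\<lambda>x g. (g 0, if x = 9 then {} else (\<lambda>j. g j mod T x) ` {1..<r x}))"
  define S :: "nat \<Rightarrow> nat set set" where
    "S = (\<lambda>x. if x = 9 then {{}} else {\<sigma>. \<sigma> \<subseteq> {..<T x} \<and> card \<sigma> \<le> d x})"
  define P where "P = (\<lambda>x. \<Lambda> \<times> S x)"
  \<comment> \<open>Only the side of higher class, where degrees are small, has to see the other one
    (both sides if the classes agree). Hubs show nothing, so class 9 becomes a clique.\<close>
  define shown :: "nat \<Rightarrow> nat \<times> nat set \<Rightarrow> nat \<Rightarrow> nat \<times> nat set \<Rightarrow> bool"
    where "shown = (\<lambda>x a y b. x \<noteq> 9 \<and> y \<le> x \<longrightarrow> fst b mod T x \<in> snd a)"
  define R where "R = (\<lambda>x a y b. shown x a y b \<and> shown y b x a)"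

  have L: "L \<ge> 512"
    unfolding L_def using e power_increasing[of 9 e "2 :: nat"] by simp
  have kL: "m < k * L" "k * L \<le> 2 * m"
  proof -
    have "m < L + L * (m div L)" using L by (intro dividend_less_times_div) auto
    then show "m < k * L" by (simp add: k_def algebra_simps)
    have "m div L * L \<le> m" by simp
    then show "k * L \<le> 2 * m" unfolding k_def using m \<open>m div L * L \<le> m\<close> by (simp only: add_mult_distrib)
  qed
  have k2: "k \<ge> 2" using m L by (simp add: k_def Suc_le_eq div_greater_zero_iff)
  have s: "s \<le> k" "k < s * L" "1 \<le> s"
  proof -
    have "k div L \<le> k div 2" using L by (intro div_le_mono2) auto
    then show "s \<le> k" using k2 by (simp add: s_def)
    have "k < L + L * (k div L)" using L by (intro dividend_less_times_div) auto
    then show "k < s * L" by (simp add: s_def algebra_simps)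
  qed (simp add: s_def)
  have sD: "2 * m < Suc s * Suc D"
  proof -
    have "k * L \<le> (s * L) * L" using s(2) by (intro mult_le_mono1) simp
    with kL(1) have "m < (s * L) * L" by (rule less_le_trans)
    then have "m < s * (L * L)" by (simp only: mult.assoc)
    then have "2 * m < s * D" by (simp add: D_def)
    also have "\<dots> \<le> Suc s * Suc D" by (rule mult_le_mono) auto
    finally show ?thesis .
  qed
  have n0: "n0 \<le> n" "n0 = n \<or> 2 * m \<le> n0" "n0 \<le> 8 * m"
  proof -
    define K where "K = k * L"
    have "n0 = min n (4 * K)" by (simp add: n0_def K_def L_def)
    then show "n0 \<le> n" "n0 = n \<or> 2 * m \<le> n0" "n0 \<le> 8 * m"
      using kL unfolding K_def[symmetric] by auto
  qed
  have finX: "finite X" by (simp add: X_def)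
  have finS: "finite (S x)" for x by (simp add: S_def)
  have fin\<Lambda>: "finite \<Lambda>" "\<Lambda> \<noteq> {}" "card \<Lambda> = 16 * L ^ 4"
    by (simp_all add: \<Lambda>_def lessThan_empty_iff L_def power_add power_mult mult.commute
        flip: power_mult)
  have finP: "finite (P x)" for x using finS fin\<Lambda> by (simp add: P_def)
  have W1: "1 \<le> W" using W one_le_power[of "2 :: real" "2 ^ (e - 3)"] by linarith
  have cS: "card (S x) \<le> W" if "x \<in> X" for x
  proof (cases "x = 9")
    case False
    then have "real (card (S x)) \<le> 2 ^ (2 ^ (e - 3))"
      using card_patterns_le[of x e] that unfolding S_def T_def d_def X_def by simp
    then show ?thesis using W by linarith
  qed (use W1 in \<open>simp add: S_def\<close>)
  have cP: "real (card (P x)) \<le> 16 * real L ^ 4 * W" if "x \<in> X" for x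
    using cS[OF that] fin\<Lambda>(3) by (simp add: P_def card_cartesian_product mult_left_mono)
  have cVsum: "(\<Sum>x = 9..j. card (V x)) = min n0 (k * 2 ^ (j + 1)) - s" if "9 \<le> j" for j
    unfolding V_def using sum_class_sizes[OF s(1) that] .
  have cVX: "(\<Sum>x\<in>X. card (V x)) = n0 - s"
    unfolding X_def using cVsum[of "e + 1"] e by (simp add: n0_def)
  have cV: "card (V x) \<le> k * 2 ^ (x + 1)" for x
  proof -
    have "card (V x) \<le> min n0 (k * 2 ^ (x + 1))"
      by (simp only: V_def card_atLeastLessThan diff_le_self)
    then show ?thesis by (rule order_trans) (rule min.cobounded2)
  qed
  have k_le: "k \<le> k * 2 ^ x" for x by simp
  have Vs: "V x \<subseteq> {s..<n0}" for x using order_trans[OF s(1) k_le[of x]] by (auto simp: V_def)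
  have disj: "V x \<inter> V y = {}" if "x < y" "9 \<le> x" for x y
  proof -
    have "k * 2 ^ (x + 1) \<le> k * 2 ^ y" using that by (intro mult_le_mono2 power_increasing) auto
    then show ?thesis using that by (auto simp: V_def)
  qed
  have d: "d x \<le> L" "1 \<le> d x" if "x \<in> X" for x
    using that power_increasing[of "e + 1 - x" e "2 :: nat"] by (auto simp: d_def L_def X_def)
  \<comment> \<open>768 is \<open>16 * 6 * 8\<close>, from the bounds on \<open>card (P x)\<close>,
    on the overlap \<open>rD\<close> and on \<open>n0\<close>.\<close>
  have small: "(\<Sum>x\<in>X. real (card (P x)) * real (card (V x))
      * real (if r x = 1 then 1 else r x * (D + 1)) / E\<^sup>2) < 1"
  proof -
    have rD: "real (if r x = 1 then 1 else r x * (D + 1)) \<le> 6 * real L ^ 3" if "x \<in> X" for x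
    proof -
      have "r x \<le> 2 * L" using d[OF that] L by (auto simp: r_def)
      moreover have "1 \<le> L * L" using L by (simp add: Suc_le_eq)
      then have "D + 1 \<le> 3 * (L * L)" by (simp add: D_def)
      ultimately have "r x * (D + 1) \<le> (2 * L) * (3 * (L * L))" by (rule mult_le_mono)
      moreover have "1 \<le> (2 * L) * (3 * (L * L))" using L by (simp add: Suc_le_eq)
      ultimately have "(if r x = 1 then 1 else r x * (D + 1)) \<le> (2 * L) * (3 * (L * L))" by simp
      then have "real (if r x = 1 then 1 else r x * (D + 1)) \<le> real ((2 * L) * (3 * (L * L)))"
        by (simp only: of_nat_le_iff)
      then show ?thesis by (simp add: power3_eq_cube)
    qed
    have "(\<Sum>x\<in>X. real (card (P x)) * real (card (V x))
        * real (if r x = 1 then 1 else r x * (D + 1)) / E\<^sup>2)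
        \<le> (\<Sum>x\<in>X. (16 * real L ^ 4 * W) * real (card (V x)) * (6 * real L ^ 3) / E\<^sup>2)"
      using cP rD W1 by (intro sum_mono divide_right_mono mult_mono) auto
    also have "\<dots> = 96 * real L ^ 7 * W / E\<^sup>2 * real (\<Sum>x\<in>X. card (V x))"
      unfolding of_nat_sum sum_distrib_left
      by (rule sum.cong) (simp_all add: power_add[of _ 4 3, simplified])
    also have "\<dots> \<le> 96 * real L ^ 7 * W / E\<^sup>2 * (8 * m)"
      using n0(3) W1 unfolding cVX by (intro mult_left_mono) auto
    also have "\<dots> = 768 * real L ^ 7 * W * m / E\<^sup>2" by simp
    also have "\<dots> < 1" using E by simp
    finally show ?thesis .
  qed
  have shown_\<phi>: "shown x (\<phi> x g) y (\<phi> y h)" 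
    if hg: "x \<noteq> 9 \<Longrightarrow> h 0 \<in> g ` {1..<r x}" for x y g h
    unfolding shown_def
  proof (intro impI, elim conjE)
    assume "x \<noteq> 9"
    then obtain j where j: "h 0 = g j" "j \<in> {1..<r x}" using hg by blast
    have "h 0 mod T x \<in> (\<lambda>j. g j mod T x) ` {1..<r x}" unfolding j(1) using j(2) by (rule imageI)
    then show "fst (\<phi> y h) mod T x \<in> snd (\<phi> x g)" using \<open>x \<noteq> 9\<close> by (simp add: \<phi>_def)
  qed
  obtain \<theta> where
    \<theta>: "\<And>x Q. x \<in> X \<Longrightarrow> Q \<subseteq> P x \<Longrightarrow> card {i. i < n \<and> \<theta> i \<in> Typed x ` Q}
        = (\<Sum>p\<in>Q. nat \<lfloor>real (card (V x)) * type_prob (r x) \<Lambda> (\<phi> x) p - E\<rfloor>)"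
    and \<theta>_free: "card {i. i < n \<and> \<theta> i = Free}
        = n0 - (\<Sum>x\<in>X. \<Sum>p\<in>P x. nat \<lfloor>real (card (V x)) * type_prob (r x) \<Lambda> (\<phi> x) p - E\<rfloor>)"
    and \<theta>_iso: "card {i. i < n \<and> \<theta> i = Isolated} = n - n0"
    and \<theta>_range: "\<And>i. \<theta> i = Free \<or> \<theta> i = Isolated \<or> (\<exists>x\<in>X. \<exists>p\<in>P x. \<theta> i = Typed x p)"
    and g: "min_universal_edges n m \<le> card (edges (typed_graph n (compat R) \<theta>))"
  proof (rule random_host[of n0 n m s D X V r \<Lambda> P "\<lambda>_. E" "\<lambda>x. x \<noteq> 9" R \<phi>])
    show "V x \<inter> V y = {}" if "x \<in> X" "y \<in> X" "x \<noteq> y" for x y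
      using disj[of x y] disj[of y x] that by (auto simp: X_def not_less_iff_gr_or_eq neq_iff)
    \<comment> \<open>In class \<open>x\<close> the least rank times \<open>d x\<close> is
      \<open>2 * k * L\<close>, which exceeds \<open>2 * m\<close>.\<close>
    show "2 * m < Suc i * r x" if "x \<in> X" "x \<noteq> 9" "i \<in> V x" for x i
    proof -
      have "2 * m < 2 * (k * L)" using kL by simp
      also have "\<dots> = (k * 2 ^ x) * d x"
        using that by (simp add: d_def L_def X_def mult.assoc flip: power_add power_Suc)
      also have "\<dots> \<le> Suc i * r x"
        using that by (intro mult_le_mono) (auto simp: V_def r_def)
      finally show ?thesis .
    qed
    show "R x (\<phi> x g) y (\<phi> y h)"
      if "x \<noteq> 9 \<Longrightarrow> h 0 \<in> g ` {1..<r x}" "y \<noteq> 9 \<Longrightarrow> g 0 \<in> h ` {1..<r y}" for x y g h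
      unfolding R_def using shown_\<phi> that by blast
  qed (use n0 sD finX Vs fin\<Lambda> finP E small in \<open>auto simp: r_def R_def\<close>)

  define cls where "cls = (\<lambda>x. {i. i < n \<and> \<theta> i \<in> Typed x ` P x})"
  define cell where "cell = (\<lambda>x y t. {i. i < n \<and> \<theta> i \<in> Typed y ` {p \<in> P y. fst p mod T x = t}})"
  define sg where "sg = (\<lambda>i. case \<theta> i of Typed x p \<Rightarrow> snd p | _ \<Rightarrow> {})"
  define Nb where "Nb = (\<lambda>x \<sigma>. \<Union>y\<in>{9..x}. \<Union>t\<in>\<sigma>. cell x y t)"
  have ccls: "card (cls x) \<le> card (V x)" if "x \<in> X" for x
    unfolding cls_def \<theta>[OF that order_refl]
    by (rule floor_counts_le) (use finP fin\<Lambda> E in auto)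
  \<comment> \<open>A residue modulo \<open>T x\<close> carries the fraction \<open>1 / T x\<close>
    of the labels, and the host counts were rounded down from expectations.\<close>
  have ccell: "real (card (cell x y t)) \<le> card (V y) / T x" if "x \<in> X" "y \<in> X" for x y t
  proof -
    define a :: nat where "a = 2 ^ (4 * e + 4 - (e + 1 + 3 * x))"
    have "e + 1 + 3 * x \<le> 4 * e + 4" using that by (simp add: X_def)
    then have Ta: "T x * a = 2 ^ (4 * e + 4)"
      by (simp only: T_def a_def power_add[symmetric] le_add_diff_inverse)
    have r1: "1 \<le> r y" by (simp add: r_def)
    let ?Q = "{p \<in> P y. fst p mod T x = t}"
    let ?M = "card {g \<in> {..<r y} \<rightarrow>\<^sub>E \<Lambda>. \<phi> y g \<in> ?Q}"
    have "?M \<le> card {g \<in> {..<r y} \<rightarrow>\<^sub>E \<Lambda>. g 0 \<in> {c. c mod T x = t}}"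
      by (rule card_mono) (use finite_PiE[of "{..<r y}" "\<lambda>_. \<Lambda>"] fin\<Lambda> in \<open>auto simp: \<phi>_def\<close>)
    also have "\<dots> \<le> card (\<Lambda> \<inter> {c. c mod T x = t}) * card \<Lambda> ^ (r y - 1)"
      by (rule card_own_label_le[OF r1 fin\<Lambda>(1)])
    also have "\<Lambda> \<inter> {c. c mod T x = t} = {c \<in> {..<T x * a}. c mod T x = t}"
      unfolding Ta by (auto simp: \<Lambda>_def)
    also have "card \<dots> * card \<Lambda> ^ (r y - 1) \<le> a * card \<Lambda> ^ (r y - 1)"
      by (intro mult_le_mono1 card_residue_le)
    finally have "T x * ?M \<le> T x * (a * card \<Lambda> ^ (r y - 1))" by (rule mult_le_mono2)
    also have "\<dots> = card \<Lambda> * card \<Lambda> ^ (r y - 1)"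
      using Ta by (simp add: \<Lambda>_def mult.assoc[symmetric])
    also have "\<dots> = card \<Lambda> ^ r y" using r1 by (simp flip: power_Suc)
    finally have "real (T x * ?M) \<le> real (card \<Lambda> ^ r y)" by (simp only: of_nat_le_iff)
    moreover have "real (card \<Lambda>) ^ r y > 0" using fin\<Lambda>(1,2) by (simp add: card_gt_0_iff)
    moreover have "real (T x) > 0" by (simp add: T_def)
    ultimately have "?M / real (card \<Lambda>) ^ r y \<le> 1 / T x"
      by (simp add: divide_simps mult.commute)
    then have "real (card (V y)) * (?M / real (card \<Lambda>) ^ r y) \<le> real (card (V y)) * (1 / T x)"
      by (rule mult_left_mono) simp
    moreover have "card (cell x y t) = (\<Sum>p\<in>?Q. nat \<lfloor>real (card (V y)) * type_prob (r y) \<Lambda> (\<phi> y) p - E\<rfloor>)"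
      unfolding cell_def by (rule \<theta>[OF that(2)]) auto
    moreover have "real (\<Sum>p\<in>?Q. nat \<lfloor>real (card (V y)) * type_prob (r y) \<Lambda> (\<phi> y) p - E\<rfloor>)
        \<le> real (card (V y)) * (?M / real (card \<Lambda>) ^ r y)"
      by (rule floor_counts(1)) (use finP fin\<Lambda> E in auto)
    ultimately show ?thesis by simp
  qed
  have cNb: "real (card (Nb x \<sigma>)) \<le> d x * (k * 2 ^ (x + 1) / T x)"
    if x: "x \<in> X" and \<sigma>: "finite \<sigma>" "card \<sigma> \<le> d x" for x \<sigma>
  proof -
    have "card (Nb x \<sigma>) \<le> (\<Sum>y = 9..x. card (\<Union>t\<in>\<sigma>. cell x y t))"
      unfolding Nb_def by (rule card_UN_le) simp
    also have "\<dots> \<le> (\<Sum>y = 9..x. \<Sum>t\<in>\<sigma>. card (cell x y t))"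
      by (intro sum_mono card_UN_le \<sigma>)
    finally have "real (card (Nb x \<sigma>)) \<le> (\<Sum>y = 9..x. \<Sum>t\<in>\<sigma>. real (card (cell x y t)))"
      by (simp flip: of_nat_sum)
    also have "\<dots> \<le> (\<Sum>y = 9..x. \<Sum>t\<in>\<sigma>. card (V y) / T x)"
      using x by (intro sum_mono ccell) (auto simp: X_def)
    also have "\<dots> = card \<sigma> * (real (\<Sum>y = 9..x. card (V y)) / T x)"
      by (simp add: sum_distrib_left sum_divide_distrib)
    also have "\<dots> \<le> d x * (k * 2 ^ (x + 1) / T x)"
    proof (intro mult_mono divide_right_mono)
      have "(\<Sum>y = 9..x. card (V y)) \<le> k * 2 ^ (x + 1)"
        using cVsum[of x] x by (simp add: X_def)
      then show "real (\<Sum>y = 9..x. card (V y)) \<le> real (k * 2 ^ (x + 1))" by (simp only: of_nat_le_iff)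
    qed (use \<sigma> in \<open>auto intro!: divide_nonneg_nonneg sum_nonneg\<close>)
    finally show ?thesis .
  qed
  \<comment> \<open>Every edge of the host has a free end, or both ends among the hubs of class 9,
    or an end of some class \<open>x > 9\<close> that shows the residue of its other end, of class
    at most \<open>x\<close>. These three kinds are bounded separately.\<close>
  define Z1 where "Z1 = {i. i < n \<and> \<theta> i = Free} \<times> {i. i < n \<and> \<theta> i \<noteq> Isolated}"
  define Z3 where "Z3 = (\<Union>x\<in>{10..e + 1}. SIGMA i:cls x. Nb x (sg i))"
  have finNb: "finite (Nb x (sg i))" for x i
    by (rule finite_subset[of _ "{..<n}"]) (auto simp: Nb_def cell_def)
  have fincls: "finite (cls x)" for x by (simp add: cls_def)
  have "card (edges (typed_graph n (compat R) \<theta>)) \<le> card (Z1 \<union> cls 9 \<times> cls 9 \<union> Z3)"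
  proof (rule card_typed_edges_le_pairs)
    show "finite (Z1 \<union> cls 9 \<times> cls 9 \<union> Z3)"
      using finNb fincls by (auto simp: Z1_def Z3_def)
    have key: "(i, j) \<in> cls 9 \<times> cls 9 \<union> Z3"
      if "i < n" "j < n" "\<theta> i = Typed x p" "\<theta> j = Typed y q" "x \<in> X" "y \<in> X" "p \<in> P x" "q \<in> P y"
        "y \<le> x" "shown x p y q" for i j x y p q
    proof (cases "x = 9")
      case True
      then have "y = 9" using that by (auto simp: X_def)
      then show ?thesis using True that by (auto simp: cls_def)
    next
      case False
      then have "x \<in> {10..e + 1}" "y \<in> {9..x}" using that by (auto simp: X_def)
      moreover have "i \<in> cls x" using that by (auto simp: cls_def)
      moreover have "fst q mod T x \<in> sg i" using that False by (simp add: shown_def sg_def)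
      moreover have "j \<in> cell x y (fst q mod T x)" using that by (auto simp: cell_def)
      ultimately show ?thesis unfolding Z3_def Nb_def by blast
    qed
    fix i j assume ij: "i < n" "j < n" "compat R (\<theta> i) (\<theta> j)"
    show "(i, j) \<in> Z1 \<union> cls 9 \<times> cls 9 \<union> Z3 \<or> (j, i) \<in> Z1 \<union> cls 9 \<times> cls 9 \<union> Z3"
    proof (cases "\<theta> i = Free \<or> \<theta> j = Free")
      case True
      then show ?thesis using ij by (cases "\<theta> i"; cases "\<theta> j") (auto simp: Z1_def)
    next
      case False
      have "\<theta> i \<noteq> Isolated" "\<theta> j \<noteq> Isolated" using ij(3) by (cases "\<theta> i"; cases "\<theta> j"; simp)+
      then obtain x p y q where xy: "\<theta> i = Typed x p" "\<theta> j = Typed y q" "x \<in> X" "y \<in> X"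
        "p \<in> P x" "q \<in> P y"
        using False \<theta>_range[of i] \<theta>_range[of j] by blast
      then have "shown x p y q" "shown y q x p" using ij(3) by (simp_all add: R_def)
      then show ?thesis
        using key[OF ij(1,2) xy(1-6)] key[OF ij(2,1) xy(2,1,4,3,6,5)] by (cases "y \<le> x") auto
    qed
  qed
  also have "\<dots> \<le> card Z1 + card (cls 9 \<times> cls 9) + card Z3"
    by (meson add_le_mono1 card_Un_le order_trans)
  finally have edges: "real (min_universal_edges n m)
      \<le> real (card Z1) + real (card (cls 9 \<times> cls 9)) + real (card Z3)"
    using g by linarith

  \<comment> \<open>The free hosts make up for the \<open>s\<close> top ranks and for a loss of at
    most \<open>card (P x) * (E + 1)\<close> in each of at most \<open>e\<close> classes.\<close>
  have Z1: "real (card Z1) \<le> (real k / L + 1 + e * (16 * real L ^ 4 * W * (E + 1))) * (8 * m)"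
  proof -
    define u where "u = card {i. i < n \<and> \<theta> i = Free}"
    have "{i. i < n \<and> \<theta> i \<noteq> Isolated} = {..<n} - {i. i < n \<and> \<theta> i = Isolated}" by auto
    then have "card {i. i < n \<and> \<theta> i \<noteq> Isolated} = n0"
      using \<theta>_iso n0(1) by (simp add: card_Diff_subset subset_iff)
    then have "card Z1 = u * n0" by (simp add: Z1_def card_cartesian_product u_def)
    have in_P: "\<phi> x g \<in> P x" if "x \<in> X" "g \<in> {..<r x} \<rightarrow>\<^sub>E \<Lambda>" for x g
    proof -
      have "g 0 \<in> \<Lambda>" using PiE_mem[OF that(2), of 0] by (simp add: r_def)
      moreover have "card ((\<lambda>j. g j mod T x) ` {1..<r x}) \<le> d x" if "x \<noteq> 9"
        using card_image_le[of "{1..<r x}" "\<lambda>j. g j mod T x"] that by (simp add: r_def)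
      ultimately show ?thesis by (auto simp: \<phi>_def P_def S_def T_def)
    qed
    have lower: "real (card (V x)) - 16 * real L ^ 4 * W * (E + 1)
        \<le> real (\<Sum>p\<in>P x. nat \<lfloor>real (card (V x)) * type_prob (r x) \<Lambda> (\<phi> x) p - E\<rfloor>)" if "x \<in> X" for x
    proof -
      have "{g \<in> {..<r x} \<rightarrow>\<^sub>E \<Lambda>. \<phi> x g \<in> P x} = {..<r x} \<rightarrow>\<^sub>E \<Lambda>" using in_P[OF that] by blast
      then have ratio: "card {g \<in> {..<r x} \<rightarrow>\<^sub>E \<Lambda>. \<phi> x g \<in> P x} / real (card \<Lambda>) ^ r x = 1"
        using fin\<Lambda>(1,2) by (simp add: card_PiE card_gt_0_iff)
      have "card (P x) * (E + 1) \<le> 16 * real L ^ 4 * W * (E + 1)"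
        using cP[OF that] E by (intro mult_right_mono) auto
      then show ?thesis
        using floor_counts(2)[of "P x" \<Lambda> E "card (V x)" "r x" "\<phi> x",
            OF finP fin\<Lambda>(1) less_imp_le[OF E(1)], unfolded ratio] by linarith
    qed
    have "real u \<le> real s + e * (16 * real L ^ 4 * W * (E + 1))"
    proof -
      let ?b = "\<Sum>x\<in>X. \<Sum>p\<in>P x. nat \<lfloor>real (card (V x)) * type_prob (r x) \<Lambda> (\<phi> x) p - E\<rfloor>"
      let ?w = "16 * real L ^ 4 * W * (E + 1)"
      have w0: "0 \<le> ?w" using W1 E by simp
      have "real (n0 - s) - card X * ?w = (\<Sum>x\<in>X. real (card (V x)) - ?w)"
        unfolding cVX[symmetric] by (simp add: sum_subtractf)
      also have "\<dots> \<le> (\<Sum>x\<in>X. real (\<Sum>p\<in>P x. nat \<lfloor>real (card (V x)) * type_prob (r x) \<Lambda> (\<phi> x) p - E\<rfloor>))"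
        by (rule sum_mono) (rule lower)
      also have "\<dots> = real ?b" by simp
      finally have b: "real (n0 - s) - card X * ?w \<le> real ?b" .
      have "card X * ?w \<le> e * ?w"
        using e w0 by (intro mult_right_mono) (auto simp: X_def)
      moreover have "real u = real (n0 - ?b)" using \<theta>_free by (simp add: u_def)
      then have "real u \<le> max 0 (real n0 - real ?b)" by (simp only: of_nat_diff_real)
      moreover have "real n0 \<le> real (n0 - s) + s" by simp
      moreover have "0 \<le> e * ?w" using w0 by simp
      ultimately show ?thesis using b by (simp only: max_def split: if_splits)
    qed
    moreover have "real s \<le> real k / L + 1"
      using of_nat_div_le_of_nat[of k L, where ?'a = real] by (simp add: s_def)
    ultimately have u: "real u \<le> real k / L + 1 + e * (16 * real L ^ 4 * W * (E + 1))" by linarith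
    have "real (card Z1) = real u * real n0" using \<open>card Z1 = u * n0\<close> by simp
    also have "\<dots> \<le> (real k / L + 1 + e * (16 * real L ^ 4 * W * (E + 1))) * (8 * m)"
    proof (intro mult_mono u)
      show "real n0 \<le> real (8 * m)" using n0(3) by (simp only: of_nat_le_iff)
      show "0 \<le> real k / L + 1 + e * (16 * real L ^ 4 * W * (E + 1))" using u by linarith
    qed simp
    finally show ?thesis by simp
  qed

  have "9 \<in> X" using e by (simp add: X_def)
  then have "card (cls 9) \<le> k * 2 ^ (9 + 1)" using ccls cV by (meson order_trans)
  also have "\<dots> = k * 2 ^ 10" by simp
  finally have "card (cls 9) \<le> k * 2 ^ 10" .
  then have "card (cls 9 \<times> cls 9) \<le> (k * 2 ^ 10) * (k * 2 ^ 10)"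
    unfolding card_cartesian_product by (intro mult_le_mono)
  then have "real (card (cls 9 \<times> cls 9)) \<le> real ((k * 2 ^ 10) * (k * 2 ^ 10))"
    by (simp only: of_nat_le_iff)
  then have Z2: "real (card (cls 9 \<times> cls 9)) \<le> 2 ^ 20 * real k ^ 2"
    by (simp add: power2_eq_square)

  \<comment> \<open>Class \<open>x\<close> has at most \<open>k * 2^(x + 1)\<close> hosts, each with
    at most \<open>d x / T x * k * 2^(x + 1)\<close> edges to its own and lower classes; the product
    is \<open>4 * k^2 / 4^x\<close>, a geometric series.\<close>
  have Z3: "real (card Z3) \<le> 8 * real k ^ 2"
  proof -
    have "card Z3 \<le> (\<Sum>x = 10..e + 1. card (SIGMA i:cls x. Nb x (sg i)))"
      unfolding Z3_def by (rule card_UN_le) simp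
    also have "\<dots> = (\<Sum>x = 10..e + 1. \<Sum>i\<in>cls x. card (Nb x (sg i)))"
      using fincls finNb by simp
    finally have "real (card Z3) \<le> (\<Sum>x = 10..e + 1. \<Sum>i\<in>cls x. real (card (Nb x (sg i))))"
      by (simp flip: of_nat_sum)
    also have "\<dots> \<le> (\<Sum>x = 10..e + 1. 4 * real k ^ 2 * (1 / 4) ^ x)"
    proof (rule sum_mono)
      fix x assume "x \<in> {10..e + 1}"
      then have x: "x \<in> X" "x \<noteq> 9" "x \<le> e + 1" by (auto simp: X_def)
      have "(\<Sum>i\<in>cls x. real (card (Nb x (sg i)))) \<le> (\<Sum>i\<in>cls x. d x * (k * 2 ^ (x + 1) / T x))"
      proof (rule sum_mono)
        fix i assume "i \<in> cls x"
        then have "sg i \<in> S x" by (auto simp: cls_def sg_def P_def)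
        then have "finite (sg i)" "card (sg i) \<le> d x"
          using x by (auto simp: S_def intro: finite_subset)
        then show "real (card (Nb x (sg i))) \<le> d x * (k * 2 ^ (x + 1) / T x)"
          by (rule cNb[OF x(1)])
      qed
      also have "\<dots> = real (card (cls x)) * (d x * (k * 2 ^ (x + 1) / T x))" by simp
      also have "\<dots> \<le> real (k * 2 ^ (x + 1)) * (d x * (k * 2 ^ (x + 1) / T x))"
        using ccls[OF x(1)] cV[of x] by (intro mult_right_mono) (auto simp only: of_nat_le_iff, auto)
      also have "\<dots> = 4 * real k ^ 2 * (4 ^ x * (d x / T x))"
        by (simp add: power2_eq_square flip: power_mult_distrib)
      also have "real (d x) / T x = (1 / 16) ^ x"
      proof -
        have "d x * 16 ^ x = T x"
        proof -
          have "(16 :: nat) ^ x = 2 ^ (4 * x)" by (simp add: power_mult)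
          then show ?thesis using x(3) by (simp add: d_def T_def flip: power_add)
        qed
        then have "real (T x) = real (d x) * 16 ^ x" by (metis of_nat_mult of_nat_numeral of_nat_power)
        then show ?thesis using d[OF x(1)] by (simp add: power_divide)
      qed
      also have "4 ^ x * (1 / 16) ^ x = (1 / 4 :: real) ^ x" by (simp flip: power_mult_distrib)
      finally show "(\<Sum>i\<in>cls x. real (card (Nb x (sg i)))) \<le> 4 * real k ^ 2 * (1 / 4) ^ x" .
    qed
    also have "\<dots> = 4 * real k ^ 2 * (\<Sum>x = 10..e + 1. (1 / 4) ^ x)"
      by (rule sum_distrib_left[symmetric])
    also have "\<dots> \<le> 4 * real k ^ 2 * 2"
    proof (rule mult_left_mono)
      have "(\<Sum>x = 10..e + 1. (1 / 4 :: real) ^ x) \<le> (\<Sum>x<e + 2. (1 / 4) ^ x)"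
        by (rule sum_mono2) auto
      also have "\<dots> = (1 - (1 / 4) ^ (e + 2)) / (1 - 1 / 4)"
        by (subst sum_gp_strict) simp
      also have "\<dots> \<le> 2" by simp (smt (verit) zero_le_power divide_nonneg_nonneg)
      finally show "(\<Sum>x = 10..e + 1. (1 / 4 :: real) ^ x) \<le> 2" .
    qed simp
    finally show ?thesis by simp
  qed
  have "2 ^ 20 * real k ^ 2 + 8 * real k ^ 2 \<le> 2 ^ 21 * real k ^ 2" by simp
  then show ?thesis using edges Z1 Z2 Z3 by linarith
qed

section \<open>Choice of parameters for the sparse upper bound\<close>

text \<open>\<open>L\<close> is the power of two with \<open>2^L \<le> m < 2^(2 * L)\<close>, so
  \<open>k\<close> has order \<open>m / ln m\<close>. With \<open>W = m^(1/8)\<close> and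
  \<open>E = m^(3/4)\<close> both requirements of \<open>sparse_host\<close> leave room for powers
  of \<open>ln m\<close>: \<open>W * m = m^(9/8)\<close> against \<open>E^2 = m^(3/2)\<close>, and a
  number of lost vertices of order \<open>W * E = m^(7/8)\<close> against
  \<open>m / L^2\<close>.\<close>

lemma sparse_upper_large:
  "\<exists>m0. \<forall>m n. m0 \<le> m \<longrightarrow>
     real (min_universal_edges n m) \<le> 2 ^ 26 * (real m ^ 2 / ln m ^ 2)"
proof -
  have "eventually (\<lambda>m :: nat. 768 * (2 * ln m) ^ 7 * m powr (1 / 8) * m < m powr (3 / 2)) at_top"
    by real_asymp
  moreover have "eventually (\<lambda>m :: nat. 16 * (2 * ln m) ^ 7 * (m powr (1 / 8) * (m powr (3 / 4) + 1)) \<le> m) at_top"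
    by real_asymp
  moreover have "eventually (\<lambda>m :: nat. (2 * ln m) ^ 2 \<le> m) at_top"
    by real_asymp
  moreover have "eventually (\<lambda>m :: nat. 2 * ln m \<le> m) at_top"
    by real_asymp
  moreover have "eventually (\<lambda>m :: nat. 1024 \<le> ln m) at_top"
    by real_asymp
  moreover have "eventually (\<lambda>m :: nat. 2 \<le> m) at_top" by (rule eventually_ge_at_top)
  ultimately have "eventually (\<lambda>m :: nat. 768 * (2 * ln m) ^ 7 * m powr (1 / 8) * m < m powr (3 / 2) \<and>
      16 * (2 * ln m) ^ 7 * (m powr (1 / 8) * (m powr (3 / 4) + 1)) \<le> m \<and>
      (2 * ln m) ^ 2 \<le> m \<and> 2 * ln m \<le> m \<and> 1024 \<le> ln m \<and> 2 \<le> m) at_top"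
    by eventually_elim simp
  then obtain m0 where m0: "\<And>m :: nat. m \<ge> m0 \<Longrightarrow>
      768 * (2 * ln m) ^ 7 * m powr (1 / 8) * m < m powr (3 / 2) \<and>
      16 * (2 * ln m) ^ 7 * (m powr (1 / 8) * (m powr (3 / 4) + 1)) \<le> m \<and>
      (2 * ln m) ^ 2 \<le> m \<and> 2 * ln m \<le> m \<and> 1024 \<le> ln m \<and> 2 \<le> m"
    by (auto simp: eventually_at_top_linorder)
  show ?thesis
  proof (intro exI[of _ m0] allI impI)
    fix m n :: nat assume "m0 \<le> m"
    note asym = m0[OF this]
    have m2: "2 \<le> m" and lnm: "1024 \<le> ln (real m)" using asym by auto
    obtain l where l: "2 ^ l \<le> m" "m < 2 ^ (l + 1)"
      using ex_power_ivl1[of 2 m] m2 by auto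
    have "l \<ge> 1" using l(2) m2 by (cases l) auto
    then obtain e where e: "2 ^ e \<le> l" "l < 2 ^ (e + 1)"
      using ex_power_ivl1[of 2 l] by auto
    define L :: nat where "L = 2 ^ e"
    define k where "k = m div L + 1"
    define W where "W = real m powr (1 / 8)"
    define E where "E = real m powr (3 / 4)"
    have "(2 :: nat) ^ L \<le> 2 ^ l" using e(1) by (simp add: L_def)
    with l(1) have mL: "2 ^ L \<le> m" by linarith
    have "(2 :: nat) ^ (l + 1) \<le> 2 ^ (2 * L)" using e(2) by (intro power_increasing) (auto simp: L_def)
    with l(2) have mL': "m < 2 ^ (2 * L)" by linarith
    have ln2: "1 / 2 \<le> ln (2 :: real)" "ln (2 :: real) \<le> 1"
    proof -
      have "exp (1 / 2 :: real) \<le> 2" using exp_bound_half[of "1 / 2 :: real"] by simp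
      then have "1 / 2 \<le> ln (2 :: real)" by (metis ln_exp ln_mono exp_gt_zero zero_less_numeral)
      then show "1 / 2 \<le> ln (2 :: real)" .
      show "ln (2 :: real) \<le> 1" using ln_le_minus_one[of "2 :: real"] by simp
    qed
    have L_le: "real L \<le> 2 * ln m"
    proof -
      have "real (2 ^ L) \<le> real m" using mL by (simp only: of_nat_le_iff)
      then have "ln (real (2 ^ L)) \<le> ln (real m)" using m2 by (subst ln_le_cancel_iff) auto
      then have "L * ln 2 \<le> ln (real m)" by (simp add: ln_realpow)
      moreover have "real L * (1 / 2) \<le> L * ln 2" using ln2 by (intro mult_left_mono) auto
      ultimately show ?thesis by simp
    qed
    have L_ge: "ln m \<le> 2 * real L"
    proof -
      have "real m \<le> real (2 ^ (2 * L))" using mL' by (simp only: of_nat_le_iff)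
      then have "ln (real m) \<le> ln (real (2 ^ (2 * L)))" using m2 by (subst ln_le_cancel_iff) auto
      also have "\<dots> = (2 * L) * ln 2" by (simp add: ln_realpow)
      also have "\<dots> \<le> real (2 * L) * 1" using ln2 by (intro mult_left_mono) auto
      finally show ?thesis by simp
    qed
    have L512: "512 \<le> L" using L_ge lnm by linarith
    then have "(2 :: nat) ^ 9 \<le> 2 ^ e" by (simp add: L_def)
    then have e9: "9 \<le> e" by (rule power_le_imp_le_exp[rotated]) simp
    have eL: "real e \<le> real L" by (simp add: L_def less_imp_le)
    have Lm: "L \<le> m" using L_le asym by linarith
    have Lpos: "real L > 0" using L512 by simp
    have L2m: "real L ^ 2 \<le> m"
    proof -
      have "real L ^ 2 \<le> (2 * ln m) ^ 2" using L_le by (intro power_mono) auto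
      then show ?thesis using asym by linarith
    qed
    have W0: "W \<ge> 0" "E > 0" using m2 by (auto simp: W_def E_def)
    have L7: "real L ^ 7 \<le> (2 * ln m) ^ 7" using L_le by (intro power_mono) auto
    have cond: "768 * real L ^ 7 * W * m < E\<^sup>2"
    proof -
      have "768 * real L ^ 7 * W * m \<le> 768 * (2 * ln m) ^ 7 * W * m"
        using L7 W0 by (intro mult_right_mono mult_left_mono) auto
      also have "\<dots> < m powr (3 / 2)" using asym by (simp add: W_def)
      also have "\<dots> = E\<^sup>2" by (simp add: E_def powr_powr powr_numeral[symmetric] del: powr_numeral)
      finally show ?thesis .
    qed
    have W: "2 ^ (2 ^ (e - 3)) \<le> W"
    proof -
      define y :: real where "y = 2 ^ (2 ^ (e - 3))"
      have "(2 :: nat) ^ (e - 3) * 8 = 2 ^ ((e - 3) + 3)" by (simp only: power_add) simp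
      also have "\<dots> = L" using e9 by (simp add: L_def)
      finally have "y ^ 8 = 2 ^ L" by (simp add: y_def flip: power_mult)
      moreover have "real (2 ^ L) \<le> real m" using mL by (simp only: of_nat_le_iff)
      ultimately have "y ^ 8 \<le> real m" by simp
      then have "(y ^ 8) powr (1 / 8) \<le> W" unfolding W_def by (intro powr_mono2) (auto simp: y_def)
      moreover have "(y ^ 8) powr (1 / 8) = y"
      proof -
        have "y > 0" by (simp add: y_def)
        then have "y ^ 8 = y powr 8" by simp
        then show ?thesis using \<open>y > 0\<close> by (simp only: powr_powr) simp
      qed
      ultimately show ?thesis by (simp add: y_def)
    qed
    have kle: "real k \<le> 2 * (real m / L)"
    proof -
      have "real k \<le> real m / L + 1"
        using of_nat_div_le_of_nat[of m L, where ?'a = real] by (simp add: k_def)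
      moreover have "1 \<le> real m / L" using Lm Lpos by simp
      ultimately show ?thesis by linarith
    qed
    define w where "w = real m / real L ^ 2"
    have free: "real k / L + 1 + e * (16 * real L ^ 4 * W * (E + 1)) \<le> 4 * w"
    proof -
      have "real k / L \<le> 2 * (real m / L) / L" using kle by (intro divide_right_mono) auto
      then have 1: "real k / L \<le> 2 * w" by (simp add: w_def power2_eq_square)
      have 2: "1 \<le> w" using L2m Lpos by (simp add: w_def)
      have "e * (16 * real L ^ 4 * W * (E + 1)) * real L ^ 2
          \<le> L * (16 * real L ^ 4 * W * (E + 1)) * real L ^ 2"
        using eL W0 by (intro mult_right_mono) auto
      also have "\<dots> = 16 * real L ^ 7 * (W * (E + 1))"
        by (simp add: power2_eq_square power4_eq_xxxx eval_nat_numeral)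
      also have "\<dots> \<le> 16 * (2 * ln m) ^ 7 * (W * (E + 1))"
        using L7 W0 by (intro mult_right_mono mult_left_mono) auto
      also have "\<dots> \<le> m" using asym by (simp add: W_def E_def)
      finally have "e * (16 * real L ^ 4 * W * (E + 1)) \<le> w"
        using Lpos by (simp add: w_def pos_le_divide_eq)
      then show ?thesis using 1 2 by linarith
    qed
    have "real (min_universal_edges n m)
        \<le> (real k / L + 1 + e * (16 * real L ^ 4 * W * (E + 1))) * (8 * m) + 2 ^ 21 * real k ^ 2"
      using sparse_host[of e m E W n] e9 Lm W0 cond W by (simp add: L_def k_def)
    also have "\<dots> \<le> (4 * w) * (8 * m) + 2 ^ 21 * (2 * (real m / L)) ^ 2"
      using free kle by (intro add_mono mult_right_mono mult_left_mono power_mono) auto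
    also have "\<dots> = (32 + 2 ^ 23) * (real m ^ 2 / real L ^ 2)"
      by (simp add: w_def power2_eq_square algebra_simps)
    also have "\<dots> \<le> 2 ^ 24 * (real m ^ 2 / real L ^ 2)"
      by (intro mult_right_mono) auto
    also have "\<dots> \<le> 2 ^ 24 * (real m ^ 2 / (ln m / 2) ^ 2)"
      using L_ge lnm by (intro mult_left_mono divide_left_mono power_mono mult_pos_pos) auto
    also have "\<dots> = 2 ^ 26 * (real m ^ 2 / ln m ^ 2)"
      by (simp add: power_divide)
    finally show "real (min_universal_edges n m) \<le> 2 ^ 26 * (real m ^ 2 / ln m ^ 2)" .
  qed
qed

lemma sparse_upper:
  "\<exists>C>0. \<forall>n m :: nat. 2 \<le> m \<longrightarrow> real (min_universal_edges n m) \<le> C * (real m ^ 2 / ln m ^ 2)"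
proof -
  obtain m0 where m0: "\<And>m n. m0 \<le> m \<Longrightarrow>
      real (min_universal_edges n m) \<le> 2 ^ 26 * (real m ^ 2 / ln m ^ 2)"
    using sparse_upper_large by blast
  define B where "B = ln (real m0 + 2)"
  \<comment> \<open>For \<open>m < m0\<close> one has \<open>ln m \<le> B\<close>, so the second
    summand covers the bound \<open>4 * m^2\<close> there.\<close>
  define C where "C = 2 ^ 26 + 4 * B ^ 2"
  have "C > 0" by (simp add: C_def add_pos_nonneg)
  moreover have "real (min_universal_edges n m) \<le> C * (real m ^ 2 / ln m ^ 2)" if "2 \<le> m" for m n
  proof (cases "m0 \<le> m")
    case True
    have "2 ^ 26 * (real m ^ 2 / ln m ^ 2) \<le> C * (real m ^ 2 / ln m ^ 2)"
      by (intro mult_right_mono) (auto simp: C_def)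
    then show ?thesis using m0[OF True, of n] by linarith
  next
    case False
    have lnm: "0 < ln (real m)" using that by simp
    have "ln (real m) \<le> B" using False that by (simp add: B_def)
    then have "ln m ^ 2 \<le> B ^ 2" using lnm by (intro power_mono) auto
    moreover have "4 * B ^ 2 \<le> C" by (simp add: C_def)
    ultimately have "4 * ln m ^ 2 \<le> C" by linarith
    then have "4 * ln m ^ 2 * (real m ^ 2 / ln m ^ 2) \<le> C * (real m ^ 2 / ln m ^ 2)"
      by (intro mult_right_mono) auto
    moreover have "4 * ln m ^ 2 * (real m ^ 2 / ln m ^ 2) = 4 * real m ^ 2" using lnm by simp
    moreover have "real (min_universal_edges n m) \<le> real (4 * m\<^sup>2)"
      using min_universal_edges_le_4_m2[of n m] by (simp only: of_nat_le_iff)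
    ultimately show ?thesis by simp
  qed
  ultimately show ?thesis by blast
qed

theorem theorem1p2:
  fixes \<epsilon> :: real
  assumes "\<epsilon> > 0"
  shows
    "(\<exists>c>0. \<exists>C>0. \<forall>n m :: nat.
        2 \<le> m \<and> real m \<le> real n * ln (real n) \<longrightarrow>
          c * (real m ^ 2 / ln (real m) ^ 2) \<le> real (min_universal_edges n m) \<and>
          real (min_universal_edges n m) \<le> C * (real m ^ 2 / ln (real m) ^ 2))
     \<and>
     (\<exists>c>0. \<exists>C>0. \<exists>n\<^sub>0 :: nat. \<forall>n m :: nat.
        n \<ge> n\<^sub>0 \<and> real n * ln (real n) < real m \<and> real m < real n powr (3 / 2 - \<epsilon>) \<longrightarrow>
          c * (real n ^ 3 * ln (real n) / real m)
            \<le> real (n choose 2) - real (min_universal_edges n m) \<and>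
          real (n choose 2) - real (min_universal_edges n m)
            \<le> C * (real n ^ 3 * ln (real n) / real m))"
proof -
  obtain c1 where c1: "c1 > 0" "\<And>n m :: nat. 2 \<le> m \<and> real m \<le> real n * ln n \<Longrightarrow>
      c1 * (real m ^ 2 / ln m ^ 2) \<le> min_universal_edges n m"
    using sparse_lower by blast
  obtain C1 where C1: "C1 > 0" "\<And>n m :: nat. 2 \<le> m \<Longrightarrow>
      real (min_universal_edges n m) \<le> C1 * (real m ^ 2 / ln m ^ 2)"
    using sparse_upper by blast
  obtain c2 n1 where c2: "c2 > 0" "\<And>n m :: nat. n1 \<le> n \<and> real n * ln n < real m \<and>
      real m < real n powr (3 / 2 - \<epsilon>) \<Longrightarrow>
      c2 * (real n ^ 3 * ln n / m) \<le> real (n choose 2) - real (min_universal_edges n m)"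
    using dense_upper[OF assms] by blast
  \<comment> \<open>Puts \<open>m\<close>, which is below \<open>n^(3/2)\<close>, under
    \<open>n choose 2\<close> for large \<open>n\<close>, as \<open>dense_lower\<close>
    requires.\<close>
  have "eventually (\<lambda>n :: nat. n powr (3 / 2) \<le> real n * (real n - 1) / 2) at_top"
    by real_asymp
  then obtain n2 where n2: "\<And>n :: nat. n2 \<le> n \<Longrightarrow> n powr (3 / 2) \<le> real n * (real n - 1) / 2"
    by (auto simp: eventually_at_top_linorder)
  have dense: "real (n choose 2) - real (min_universal_edges n m) \<le> 1 * (real n ^ 3 * ln n / m)"
    if n: "max 2 n2 \<le> n" and m: "real n * ln n < real m" "real m < real n powr (3 / 2 - \<epsilon>)"
    for n m :: nat
  proof -
    have "0 \<le> real n * ln n" using n by simp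
    then have "1 \<le> m" using m(1) by linarith
    have "real n powr (3 / 2 - \<epsilon>) \<le> real n powr (3 / 2)"
      using n assms by (intro powr_mono) auto
    moreover have "n2 \<le> n" using n by simp
    ultimately have "real m \<le> real n * (real n - 1) / 2" using n2[of n] m(2) by linarith
    also have "\<dots> = real (n * (n - 1)) / 2" using n by (simp add: of_nat_diff)
    also have "\<dots> = real (n choose 2)" unfolding two_times_choose_two[symmetric] by simp
    finally show ?thesis using dense_lower[of n m] n \<open>1 \<le> m\<close> by simp
  qed
  show ?thesis
  proof (intro conjI)
    show "\<exists>c>0. \<exists>C>0. \<forall>n m :: nat. 2 \<le> m \<and> real m \<le> real n * ln (real n) \<longrightarrow>
          c * (real m ^ 2 / ln (real m) ^ 2) \<le> real (min_universal_edges n m) \<and>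
          real (min_universal_edges n m) \<le> C * (real m ^ 2 / ln (real m) ^ 2)"
      using c1 C1 by blast
    show "\<exists>c>0. \<exists>C>0. \<exists>n\<^sub>0 :: nat. \<forall>n m :: nat.
        n \<ge> n\<^sub>0 \<and> real n * ln (real n) < real m \<and> real m < real n powr (3 / 2 - \<epsilon>) \<longrightarrow>
          c * (real n ^ 3 * ln (real n) / real m)
            \<le> real (n choose 2) - real (min_universal_edges n m) \<and>
          real (n choose 2) - real (min_universal_edges n m)
            \<le> C * (real n ^ 3 * ln (real n) / real m)"
      by (rule exI[of _ c2], rule conjI[OF c2(1)], rule exI[of _ 1], rule conjI[OF zero_less_one],
          rule exI[of _ "max n1 (max 2 n2)"]) (use c2(2) dense in auto)
  qed
qed

end
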